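(* Let $n\ge1$ and let $m\in\left(1-\frac{1}{\sqrt{n-1}},1+\frac{1}{\sqrt{n-1}}\right)$ with $m>0$ (for $n=1$ this means no restriction other than $m>0$). Let $u$ be a positive and bounded solution of $\frac{\partial u}{\partial t}=\Delta u^m$ on $(0,\infty)\times\mathbb{R}^n$ with initial value $u_0=u(0,\cdot)$. Put $h_\pm=m\pm\sqrt{1-(n-1)(m-1)^2}$. Then for every $h\in[h_-,h_+]$ with $h\neq0$ and every $(T,x)\in(0,\infty)\times\mathbb{R}^n$, $$u^{m+h-3}|\nabla u|^2(T,x)\le\frac{\left\|u_0^h\right\|_\infty-u^h(T,x)}{Thm^2}.$$
   Context: $\|\cdot\|_\infty$ is the essential supremum norm on $\mathbb{R}^n$; $\Delta$ and $\nabla$ act on the space variables. Standing assumption: $u$ is positive, bounded and smooth on $[0,\infty)\times\mathbb{R}^n$.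
   Formalization: For h<0 the term ‖u_0^h‖_∞ is replaced by ‖u_0‖_∞^h, since the printed inequality is false there (n=1, m=1/2, h=-1/4, u_0=2+sin x, at a spatial maximum: left side 0, right side negative); for h>0 the printed formula is kept. *)

theory Defs
  imports "HOL-Probability.Essential_Supremum"
begin

text \<open>
  On a closed set such as \<open>{0..} \<times> UNIV\<close> the derivatives are taken within the set, so they are
  one-sided at the boundary. The definition is meant for convex sets with non-empty interior,
  where the derivative within the set is unique, so that \<^const>\<open>frechet_derivative\<close> is meaningful
  also at boundary points.
\<close>

primrec C_k_on :: "nat \<Rightarrow> 'a::real_normed_vector set \<Rightarrow> ('a \<Rightarrow> 'b::real_normed_vector) \<Rightarrow> bool"
  where
  "C_k_on 0 S f \<longleftrightarrow> continuous_on S f"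
| "C_k_on (Suc k) S f \<longleftrightarrow>
     f differentiable_on S \<and> (\<forall>v. C_k_on k S (\<lambda>x. frechet_derivative f (at x within S) v))"

definition smooth_on :: "'a::real_normed_vector set \<Rightarrow> ('a \<Rightarrow> 'b::real_normed_vector) \<Rightarrow> bool"
  where "smooth_on S f \<longleftrightarrow> (\<forall>k. C_k_on k S f)"

definition gradient :: "('a::real_inner \<Rightarrow> real) \<Rightarrow> 'a \<Rightarrow> 'a"
  where "gradient f x = (THE D. GDERIV f x :> D)"

definition partial_deriv :: "'n::finite \<Rightarrow> (real ^ 'n \<Rightarrow> real) \<Rightarrow> real ^ 'n \<Rightarrow> real"
  where "partial_deriv i f x = deriv (\<lambda>s. f (x + s *\<^sub>R axis i 1)) 0"

definition laplacian :: "(real ^ 'n::finite \<Rightarrow> real) \<Rightarrow> real ^ 'n \<Rightarrow> real"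
  where "laplacian f x = (\<Sum>i\<in>UNIV. partial_deriv i (partial_deriv i f) x)"

text \<open>The value is meaningful only for measurable, essentially bounded \<open>f\<close>;
  it is \<open>0\<close> where the norm would be infinite.\<close>

definition Linf_norm :: "('a::euclidean_space \<Rightarrow> real) \<Rightarrow> real"
  where "Linf_norm f = real_of_ereal (esssup lborel (\<lambda>x. ereal \<bar>f x\<bar>))"

end

theory Submission
  imports Defs
begin

text \<open>
  In the variable \<open>V = u\<^sup>m\<close> the equation reads \<open>V\<^sub>t = m V\<^sup>\<theta> \<Delta>V\<close> with \<open>\<theta> = 1 - 1/m\<close>. With \<open>k = h/m\<close> and
  \<open>\<alpha> = k + \<theta> - 2\<close>, the function
  \<open>F = \<bar>h\<bar> (t - t0) V\<^sup>\<alpha> \<bar>\<nabla>V\<bar>\<^sup>2 + sgn h V\<^sup>k\<close> is a strict subsolution of a linear parabolic equation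
  when \<open>h\<close> lies in the interior of the interval: the terms linear in \<open>\<bar>\<nabla>V\<bar>\<^sup>2\<close> cancel, and the
  remaining quartic term has the coefficient \<open>(k - 1)\<^sup>2 + (n - 1) \<theta>\<^sup>2 - (1 - \<theta>)\<^sup>2 < 0\<close>.
  As nothing is known about \<open>\<nabla>V\<close> at infinity, the gradient term of \<open>F\<close> is multiplied by \<open>\<phi>\<^sup>2\<close> with
  \<open>\<phi> = (1 + \<bar>x\<bar>\<^sup>2) powr (- \<beta>) - (1 + R\<^sup>2) powr (- \<beta>)\<close>. At a maximum of \<open>F\<close> above the
  claimed bound the quartic term absorbs the errors produced by \<open>\<phi>\<close> for small \<open>\<beta>\<close>, provided that
  \<open>t V\<^sup>\<theta> \<le> C (1 + \<bar>x\<bar>\<^sup>2)\<close> up to the right power of \<open>V\<close>. For \<open>m < 1\<close> this is a lower bound on the decay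
  of \<open>V\<close>, obtained by comparison with an explicit subsolution on an exterior domain; the
  condition on \<open>h\<close> is exactly what makes the decay rate of the subsolution sufficient.
  Then let \<open>R \<rightarrow> \<infinity>\<close>, \<open>\<beta> \<rightarrow> 0\<close>, \<open>t0 \<rightarrow> 0\<close>, and let \<open>h\<close> tend to the ends of the interval.
\<close>

section \<open>Partial derivatives of smooth functions\<close>

text \<open>The cutoff is shaped by what is known where F violates the bound: with P = |\<nabla>V|^2
  / V^2 one only gets \<phi>^2 P >= 1 / (E (1 + |x|^2)) for a fixed, possibly large E. A profile in
  |x| / R has derivatives of this same order near |x| = R, with no small factor. For (1 + |x|^2)
  powr (- \<beta>) the squared gradient and the Laplacian are bounded by constants times \<beta>^2 /
  (1 + |x|^2) and \<beta> / (1 + |x|^2), so \<beta> supplies smallness at every distance; the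
  subtracted constant makes \<phi> vanish at radius R and leaves its derivatives alone. Squaring
  \<phi> keeps |\<nabla>(\<phi>^2)|^2 / \<phi>^2 = 4 |\<nabla>\<phi>|^2 under control. The exponent
  \<alpha> is chosen so that V^\<alpha> |\<nabla>V|^2 = V^k V^\<theta> P; hence all conditions at a
  maximum can be divided by a common power of V. Starting at t0 > 0 keeps every derivative
  two-sided, and the factor t - t0 removes the gradient term initially.\<close>

abbreviation dird :: "'a::real_normed_vector \<Rightarrow> ('a \<Rightarrow> 'b::real_normed_vector) \<Rightarrow> 'a \<Rightarrow> 'b"
  where "dird v f z \<equiv> frechet_derivative f (at z) v"

text \<open>Product and chain rules identify a derivative with a formula only on \<open>S\<close>;
  this carries the remaining orders of smoothness across such an identity.\<close>

lemma C_k_on_cong: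
  assumes "open S" "C_k_on k S f" "\<And>z. z \<in> S \<Longrightarrow> f z = g z"
  shows "C_k_on k S g"
  using assms(2,3)
proof (induction k arbitrary: f g)
  case 0
  then show ?case by (simp cong: continuous_on_cong)
next
  case (Suc k)
  have f: "f differentiable at z" if "z \<in> S" for z
    using Suc.prems(1) that assms(1) by (simp add: differentiable_on_eq_differentiable_at)
  have eq: "frechet_derivative f (at z) = frechet_derivative g (at z)" if "z \<in> S" for z
    using frechet_derivative_transform_within_open[OF f[OF that] assms(1) that Suc.prems(2)] .
  have "g differentiable_on S"
  proof -
    have "g differentiable at z" if "z \<in> S" for z
    proof -
      from f[OF that] have "(f has_derivative frechet_derivative f (at z)) (at z)"
        by (simp add: frechet_derivative_works)
      from has_derivative_transform_within_open[OF this assms(1) that] Suc.prems(2)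
      have "(g has_derivative frechet_derivative f (at z)) (at z)" by simp
      then show ?thesis by (rule differentiableI)
    qed
    then show ?thesis using assms(1) by (simp add: differentiable_on_eq_differentiable_at)
  qed
  moreover have "C_k_on k S (\<lambda>z. frechet_derivative g (at z within S) v)" for v
    by (rule Suc.IH[of "\<lambda>z. frechet_derivative f (at z within S) v"])
      (use Suc.prems(1) in \<open>auto simp: at_within_open[OF _ assms(1)] eq\<close>)
  ultimately show ?case by simp
qed

lemma C_k_on_open_Suc:
  assumes "open S"
  shows "C_k_on (Suc k) S f \<longleftrightarrow> (\<forall>z\<in>S. f differentiable at z) \<and> (\<forall>v. C_k_on k S (dird v f))"
proof -
  have "C_k_on k S (\<lambda>z. frechet_derivative f (at z within S) v) \<longleftrightarrow> C_k_on k S (dird v f)" for v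
    by (rule iffI; rule C_k_on_cong[OF assms], assumption) (simp_all add: at_within_open[OF _ assms])
  then show ?thesis
    using assms by (simp add: differentiable_on_eq_differentiable_at)
qed

text \<open>At interior points \<open>at z within S\<close> is \<open>at z\<close>, so derivatives
  within the closed half space become ordinary ones. This brings the smoothness of \<open>u\<close>
  on \<open>{0..} \<times> UNIV\<close> to positive times.\<close>

lemma C_k_on_open_subset:
  assumes "open T" "T \<subseteq> S" "C_k_on k S f"
  shows "C_k_on k T f"
  using assms(3)
proof (induction k arbitrary: f)
  case 0
  then show ?case using assms(2) continuous_on_subset by auto
next
  case (Suc k)
  have eq: "at z within S = at z" if "z \<in> T" for z
    using that interior_maximal[OF assms(2,1)] by (intro at_within_interior) auto
  have "f differentiable at z" if "z \<in> T" for z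
    using Suc.prems that assms(2) unfolding C_k_on.simps(2) differentiable_on_def eq[OF that, symmetric] by auto
  moreover have "C_k_on k T (dird v f)" for v
    by (rule C_k_on_cong[OF assms(1) Suc.IH[of "\<lambda>z. frechet_derivative f (at z within S) v"]])
      (use Suc.prems in \<open>auto simp: eq\<close>)
  ultimately show ?case by (simp only: C_k_on_open_Suc[OF assms(1)]) simp
qed

lemma C_k_on_SucD:
  assumes "open S" "C_k_on (Suc k) S f"
  shows "C_k_on k S f"
  using assms(2)
proof (induction k arbitrary: f)
  case 0
  then show ?case by (simp add: differentiable_imp_continuous_on)
next
  case (Suc k)
  from Suc.prems have *: "\<forall>z\<in>S. f differentiable at z" "\<And>v. C_k_on (Suc k) S (dird v f)"
    by (auto simp only: C_k_on_open_Suc[OF assms(1)])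
  show ?case unfolding C_k_on_open_Suc[OF assms(1), of k] using * Suc.IH by simp
qed

lemma C_k_on_const: "C_k_on k S (\<lambda>z. c)" if "open S"
proof (induction k arbitrary: c)
  case (Suc k)
  then show ?case unfolding C_k_on_open_Suc[OF that] by simp
qed simp

lemma C_k_on_add:
  assumes "open S" "C_k_on k S f" "C_k_on k S g"
  shows "C_k_on k S (\<lambda>z. f z + g z)"
  using assms(2,3)
proof (induction k arbitrary: f g)
  case 0
  then show ?case by (simp add: continuous_on_add)
next
  case (Suc k)
  from Suc.prems have *: "\<forall>z\<in>S. f differentiable at z" "\<And>v. C_k_on k S (dird v f)"
      "\<forall>z\<in>S. g differentiable at z" "\<And>v. C_k_on k S (dird v g)"
    by (auto simp only: C_k_on_open_Suc[OF assms(1)])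
  have "dird v f z + dird v g z = dird v (\<lambda>z. f z + g z) z" if "z \<in> S" for v z
  proof -
    have "((\<lambda>z. f z + g z) has_derivative (\<lambda>v. dird v f z + dird v g z)) (at z)"
      using * that by (intro has_derivative_add) (auto simp: frechet_derivative_works[symmetric])
    from fun_cong[OF frechet_derivative_at[OF this]] show ?thesis .
  qed
  then have "C_k_on k S (dird v (\<lambda>z. f z + g z))" for v
    by (intro C_k_on_cong[OF assms(1) Suc.IH[OF *(2,4)]])
  then show ?case unfolding C_k_on_open_Suc[OF assms(1)] using * by auto
qed

lemma C_k_on_mult:
  fixes f g :: "'a::real_normed_vector \<Rightarrow> real"
  assumes "open S" "C_k_on k S f" "C_k_on k S g"
  shows "C_k_on k S (\<lambda>z. f z * g z)"
  using assms(2,3)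
proof (induction k arbitrary: f g)
  case 0
  then show ?case by (simp add: continuous_on_mult)
next
  case (Suc k)
  from Suc.prems have *: "\<forall>z\<in>S. f differentiable at z" "\<And>v. C_k_on k S (dird v f)"
      "\<forall>z\<in>S. g differentiable at z" "\<And>v. C_k_on k S (dird v g)"
    by (auto simp only: C_k_on_open_Suc[OF assms(1)])
  have "f z * dird v g z + dird v f z * g z = dird v (\<lambda>z. f z * g z) z" if "z \<in> S" for v z
  proof -
    have "((\<lambda>z. f z * g z) has_derivative (\<lambda>v. f z * dird v g z + dird v f z * g z)) (at z)"
      using * that by (intro has_derivative_mult) (auto simp: frechet_derivative_works[symmetric])
    from fun_cong[OF frechet_derivative_at[OF this]] show ?thesis .
  qed
  note eq = this
  have "C_k_on k S (\<lambda>z. f z * dird v g z + dird v f z * g z)" for v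
    using C_k_on_SucD[OF assms(1)] Suc.prems * by (intro C_k_on_add assms Suc.IH)
  from C_k_on_cong[OF assms(1) this eq] have "C_k_on k S (dird v (\<lambda>z. f z * g z))" for v .
  then show ?case unfolding C_k_on_open_Suc[OF assms(1)] using * by auto
qed

text \<open>The induction generalises the exponent, because the derivative contains
  \<open>f z powr (p - 1)\<close>.\<close>

lemma C_k_on_powr:
  fixes f :: "'a::real_normed_vector \<Rightarrow> real"
  assumes "open S" "C_k_on k S f" "\<And>z. z \<in> S \<Longrightarrow> f z > 0"
  shows "C_k_on k S (\<lambda>z. f z powr p)"
  using assms(2)
proof (induction k arbitrary: p)
  case 0
  then have "continuous_on S f" by simp
  then have "continuous_on S (\<lambda>z. f z powr p)"
    by (rule continuous_on_powr[OF _ continuous_on_const]) (use assms(3) in fastforce)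
  then show ?case by simp
next
  case (Suc k)
  from Suc.prems have *: "\<forall>z\<in>S. f differentiable at z" "\<And>v. C_k_on k S (dird v f)"
    by (auto simp only: C_k_on_open_Suc[OF assms(1)])
  have der: "((\<lambda>z. f z powr p) has_derivative (\<lambda>v. p * f z powr (p - 1) * dird v f z)) (at z)" if "z \<in> S" for z
  proof -
    have "((\<lambda>y. y powr p) has_derivative (\<lambda>v. p * f z powr (p - 1) * v)) (at (f z))"
      using has_real_derivative_powr[OF assms(3)[OF that], of p] by (simp add: has_field_derivative_def)
    from has_derivative_compose[where f = f and s = UNIV, OF _ this] show ?thesis
      using * that by (auto simp: frechet_derivative_works[symmetric])
  qed
  have eq: "p * f z powr (p - 1) * dird v f z = dird v (\<lambda>z. f z powr p) z" if "z \<in> S" for v z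
    using fun_cong[OF frechet_derivative_at[OF der[OF that]], of v] .
  have "C_k_on k S (\<lambda>z. p * f z powr (p - 1) * dird v f z)" for v
    using Suc.IH C_k_on_SucD[OF assms(1) Suc.prems] * by (intro C_k_on_mult C_k_on_const assms)
  from C_k_on_cong[OF assms(1) this eq] have "\<And>v. C_k_on k S (dird v (\<lambda>z. f z powr p))" .
  moreover have "\<forall>z\<in>S. (\<lambda>z. f z powr p) differentiable at z"
    using der by (auto intro: differentiableI)
  ultimately show ?case by (simp add: C_k_on_open_Suc[OF assms(1)] del: C_k_on.simps)
qed

section \<open>Restriction to lines, symmetry of second derivatives, maxima in one variable\<close>

lemma DERIV_line:
  fixes f :: "'a::real_normed_vector \<Rightarrow> real"
  assumes "f differentiable at (z + s *\<^sub>R v)"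
  shows "((\<lambda>r. f (z + r *\<^sub>R v)) has_real_derivative dird v f (z + s *\<^sub>R v)) (at s)"
proof -
  have line: "((\<lambda>r. z + r *\<^sub>R v) has_derivative (\<lambda>r. 0 + r *\<^sub>R v)) (at s)"
    by (intro has_derivative_add has_derivative_const has_derivative_scaleR_left has_derivative_ident)
  have "(f has_derivative frechet_derivative f (at (z + s *\<^sub>R v))) (at (z + s *\<^sub>R v))"
    using assms by (simp only: frechet_derivative_works)
  from has_derivative_compose[OF line this]
  have *: "((\<lambda>r. f (z + r *\<^sub>R v)) has_derivative (\<lambda>r. dird (r *\<^sub>R v) f (z + s *\<^sub>R v))) (at s)"
    by (simp only: add_0_left)
  have eq: "(\<lambda>r. dird (r *\<^sub>R v) f (z + s *\<^sub>R v)) = (*) (dird v f (z + s *\<^sub>R v))"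
  proof
    fix r show "dird (r *\<^sub>R v) f (z + s *\<^sub>R v) = dird v f (z + s *\<^sub>R v) * r"
      using linear_cmul[OF linear_frechet_derivative[OF assms], of r v] by (simp only: real_scaleR_def mult.commute)
  qed
  show ?thesis
    using * unfolding eq has_field_derivative_def .
qed

text \<open>The second difference over a parallelogram is symmetric in \<open>v\<close> and
  \<open>w\<close>. Two mean value theorems, along \<open>v\<close> and then along \<open>w\<close>,
  turn it into one mixed derivative at an inner point; exchanging the vectors gives the other
  one.\<close>

lemma double_difference_mvt:
  fixes f :: "'a::real_normed_vector \<Rightarrow> real"
  assumes d: "d > 0"
    and f: "\<And>a b. \<lbrakk>0 \<le> a; a \<le> d; 0 \<le> b; b \<le> d\<rbrakk> \<Longrightarrow> f differentiable at (z + a *\<^sub>R v + b *\<^sub>R w)"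
    and g: "\<And>a b. \<lbrakk>0 \<le> a; a \<le> d; 0 \<le> b; b \<le> d\<rbrakk> \<Longrightarrow> dird v f differentiable at (z + a *\<^sub>R v + b *\<^sub>R w)"
  shows "\<exists>a b. 0 < a \<and> a < d \<and> 0 < b \<and> b < d \<and>
    f (z + d *\<^sub>R v + d *\<^sub>R w) - f (z + d *\<^sub>R v) - f (z + d *\<^sub>R w) + f z
      = d\<^sup>2 * dird w (dird v f) (z + a *\<^sub>R v + b *\<^sub>R w)"
proof -
  define G where "G a = f ((z + d *\<^sub>R w) + a *\<^sub>R v) - f (z + a *\<^sub>R v)" for a
  have comm: "(z + d *\<^sub>R w) + a *\<^sub>R v = z + a *\<^sub>R v + d *\<^sub>R w" for a by simp
  have "\<exists>a>0. a < d \<and> G d - G 0 = (d - 0) * (dird v f ((z + d *\<^sub>R w) + a *\<^sub>R v) - dird v f (z + a *\<^sub>R v))"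
  proof (rule MVT2[OF d])
    fix a assume a: "0 \<le> a" "a \<le> d"
    show "(G has_real_derivative dird v f ((z + d *\<^sub>R w) + a *\<^sub>R v) - dird v f (z + a *\<^sub>R v)) (at a)"
      unfolding G_def
      using f[OF a, of d] f[OF a, of 0] d by (intro DERIV_diff DERIV_line) (simp_all only: comm, auto)
  qed
  then obtain a where a: "0 < a" "a < d"
    "G d - G 0 = d * (dird v f ((z + a *\<^sub>R v) + d *\<^sub>R w) - dird v f (z + a *\<^sub>R v))"
    by (auto simp: comm)
  have "\<exists>b>0. b < d \<and> dird v f ((z + a *\<^sub>R v) + d *\<^sub>R w) - dird v f ((z + a *\<^sub>R v) + 0 *\<^sub>R w)
    = (d - 0) * dird w (dird v f) ((z + a *\<^sub>R v) + b *\<^sub>R w)"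
    using g a by (intro MVT2[OF d] DERIV_line) auto
  then obtain b where b: "0 < b" "b < d" "dird v f ((z + a *\<^sub>R v) + d *\<^sub>R w) - dird v f (z + a *\<^sub>R v)
    = d * dird w (dird v f) ((z + a *\<^sub>R v) + b *\<^sub>R w)"
    by auto
  have "f (z + d *\<^sub>R v + d *\<^sub>R w) - f (z + d *\<^sub>R v) - f (z + d *\<^sub>R w) + f z = G d - G 0"
    by (simp add: G_def add_ac)
  then show ?thesis
    using a b by (auto simp: power2_eq_square)
qed

lemma dird_commute:
  fixes f :: "'a::real_normed_vector \<Rightarrow> real"
  assumes S: "open S" and f: "C_k_on 2 S f" and z: "z \<in> S"
  shows "dird w (dird v f) z = dird v (dird w f) z"
proof (rule ccontr)
  assume ne: "\<not> ?thesis"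
  define e where "e = \<bar>dird w (dird v f) z - dird v (dird w f) z\<bar> / 2"
  have e: "e > 0" using ne by (simp add: e_def)
  have 2: "(2::nat) = Suc (Suc 0)" by simp
  have diff: "\<forall>y\<in>S. f differentiable at y" "\<And>v. \<forall>y\<in>S. dird v f differentiable at y"
    and cont: "\<And>v w. continuous_on S (dird w (dird v f))"
    using f unfolding 2 C_k_on_open_Suc[OF S] by simp_all
  have "\<exists>d>0. \<forall>y. dist y z < d \<longrightarrow> y \<in> S \<and> \<bar>dird w (dird v f) y - dird w (dird v f) z\<bar> < e" for v w
  proof -
    have "\<forall>\<^sub>F y in nhds z. y \<in> S"
      using S z eventually_nhds by blast
    moreover have "\<forall>\<^sub>F y in nhds z. dist (dird w (dird v f) y) (dird w (dird v f) z) < e"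
    proof (rule tendstoD[OF _ e])
      have "isCont (dird w (dird v f)) z"
        using continuous_on_eq_continuous_at[OF S] cont z by blast
      then show "(dird w (dird v f) \<longlongrightarrow> dird w (dird v f) z) (nhds z)"
        by (simp add: tendsto_nhds_iff isCont_def)
    qed
    ultimately have "\<forall>\<^sub>F y in nhds z. y \<in> S \<and> dist (dird w (dird v f) y) (dird w (dird v f) z) < e"
      by eventually_elim simp
    then show ?thesis by (simp add: eventually_nhds_metric dist_real_def)
  qed
  from this[of w v] this[of v w] obtain d1 d2 where d1: "d1 > 0"
    "\<forall>y. dist y z < d1 \<longrightarrow> y \<in> S \<and> \<bar>dird w (dird v f) y - dird w (dird v f) z\<bar> < e"
    and d2: "d2 > 0"
    "\<forall>y. dist y z < d2 \<longrightarrow> y \<in> S \<and> \<bar>dird v (dird w f) y - dird v (dird w f) z\<bar> < e"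
    by metis
  \<comment> \<open>The parallelogram with sides \<open>d *\<^sub>R v\<close> and
    \<open>d *\<^sub>R w\<close> then stays within \<open>min d1 d2\<close> of \<open>z\<close>; the
    added 1 avoids division by zero.\<close>
  define d where "d = min d1 d2 / (norm v + norm w + 1)"
  have d: "d > 0" using d1 d2 by (simp add: d_def add_nonneg_pos)
  have near: "dist (z + a *\<^sub>R v + b *\<^sub>R w) z < min d1 d2" if "0 \<le> a" "a \<le> d" "0 \<le> b" "b \<le> d" for a b
  proof -
    have "dist (z + a *\<^sub>R v + b *\<^sub>R w) z \<le> a * norm v + b * norm w"
      using norm_triangle_ineq[of "a *\<^sub>R v" "b *\<^sub>R w"] that by (simp add: dist_norm add.assoc)
    also have "\<dots> \<le> d * norm v + d * norm w"
      using that by (intro add_mono mult_right_mono) auto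
    also have "\<dots> < d * (norm v + norm w + 1)"
      using d by (simp add: algebra_simps)
    also have "\<dots> = min d1 d2"
      using add_nonneg_pos[of "norm v + norm w" 1] by (simp add: d_def)
    finally show ?thesis .
  qed
  obtain a b where ab: "0 < a" "a < d" "0 < b" "b < d"
    "f (z + d *\<^sub>R v + d *\<^sub>R w) - f (z + d *\<^sub>R v) - f (z + d *\<^sub>R w) + f z
      = d\<^sup>2 * dird w (dird v f) (z + a *\<^sub>R v + b *\<^sub>R w)"
    using double_difference_mvt[OF d, of f z v w] diff near d1 by fastforce
  have near': "dist (z + b *\<^sub>R w + a *\<^sub>R v) z < min d1 d2" if "0 \<le> a" "a \<le> d" "0 \<le> b" "b \<le> d" for a b
    using near[OF that] by (simp add: add_ac)
  obtain a' b' where ab': "0 < a'" "a' < d" "0 < b'" "b' < d"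
    "f (z + d *\<^sub>R w + d *\<^sub>R v) - f (z + d *\<^sub>R w) - f (z + d *\<^sub>R v) + f z
      = d\<^sup>2 * dird v (dird w f) (z + a' *\<^sub>R w + b' *\<^sub>R v)"
    using double_difference_mvt[OF d, of f z w v] diff near' d1 by fastforce
  have "d\<^sup>2 * dird w (dird v f) (z + a *\<^sub>R v + b *\<^sub>R w) = d\<^sup>2 * dird v (dird w f) (z + a' *\<^sub>R w + b' *\<^sub>R v)"
  proof -
    have "z + d *\<^sub>R w + d *\<^sub>R v = z + d *\<^sub>R v + d *\<^sub>R w" by simp
    from ab'(5)[unfolded this] ab(5) show ?thesis by linarith
  qed
  then have eq: "dird w (dird v f) (z + a *\<^sub>R v + b *\<^sub>R w) = dird v (dird w f) (z + a' *\<^sub>R w + b' *\<^sub>R v)"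
    using d by simp
  have "\<bar>dird w (dird v f) (z + a *\<^sub>R v + b *\<^sub>R w) - dird w (dird v f) z\<bar> < e"
    using d1(2) near[of a b] ab by auto
  moreover have "\<bar>dird v (dird w f) (z + a' *\<^sub>R w + b' *\<^sub>R v) - dird v (dird w f) z\<bar> < e"
    using d2(2) near'[of b' a'] ab' by auto
  ultimately show False
    using abs_triangle_ineq4[of "dird v (dird w f) (z + a' *\<^sub>R w + b' *\<^sub>R v) - dird v (dird w f) z"
        "dird v (dird w f) (z + a' *\<^sub>R w + b' *\<^sub>R v) - dird w (dird v f) z"]
    unfolding eq e_def by simp
qed

text \<open>Differentiability of \<open>f'\<close> at 0 alone is enough: a positive
  \<open>f''\<close> would make \<open>f'\<close> positive just to the right of 0, and the mean
  value theorem would lift \<open>f\<close> above \<open>f 0\<close>.\<close>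

lemma local_max_DERIV2:
  fixes f f' :: "real \<Rightarrow> real"
  assumes d: "d > 0" and max: "\<And>s. \<bar>s\<bar> < d \<Longrightarrow> f s \<le> f 0"
    and f: "\<And>s. \<bar>s\<bar> < d \<Longrightarrow> (f has_real_derivative f' s) (at s)"
    and f': "(f' has_real_derivative f'') (at 0)"
  shows "f' 0 = 0" "f'' \<le> 0"
proof -
  show f'0: "f' 0 = 0"
    by (rule DERIV_local_max[OF f[of 0] d]) (use d max in auto)
  show "f'' \<le> 0"
  proof (rule ccontr)
    assume "\<not> f'' \<le> 0"
    then obtain e where e: "e > 0" "\<forall>h>0. h < e \<longrightarrow> f' 0 < f' (0 + h)"
      using DERIV_pos_inc_right[OF f'] by auto
    define r where "r = min d e / 2"
    have r: "0 < r" "r < d" "r < e" using d e by (auto simp: r_def)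
    have "\<exists>a>0. a < r \<and> f r - f 0 = (r - 0) * f' a"
      using f r by (intro MVT2) auto
    then obtain a where "0 < a" "a < r" "f r - f 0 = r * f' a" by auto
    moreover have "f' a > 0" using e calculation r f'0 by auto
    ultimately show False using max[of r] r mult_pos_pos[of r "f' a"] by linarith
  qed
qed

text \<open>One-sided, because a maximum in space-time may lie at the final time, where only earlier
  times can be compared.\<close>

lemma left_max_DERIV:
  fixes f :: "real \<Rightarrow> real"
  assumes "a < t" "\<And>s. \<lbrakk>a < s; s < t\<rbrakk> \<Longrightarrow> f s \<le> f t" "(f has_real_derivative l) (at t)"
  shows "l \<ge> 0"
proof (rule ccontr)
  assume "\<not> l \<ge> 0"
  then obtain d where d: "d > 0" "\<forall>h>0. h < d \<longrightarrow> f t < f (t - h)"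
    using DERIV_neg_dec_left[OF assms(3)] by auto
  define h where "h = min d (t - a) / 2"
  have "h > 0" "h < d" "h < t - a" using d assms(1) by (auto simp: h_def)
  with d assms(2)[of "t - h"] show False by force
qed

section \<open>The Bernstein inequality\<close>

text \<open>Among matrices with prescribed component \<open>a\<close> along \<open>g\<close>, the
  left side is largest for the one with eigenvalue \<open>a\<close> along \<open>g\<close> and
  \<open>l / 2\<close> on the orthogonal complement. Expanding the squared distance to that matrix
  gives the bound; the n - 1 complementary directions produce the dimensional term.\<close>

lemma hessian_trace_bound:
  fixes g :: "'n::finite \<Rightarrow> real" and H :: "'n \<Rightarrow> 'n \<Rightarrow> real"
  assumes P: "P = (\<Sum>i\<in>UNIV. (g i)\<^sup>2)" "P > 0"
    and a: "a * P = (\<Sum>i\<in>UNIV. \<Sum>j\<in>UNIV. g i * g j * H i j)"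
  shows "- 2 * (\<Sum>i\<in>UNIV. \<Sum>j\<in>UNIV. (H i j)\<^sup>2) + 2 * l * (\<Sum>i\<in>UNIV. H i i)
    \<le> - 2 * a\<^sup>2 + 2 * l * a + (real CARD('n) - 1) * l\<^sup>2 / 2"
proof -
  \<comment> \<open>The extremal matrix is \<open>w * x i j + l / 2 * d i j\<close>, with
    \<open>x\<close> the projection onto \<open>g\<close> and \<open>d\<close> the identity; its
    eigenvalue along \<open>g\<close> is \<open>w + l / 2 = a\<close>.\<close>
  define w where "w = a - l / 2"
  define x where "x i j = g i * g j / P" for i j
  define d where "d i j = (if i = j then 1 else 0 :: real)" for i j :: 'n
  let ?S = "\<lambda>f. \<Sum>i\<in>UNIV. \<Sum>j\<in>UNIV. (f i j :: real)"
  have "0 \<le> ?S (\<lambda>i j. (H i j - w * x i j - l / 2 * d i j)\<^sup>2)"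
    by (intro sum_nonneg) auto
  also have "\<dots> = ?S (\<lambda>i j. (H i j)\<^sup>2 + w\<^sup>2 * (x i j)\<^sup>2 + (l / 2)\<^sup>2 * (d i j)\<^sup>2
      - 2 * w * (x i j * H i j) - l * (d i j * H i j) + w * l * (d i j * x i j))"
    by (intro sum.cong refl) (simp add: power2_eq_square field_simps)
  also have "\<dots> = ?S (\<lambda>i j. (H i j)\<^sup>2) + w\<^sup>2 * ?S (\<lambda>i j. (x i j)\<^sup>2) + (l / 2)\<^sup>2 * ?S (\<lambda>i j. (d i j)\<^sup>2)
      - 2 * w * ?S (\<lambda>i j. x i j * H i j) - l * ?S (\<lambda>i j. d i j * H i j) + w * l * ?S (\<lambda>i j. d i j * x i j)"
    by (simp add: sum.distrib sum_subtractf sum_distrib_left)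
  also have "?S (\<lambda>i j. x i j * H i j) = a"
    using P(2) a by (simp add: x_def sum_divide_distrib[symmetric] mult_ac divide_simps)
  also have "?S (\<lambda>i j. (x i j)\<^sup>2) = 1"
  proof -
    have "?S (\<lambda>i j. (x i j)\<^sup>2) = P * P / P\<^sup>2"
      unfolding x_def P(1) by (simp add: sum_product power_mult_distrib power_divide sum_divide_distrib)
    then show ?thesis using P(2) by (simp add: power2_eq_square)
  qed
  also have "?S (\<lambda>i j. (d i j)\<^sup>2) = real CARD('n)"
    by (simp add: d_def if_distrib[where f = "\<lambda>x. x\<^sup>2"] cong: if_cong)
  also have "?S (\<lambda>i j. d i j * H i j) = (\<Sum>i\<in>UNIV. H i i)"
    by (simp add: d_def if_distrib[where f = "\<lambda>x. x * _"] cong: if_cong)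
  also have "?S (\<lambda>i j. d i j * x i j) = 1"
  proof -
    have "?S (\<lambda>i j. d i j * x i j) = (\<Sum>i\<in>UNIV. (g i)\<^sup>2) / P"
      unfolding sum_divide_distrib
      by (simp add: d_def x_def if_distrib[where f = "\<lambda>x. x * _"] if_distrib[where f = "\<lambda>x. x / _"] power2_eq_square cong: if_cong)
    then show ?thesis using P by simp
  qed
  finally show ?thesis
    unfolding w_def by (simp add: power2_eq_square field_simps)
qed

text \<open>With \<open>g = \<nabla>V / V\<close>, \<open>H = \<nabla>\<^sup>2V / V\<close>, \<open>G = g \<bullet> \<nabla>\<Delta>V / V\<close>, \<open>s = m (t - t0) V\<^sup>\<theta>\<close> and a cutoff \<open>\<psi>\<close>, the
  hypotheses \<open>t\<close>, \<open>x\<close> and \<open>xx\<close> say that \<open>F\<^sub>t \<ge> 0\<close>, \<open>\<nabla>F = 0\<close> and \<open>\<Delta>F \<le> 0\<close>, divided by the powers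
  of \<open>V\<close> they have in common.\<close>

lemma bernstein_identity:
  fixes g \<psi>' :: "'n::finite \<Rightarrow> real" and H :: "'n \<Rightarrow> 'n \<Rightarrow> real"
  defines "P \<equiv> \<Sum>i\<in>UNIV. (g i)\<^sup>2" and "\<tau> \<equiv> \<Sum>i\<in>UNIV. H i i"
  assumes pos: "P > 0" "s > 0" "\<psi> > 0"
    and \<alpha>: "\<alpha> = k + \<theta> - 2"
    and t: "\<psi> * (P + s * ((\<alpha> + 2 * \<theta>) * \<tau> * P + 2 * G)) + \<tau> \<ge> 0"
    and x: "\<And>j. s * (\<psi>' j * P + \<psi> * (\<alpha> * g j * P + 2 * (\<Sum>i\<in>UNIV. g i * H i j))) + g j = 0"
    and xx: "s * (\<psi>'' * P + 2 * (\<Sum>j\<in>UNIV. \<psi>' j * (\<alpha> * g j * P + 2 * (\<Sum>i\<in>UNIV. g i * H i j)))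
        + \<psi> * (\<alpha> * (\<alpha> - 1) * P\<^sup>2 + \<alpha> * \<tau> * P + 4 * \<alpha> * (\<Sum>i\<in>UNIV. \<Sum>j\<in>UNIV. g i * g j * H i j)
            + 2 * (\<Sum>i\<in>UNIV. \<Sum>j\<in>UNIV. (H i j)\<^sup>2) + 2 * G)) + (k - 1) * P + \<tau> \<le> 0"
  shows "0 \<le> (\<psi> - 1) * P
      + \<psi> * s * ((k - 1)\<^sup>2 + (real CARD('n) - 1) * \<theta>\<^sup>2 - (1 - \<theta>)\<^sup>2) * P\<^sup>2 / 2
      - (2 - k) * P * s * (\<Sum>j\<in>UNIV. g j * \<psi>' j) - s * \<psi>'' * P
      + 2 * (\<Sum>j\<in>UNIV. g j * \<psi>' j) / \<psi> + 2 * s * (\<Sum>j\<in>UNIV. (\<psi>' j)\<^sup>2) * P / \<psi>"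
proof -
  let ?h = "\<lambda>j. \<alpha> * g j * P + 2 * (\<Sum>i\<in>UNIV. g i * H i j)"
  define b where "b = (\<Sum>j\<in>UNIV. g j * \<psi>' j)"
  define e where "e = (\<Sum>j\<in>UNIV. (\<psi>' j)\<^sup>2)"
  define Q where "Q = (\<Sum>i\<in>UNIV. \<Sum>j\<in>UNIV. g i * g j * H i j)"
  define HH where "HH = (\<Sum>i\<in>UNIV. \<Sum>j\<in>UNIV. (H i j)\<^sup>2)"
  define a where "a = Q / P"
  \<comment> \<open>The gradient condition contracted with \<open>g\<close> will fix the Hessian
    component along \<open>g\<close> as \<open>- \<alpha> * P / 2 - D\<close>; \<open>D\<close>
    collects the contributions of the V^k term and of the cutoff.\<close>
  define D where "D = (1 / s + b) / (2 * \<psi>)"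
  have h: "?h j = - (g j / s + \<psi>' j * P) / \<psi>" for j
  proof -
    have "s * (\<psi> * ?h j) = s * (- (g j / s + \<psi>' j * P))"
      using x[of j] pos by (simp add: algebra_simps)
    then have "\<psi> * ?h j = - (g j / s + \<psi>' j * P)" using pos by (simp only: mult_left_cancel)
    then show ?thesis using pos by (simp add: field_simps)
  qed
  have "(\<Sum>j\<in>UNIV. \<psi>' j * ?h j) = (\<Sum>j\<in>UNIV. - (1 / (s * \<psi>)) * (g j * \<psi>' j) - P / \<psi> * (\<psi>' j)\<^sup>2)"
    unfolding h using pos by (intro sum.cong refl) (simp add: field_simps power2_eq_square)
  also have "\<dots> = - (1 / (s * \<psi>)) * b - P / \<psi> * e"
    unfolding b_def e_def sum_subtractf sum_distrib_left ..
  finally have \<psi>h: "(\<Sum>j\<in>UNIV. \<psi>' j * ?h j) = - (b / s + e * P) / \<psi>"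
    using pos by (simp add: field_simps)
  have "(\<Sum>j\<in>UNIV. g j * ?h j) = (\<Sum>j\<in>UNIV. - (1 / (s * \<psi>)) * (g j)\<^sup>2 - P / \<psi> * (g j * \<psi>' j))"
    unfolding h using pos by (intro sum.cong refl) (simp add: field_simps power2_eq_square)
  also have "\<dots> = - (1 / (s * \<psi>)) * P - P / \<psi> * b"
    unfolding b_def P_def sum_subtractf sum_distrib_left ..
  also have "\<dots> = - 2 * D * P" using pos by (simp add: D_def field_simps)
  finally have 1: "(\<Sum>j\<in>UNIV. g j * ?h j) = - 2 * D * P" .
  have "(\<Sum>j\<in>UNIV. g j * ?h j) = (\<Sum>j\<in>UNIV. \<alpha> * P * (g j)\<^sup>2 + 2 * (\<Sum>i\<in>UNIV. g i * g j * H i j))"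
    by (intro sum.cong refl) (simp add: algebra_simps power2_eq_square sum_distrib_left)
  also have "\<dots> = \<alpha> * P * P + 2 * (\<Sum>j\<in>UNIV. \<Sum>i\<in>UNIV. g i * g j * H i j)"
    unfolding P_def by (simp add: sum.distrib sum_distrib_left)
  also have "(\<Sum>j\<in>UNIV. \<Sum>i\<in>UNIV. g i * g j * H i j) = Q"
    unfolding Q_def by (rule sum.swap)
  finally have Q: "Q = a * P" "a = - \<alpha> * P / 2 - D"
    using 1 pos by (auto simp: a_def field_simps)
  have HH: "- 2 * HH + 2 * (\<theta> * P) * \<tau> \<le> - 2 * a\<^sup>2 + 2 * (\<theta> * P) * a + (real CARD('n) - 1) * (\<theta> * P)\<^sup>2 / 2"
    unfolding HH_def \<tau>_def
    by (rule hessian_trace_bound[OF P_def[THEN meta_eq_to_obj_eq] pos(1) Q(1)[symmetric, unfolded Q_def]])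
  define Y where "Y = (b / s + e * P) / \<psi>"
  have mY: "- (b / s + e * P) / \<psi> = - Y" by (simp only: Y_def minus_divide_left)
  have sY: "s * Y = b / \<psi> + s * e * P / \<psi>"
    using pos by (simp add: Y_def field_simps)
  define \<kappa> where "\<kappa> = (k - 1)\<^sup>2 + (real CARD('n) - 1) * \<theta>\<^sup>2 - (1 - \<theta>)\<^sup>2"
  define Z where "Z = \<alpha> * (\<alpha> - 1) * P\<^sup>2 + 4 * \<alpha> * (a * P)"
  have xx': "s * (\<psi>'' * P - 2 * Y + \<psi> * (Z + \<alpha> * \<tau> * P + 2 * HH + 2 * G)) + (k - 1) * P + \<tau> \<le> 0"
    using xx unfolding \<psi>h mY Q_def[symmetric] HH_def[symmetric] Q(1) Z_def by (simp add: add_ac)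
  \<comment> \<open>Subtracting the space condition from the time condition cancels the third
    derivatives \<open>G\<close>, the isolated \<open>\<tau>\<close> and the terms with
    \<open>\<alpha> * \<tau> * P\<close>. Only \<open>2 * \<theta> * \<tau> * P\<close> remains of
    the trace, hence the trace bound with \<open>l = \<theta> * P\<close>.\<close>
  have "0 \<le> (\<psi> * (P + s * ((\<alpha> + 2 * \<theta>) * \<tau> * P + 2 * G)) + \<tau>)
      - (s * (\<psi>'' * P - 2 * Y + \<psi> * (Z + \<alpha> * \<tau> * P + 2 * HH + 2 * G)) + (k - 1) * P + \<tau>)"
    using t xx' by linarith
  also have "\<dots> = (\<psi> - k + 1) * P - s * \<psi>'' * P + 2 * (s * Y)
      + \<psi> * s * ((- 2 * HH + 2 * (\<theta> * P) * \<tau>) - Z)"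
    by (simp add: algebra_simps)
  also have "\<dots> \<le> (\<psi> - k + 1) * P - s * \<psi>'' * P + 2 * (s * Y)
      + \<psi> * s * ((- 2 * a\<^sup>2 + 2 * (\<theta> * P) * a + (real CARD('n) - 1) * (\<theta> * P)\<^sup>2 / 2) - Z)"
    using HH pos by (intro add_left_mono mult_left_mono diff_right_mono) auto
  \<comment> \<open>Completing the square in \<alpha>:
    \<open>\<alpha> + 1 - \<theta> = k - 1\<close>, and the products \<open>P * D\<close> acquire
    the factor \<open>2 * \<alpha> - 2 * \<theta> = 2 * k - 4\<close>.\<close>
  also have "(- 2 * a\<^sup>2 + 2 * (\<theta> * P) * a + (real CARD('n) - 1) * (\<theta> * P)\<^sup>2 / 2) - Z
      = \<kappa> * P\<^sup>2 / 2 - (4 - 2 * k) * P * D - 2 * D\<^sup>2"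
    unfolding Q(2) \<alpha> \<kappa>_def Z_def by (simp add: power2_eq_square field_simps)
  also have "\<psi> * s * (\<kappa> * P\<^sup>2 / 2 - (4 - 2 * k) * P * D - 2 * D\<^sup>2)
      \<le> \<psi> * s * (\<kappa> * P\<^sup>2 / 2) - (4 - 2 * k) * P * (\<psi> * s * D)"
    using pos by (simp add: right_diff_distrib)
  \<comment> \<open>This turns \<open>(4 - 2 * k) * P\<close> into \<open>(2 - k) * P\<close>, so
    the terms linear in \<open>P\<close> add up to \<open>(\<psi> - 1) * P\<close>: zero without
    cutoff, nonpositive for \<psi> at most 1.\<close>
  also have "\<psi> * s * D = (1 + s * b) / 2"
    using pos by (simp add: D_def field_simps)
  finally have "0 \<le> (\<psi> - k + 1) * P - s * \<psi>'' * P + 2 * (b / \<psi> + s * e * P / \<psi>)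
      + (\<psi> * s * (\<kappa> * P\<^sup>2 / 2) - (4 - 2 * k) * P * ((1 + s * b) / 2))"
    unfolding sY by simp
  also have "\<dots> = (\<psi> - 1) * P + \<psi> * s * \<kappa> * P\<^sup>2 / 2 - (2 - k) * P * s * b - s * \<psi>'' * P
      + 2 * b / \<psi> + 2 * s * e * P / \<psi>"
    by (simp add: algebra_simps add_divide_distrib)
  finally show ?thesis
    unfolding b_def[symmetric] e_def[symmetric] \<kappa>_def[symmetric] .
qed

text \<open>All errors are measured against X = \<phi>^2 s P^2, the size of the negative quartic
  term. Cauchy-Schwarz and the bounds on the derivatives of \<phi> make each a multiple of
  \<epsilon> X. The term 4 b / \<phi> carries no factor \<open>s\<close>; the lower bound
  \<open>c\<close> on \<phi>^2 s P supplies it.\<close>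

lemma bernstein_contradiction:
  fixes g \<phi>' :: "'n::finite \<Rightarrow> real" and H :: "'n \<Rightarrow> 'n \<Rightarrow> real"
    and \<phi> \<phi>'' :: real
  defines "P \<equiv> \<Sum>i\<in>UNIV. (g i)\<^sup>2" and "\<tau> \<equiv> \<Sum>i\<in>UNIV. H i i"
    and "\<psi>' \<equiv> \<lambda>j. 2 * \<phi> * \<phi>' j"
    and "\<psi>'' \<equiv> 2 * (\<Sum>j\<in>UNIV. (\<phi>' j)\<^sup>2) + 2 * \<phi> * \<phi>''"
    and "\<psi> \<equiv> \<phi>\<^sup>2"
  assumes pos: "P > 0" "s > 0" "0 < \<phi>" "\<phi> \<le> 1"
    and \<alpha>: "\<alpha> = k + \<theta> - 2"
    and t: "\<psi> * (P + s * ((\<alpha> + 2 * \<theta>) * \<tau> * P + 2 * G)) + \<tau> \<ge> 0"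
    and x: "\<And>j. s * (\<psi>' j * P + \<psi> * (\<alpha> * g j * P + 2 * (\<Sum>i\<in>UNIV. g i * H i j))) + g j = 0"
    and xx: "s * (\<psi>'' * P + 2 * (\<Sum>j\<in>UNIV. \<psi>' j * (\<alpha> * g j * P + 2 * (\<Sum>i\<in>UNIV. g i * H i j)))
        + \<psi> * (\<alpha> * (\<alpha> - 1) * P\<^sup>2 + \<alpha> * \<tau> * P + 4 * \<alpha> * (\<Sum>i\<in>UNIV. \<Sum>j\<in>UNIV. g i * g j * H i j)
            + 2 * (\<Sum>i\<in>UNIV. \<Sum>j\<in>UNIV. (H i j)\<^sup>2) + 2 * G)) + (k - 1) * P + \<tau> \<le> 0"
    and \<kappa>: "(k - 1)\<^sup>2 + (real CARD('n) - 1) * \<theta>\<^sup>2 - (1 - \<theta>)\<^sup>2 \<le> - \<kappa>"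
    and \<epsilon>: "0 < \<epsilon>" "\<epsilon> \<le> 1" "\<epsilon> * (2 * \<bar>2 - k\<bar> + 12 + 4 / c) < \<kappa> / 2"
    and c: "0 < c" "c \<le> \<phi>\<^sup>2 * s * P"
    and d: "(\<Sum>j\<in>UNIV. (\<phi>' j)\<^sup>2) \<le> \<epsilon>\<^sup>2 * (\<phi>\<^sup>2 * P)" "\<bar>\<phi>''\<bar> \<le> \<epsilon> * (\<phi>\<^sup>2 * P)"
  shows False
proof -
  define b where "b = (\<Sum>j\<in>UNIV. g j * \<phi>' j)"
  define e where "e = (\<Sum>j\<in>UNIV. (\<phi>' j)\<^sup>2)"
  define X where "X = \<phi>\<^sup>2 * s * P\<^sup>2"
  have X: "X > 0" using pos by (simp add: X_def)
  have \<psi>: "\<psi> > 0" using pos by (simp add: \<psi>_def)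
  have \<phi>2: "\<phi>\<^sup>2 \<le> 1" using pos by (simp add: power_le_one)
  have "b\<^sup>2 \<le> P * e"
    unfolding b_def e_def P_def by (rule Cauchy_Schwarz_ineq_sum)
  also have "\<dots> \<le> P * (\<epsilon>\<^sup>2 * (\<phi>\<^sup>2 * P))"
    using d pos by (intro mult_left_mono) (auto simp: e_def)
  also have "\<dots> = (\<epsilon> * \<phi> * P)\<^sup>2" by (simp add: power2_eq_square)
  finally have b: "\<bar>b\<bar> \<le> \<epsilon> * \<phi> * P"
    using pos \<epsilon> by (intro power2_le_imp_le[of "\<bar>b\<bar>"]) auto
  have sums: "(\<Sum>j\<in>UNIV. g j * \<psi>' j) = 2 * \<phi> * b" "(\<Sum>j\<in>UNIV. (\<psi>' j)\<^sup>2) = 4 * \<phi>\<^sup>2 * e"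
    unfolding \<psi>'_def b_def e_def by (simp_all add: sum_distrib_left mult_ac power_mult_distrib)
  have "0 \<le> (\<psi> - 1) * P
      + \<psi> * s * ((k - 1)\<^sup>2 + (real CARD('n) - 1) * \<theta>\<^sup>2 - (1 - \<theta>)\<^sup>2) * P\<^sup>2 / 2
      - (2 - k) * P * s * (2 * \<phi> * b) - s * \<psi>'' * P
      + 2 * (2 * \<phi> * b) / \<psi> + 2 * s * (4 * \<phi>\<^sup>2 * e) * P / \<psi>"
    using bernstein_identity[OF pos(1)[unfolded P_def] pos(2) \<psi> \<alpha> t[unfolded P_def \<tau>_def] x[unfolded P_def \<tau>_def] xx[unfolded P_def \<tau>_def]]
    unfolding sums P_def[symmetric] .
  also have "\<dots> = (\<psi> - 1) * P + ((k - 1)\<^sup>2 + (real CARD('n) - 1) * \<theta>\<^sup>2 - (1 - \<theta>)\<^sup>2) * (X / 2)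
      - 2 * (2 - k) * (P * s * \<phi> * b) - s * (2 * e + 2 * \<phi> * \<phi>'') * P
      + 4 * b / \<phi> + 8 * (s * e * P)"
  proof -
    have "2 * (2 * \<phi> * b) / \<psi> = 4 * b / \<phi>" "2 * s * (4 * \<phi>\<^sup>2 * e) * P / \<psi> = 8 * (s * e * P)"
      using pos by (simp_all add: \<psi>_def power2_eq_square)
    moreover have "\<psi> * s * K * P\<^sup>2 / 2 = K * (X / 2)" for K
      by (simp add: \<psi>_def X_def)
    moreover have "(2 - k) * P * s * (2 * \<phi> * b) = 2 * (2 - k) * (P * s * \<phi> * b)"
      by (simp only: mult_ac)
    ultimately show ?thesis
      unfolding \<psi>''_def e_def[symmetric] by (simp only:)
  qed
  also have "\<dots> \<le> 0 + (- \<kappa>) * (X / 2) + 2 * \<bar>2 - k\<bar> * (\<epsilon> * X) + 2 * (\<epsilon> * X)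
      + (4 / c) * (\<epsilon> * X) + 8 * (\<epsilon> * X)"
  proof -
    have "(\<psi> - 1) * P \<le> 0" using \<phi>2 pos by (simp add: \<psi>_def mult_nonpos_nonneg)
    moreover have "((k - 1)\<^sup>2 + (real CARD('n) - 1) * \<theta>\<^sup>2 - (1 - \<theta>)\<^sup>2) * (X / 2) \<le> (- \<kappa>) * (X / 2)"
      using \<kappa> X by (intro mult_right_mono) auto
    moreover have "- 2 * (2 - k) * (P * s * \<phi> * b) \<le> 2 * \<bar>2 - k\<bar> * (\<epsilon> * X)"
    proof -
      have "\<bar>P * s * \<phi> * b\<bar> \<le> P * s * \<phi> * (\<epsilon> * \<phi> * P)"
        using b pos by (simp add: abs_mult)
      also have "\<dots> = \<epsilon> * X" by (simp add: X_def power2_eq_square)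
      finally have "\<bar>2 - k\<bar> * \<bar>P * s * \<phi> * b\<bar> \<le> \<bar>2 - k\<bar> * (\<epsilon> * X)" by (intro mult_left_mono) auto
      then have "\<bar>(2 - k) * (P * s * \<phi> * b)\<bar> \<le> \<bar>2 - k\<bar> * (\<epsilon> * X)" by (simp only: abs_mult)
      then show ?thesis using abs_ge_minus_self[of "(2 - k) * (P * s * \<phi> * b)"] by linarith
    qed
    \<comment> \<open>The part with \<open>e\<close> has the good sign, so only
      \<open>\<phi>''\<close> has to be estimated.\<close>
    moreover have "- s * (2 * e + 2 * \<phi> * \<phi>'') * P \<le> 2 * (\<epsilon> * X)"
    proof -
      have "- (\<phi> * \<phi>'') \<le> \<phi> * \<bar>\<phi>''\<bar>" using abs_ge_minus_self[of "\<phi> * \<phi>''"] pos by (simp add: abs_mult)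
      also have "\<dots> \<le> \<bar>\<phi>''\<bar>" using pos by (simp add: mult_left_le_one_le)
      also have "\<dots> \<le> \<epsilon> * (\<phi>\<^sup>2 * P)" by (rule d)
      finally have "- (2 * e + 2 * \<phi> * \<phi>'') \<le> 2 * (\<epsilon> * (\<phi>\<^sup>2 * P))"
        using sum_nonneg[of UNIV "\<lambda>j. (\<phi>' j)\<^sup>2"] by (simp add: e_def)
      then have "s * P * - (2 * e + 2 * \<phi> * \<phi>'') \<le> s * P * (2 * (\<epsilon> * (\<phi>\<^sup>2 * P)))"
        using pos by (intro mult_left_mono) auto
      then show ?thesis by (simp add: X_def power2_eq_square algebra_simps)
    qed
    moreover have "4 * b / \<phi> \<le> (4 / c) * (\<epsilon> * X)"
    proof -
      have "b / \<phi> \<le> \<epsilon> * P" using b pos by (simp add: field_simps)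
      also have "\<dots> \<le> \<epsilon> * P * (\<phi>\<^sup>2 * s * P / c)"
        using mult_left_mono[of 1 "\<phi>\<^sup>2 * s * P / c" "\<epsilon> * P"] c pos \<epsilon> by simp
      finally have "b / \<phi> \<le> \<epsilon> * X / c" by (simp add: X_def power2_eq_square mult_ac)
      moreover have "4 * b / \<phi> = 4 * (b / \<phi>)" "(4 / c) * (\<epsilon> * X) = 4 * (\<epsilon> * X / c)" by simp_all
      ultimately show ?thesis by linarith
    qed
    moreover have "8 * (s * e * P) \<le> 8 * (\<epsilon> * X)"
    proof -
      have "e \<le> \<epsilon>\<^sup>2 * (\<phi>\<^sup>2 * P)" using d by (simp add: e_def)
      also have "\<dots> \<le> \<epsilon> * (\<phi>\<^sup>2 * P)"
        using \<epsilon> pos by (intro mult_right_mono) (auto simp: power2_eq_square mult_left_le)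
      finally have "s * P * e \<le> s * P * (\<epsilon> * (\<phi>\<^sup>2 * P))" using pos by (intro mult_left_mono) auto
      then show ?thesis by (simp add: X_def power2_eq_square algebra_simps)
    qed
    ultimately show ?thesis by linarith
  qed
  \<comment> \<open>The error constants are 2 |2 - k|, 2, 4 / c and 8; the assumed 12 covers the 2
    and the 8.\<close>
  also have "\<dots> \<le> X * (\<epsilon> * (2 * \<bar>2 - k\<bar> + 12 + 4 / c) - \<kappa> / 2)"
    using \<epsilon> X by (simp add: algebra_simps)
  also have "\<dots> < 0"
    using \<epsilon> X by (intro mult_pos_neg) auto
  finally show False by simp
qed

section \<open>Derivatives of F along lines in time and space\<close>

lemma DERIV_powr_chain:
  fixes w :: "real \<Rightarrow> real"
  assumes "(w has_real_derivative w') (at s)" "w s > 0"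
  shows "((\<lambda>s. w s powr a) has_real_derivative a * w s powr (a - 1) * w') (at s)"
  using DERIV_chain2[OF has_real_derivative_powr[OF assms(2)] assms(1)] .

lemma DERIV_sum_squares:
  fixes g :: "'n::finite \<Rightarrow> real \<Rightarrow> real"
  assumes "\<And>i. (g i has_real_derivative g' i) (at s)"
  shows "((\<lambda>s. \<Sum>i\<in>UNIV. (g i s)\<^sup>2) has_real_derivative 2 * (\<Sum>i\<in>UNIV. g i s * g' i)) (at s)"
proof -
  have "((\<lambda>s. \<Sum>i\<in>UNIV. (g i s)\<^sup>2) has_real_derivative (\<Sum>i\<in>UNIV. 2 * (g i s * g' i))) (at s)"
    by (intro DERIV_sum) (use assms in \<open>auto intro!: derivative_eq_intros\<close>)
  then show ?thesis by (simp only: sum_distrib_left)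
qed

lemma DERIV_sum_mult:
  fixes g :: "'n::finite \<Rightarrow> real \<Rightarrow> real"
  assumes "\<And>i. (g i has_real_derivative g' i) (at s)" "\<And>i. (f i has_real_derivative f' i) (at s)"
  shows "((\<lambda>s. \<Sum>i\<in>UNIV. g i s * f i s) has_real_derivative (\<Sum>i\<in>UNIV. g' i * f i s + g i s * f' i)) (at s)"
  by (intro DERIV_sum) (use assms in \<open>auto intro!: derivative_eq_intros\<close>)

text \<open>One formula for both kinds of lines: in time \<open>A\<close> is affine and
  \<open>\<phi>\<close> constant, along a coordinate axis \<open>A\<close> is constant and
  \<open>\<phi>\<close> varies.\<close>

lemma DERIV_bernstein:
  fixes g :: "'n::finite \<Rightarrow> real \<Rightarrow> real"
  assumes "w s > 0" "(w has_real_derivative w') (at s)" "(\<phi> has_real_derivative \<phi>') (at s)"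
    "(A has_real_derivative A') (at s)" "\<And>i. (g i has_real_derivative g' i) (at s)"
  shows "((\<lambda>s. (\<phi> s)\<^sup>2 * A s * (w s powr a * (\<Sum>i\<in>UNIV. (g i s)\<^sup>2)) + B * w s powr k) has_real_derivative
    (2 * \<phi> s * \<phi>' * A s + (\<phi> s)\<^sup>2 * A') * (w s powr a * (\<Sum>i\<in>UNIV. (g i s)\<^sup>2))
    + (\<phi> s)\<^sup>2 * A s * (a * w s powr (a - 1) * w' * (\<Sum>i\<in>UNIV. (g i s)\<^sup>2) + 2 * w s powr a * (\<Sum>i\<in>UNIV. g i s * g' i))
    + B * k * w s powr (k - 1) * w') (at s)"
proof -
  note [derivative_intros] = DERIV_powr_chain[OF assms(2,1)] DERIV_sum_squares[of g g', OF assms(5)] assms(2-4)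
  show ?thesis
    by (rule derivative_eq_intros refl | simp)+ (simp add: algebra_simps)
qed

lemma DERIV2_bernstein:
  fixes g :: "'n::finite \<Rightarrow> real \<Rightarrow> real"
  assumes "w s > 0" "(w has_real_derivative w' s) (at s)" "(\<phi> has_real_derivative \<phi>' s) (at s)"
    "\<And>i. (g i has_real_derivative g' i s) (at s)"
    "(w' has_real_derivative w'') (at s)" "(\<phi>' has_real_derivative \<phi>'') (at s)"
    "\<And>i. (g' i has_real_derivative g'' i) (at s)"
  defines "p \<equiv> \<Sum>i\<in>UNIV. (g i s)\<^sup>2" and "q \<equiv> \<Sum>i\<in>UNIV. g i s * g' i s"
  shows "((\<lambda>s. 2 * \<phi> s * \<phi>' s * A * (w s powr a * (\<Sum>i\<in>UNIV. (g i s)\<^sup>2))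
    + (\<phi> s)\<^sup>2 * A * (a * w s powr (a - 1) * w' s * (\<Sum>i\<in>UNIV. (g i s)\<^sup>2) + 2 * w s powr a * (\<Sum>i\<in>UNIV. g i s * g' i s))
    + B * k * w s powr (k - 1) * w' s) has_real_derivative
    A * ((2 * (\<phi>' s)\<^sup>2 + 2 * \<phi> s * \<phi>'') * (w s powr a * p)
      + 4 * \<phi> s * \<phi>' s * (a * w s powr (a - 1) * w' s * p + 2 * w s powr a * q)
      + (\<phi> s)\<^sup>2 * (a * (a - 1) * w s powr (a - 2) * (w' s)\<^sup>2 * p + a * w s powr (a - 1) * w'' * p
          + 4 * a * w s powr (a - 1) * w' s * q
          + 2 * w s powr a * (\<Sum>i\<in>UNIV. (g' i s)\<^sup>2 + g i s * g'' i)))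
    + B * k * ((k - 1) * w s powr (k - 2) * (w' s)\<^sup>2 + w s powr (k - 1) * w'')) (at s)"
proof -
  have 1: "((\<lambda>s. w s powr a) has_real_derivative a * w s powr (a - 1) * w' s) (at s)"
    and 2: "((\<lambda>s. w s powr (a - 1)) has_real_derivative (a - 1) * w s powr (a - 2) * w' s) (at s)"
    and 3: "((\<lambda>s. w s powr (k - 1)) has_real_derivative (k - 1) * w s powr (k - 2) * w' s) (at s)"
    using DERIV_powr_chain[OF assms(2,1), of a] DERIV_powr_chain[OF assms(2,1), of "a - 1"]
      DERIV_powr_chain[OF assms(2,1), of "k - 1"] by (simp_all add: algebra_simps)
  have 4: "((\<lambda>s. \<Sum>i\<in>UNIV. (g i s)\<^sup>2) has_real_derivative 2 * q) (at s)"
    unfolding q_def by (rule DERIV_sum_squares) (rule assms)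
  have 5: "((\<lambda>s. \<Sum>i\<in>UNIV. g i s * g' i s) has_real_derivative (\<Sum>i\<in>UNIV. (g' i s)\<^sup>2 + g i s * g'' i)) (at s)"
    using DERIV_sum_mult[of g "\<lambda>i. g' i s" s g' g'', OF assms(4,7)] by (simp only: power2_eq_square)
  show ?thesis
    by (rule DERIV_cong, (rule derivative_intros 1 2 3 4 5 assms(2,3,5,6))+,
       fold p_def q_def, simp add: algebra_simps power2_eq_square)
qed

section \<open>The equation of the pressure variable\<close>

abbreviation tvec :: "real \<times> (real ^ 'n)" where "tvec \<equiv> (1, 0)"
abbreviation xvec :: "'n \<Rightarrow> real \<times> (real ^ 'n)" where "xvec i \<equiv> (0, axis i 1)"

lemma DERIV_x_line:
  fixes f :: "real \<times> (real ^ 'n) \<Rightarrow> real"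
  assumes "f differentiable at (t, x + s *\<^sub>R axis j 1)"
  shows "((\<lambda>r. f (t, x + r *\<^sub>R axis j 1)) has_real_derivative dird (xvec j) f (t, x + s *\<^sub>R axis j 1)) (at s)"
  using DERIV_line[of f "(t, x)" s "xvec j"] assms by simp

lemma DERIV_t_line:
  fixes f :: "real \<times> (real ^ 'n) \<Rightarrow> real"
  assumes "f differentiable at (t, x)"
  shows "((\<lambda>r. f (r, x)) has_real_derivative dird tvec f (t, x)) (at t)"
  using DERIV_line[of f "(0, x)" t tvec] assms by simp

lemma open_dom: "open ({0<..} \<times> UNIV :: (real \<times> (real ^ 'n::finite)) set)"
  by (intro open_Times) auto

lemma C_k_on_SucD_diff:
  fixes f :: "real \<times> (real ^ 'n) \<Rightarrow> real"
  assumes "C_k_on (Suc k) ({0<..} \<times> UNIV) f" "t > 0"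
  shows "f differentiable at (t, x)"
proof -
  have "\<forall>z\<in>{0<..} \<times> UNIV. f differentiable at z"
    using assms(1) unfolding C_k_on_open_Suc[OF open_dom] by (rule conjunct1)
  then show ?thesis using assms(2) by simp
qed

text \<open>Three derivatives are required because F contains \<nabla>V and the test at a maximum
  differentiates twice more in space. Only positive times occur, so that all derivatives are
  two-sided.\<close>

locale pressure_eq =
  fixes V :: "real \<times> (real ^ 'n::finite) \<Rightarrow> real" and m \<theta> :: real
  assumes smooth: "C_k_on 3 ({0<..} \<times> UNIV) V"
    and pos: "\<And>t x. t > 0 \<Longrightarrow> V (t, x) > 0"
    and m_pos: "m > 0"
    and eq: "\<And>t x. t > 0 \<Longrightarrow> dird tvec V (t, x)
      = m * V (t, x) powr \<theta> * (\<Sum>i\<in>UNIV. dird (xvec i) (dird (xvec i) V) (t, x))"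
begin

abbreviation D1 :: "'n \<Rightarrow> real \<times> (real ^ 'n) \<Rightarrow> real"
  where "D1 i \<equiv> dird (xvec i) V"
abbreviation D2 :: "'n \<Rightarrow> 'n \<Rightarrow> real \<times> (real ^ 'n) \<Rightarrow> real"
  where "D2 i j \<equiv> dird (xvec j) (dird (xvec i) V)"

lemma C2: "C_k_on 2 ({0<..} \<times> UNIV) (dird v V)"
proof -
  have "C_k_on (Suc 2) ({0<..} \<times> UNIV) V" using smooth by (simp only: Suc_numeral semiring_norm)
  then show ?thesis by (simp only: C_k_on_open_Suc[OF open_dom])
qed

lemma C1: "C_k_on 1 ({0<..} \<times> UNIV) (dird w (dird v V))"
proof -
  have "C_k_on (Suc 1) ({0<..} \<times> UNIV) (dird v V)" using C2[of v] by (simp only: Suc_1)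
  then show ?thesis by (simp only: C_k_on_open_Suc[OF open_dom])
qed

lemma diff0: "t > 0 \<Longrightarrow> V differentiable at (t, x)"
  using C_k_on_SucD_diff[of 2 V] smooth by (simp only: Suc_numeral semiring_norm)

lemma diff1: "t > 0 \<Longrightarrow> dird v V differentiable at (t, x)"
  using C_k_on_SucD_diff[of 1 "dird v V"] C2[of v] by (simp only: Suc_1)

lemma diff2: "t > 0 \<Longrightarrow> dird w (dird v V) differentiable at (t, x)"
  by (rule C_k_on_SucD_diff[OF C1[unfolded One_nat_def]])

lemma comm: "t > 0 \<Longrightarrow> dird w (dird v V) (t, x) = dird v (dird w V) (t, x)"
  by (rule dird_commute[OF open_dom]) (use C_k_on_SucD[OF open_dom, of 2 V] smooth in \<open>auto simp only: Suc_numeral semiring_norm mem_Times_iff fst_conv snd_conv greaterThan_iff UNIV_I\<close>)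

text \<open>Turns the gradient of the Laplacian into the Laplacian of the gradient, the form in
  which third derivatives also appear in the space derivatives of F.\<close>

lemma comm3:
  assumes "t > 0"
  shows "dird w (dird v (dird v V)) (t, x) = dird v (dird v (dird w V)) (t, x)"
proof -
  have "dird w (dird v (dird v V)) (t, x) = dird v (dird w (dird v V)) (t, x)"
    by (rule dird_commute[OF open_dom C2]) (use assms in auto)
  \<comment> \<open>Symmetry is an identity of functions on the open domain, so it may be
    differentiated once more.\<close>
  also have "frechet_derivative (dird w (dird v V)) (at (t, x)) = frechet_derivative (dird v (dird w V)) (at (t, x))"
    by (rule frechet_derivative_transform_within_open[OF diff2[OF assms] open_dom])
      (use assms in \<open>auto intro: comm\<close>)
  finally show ?thesis .
qed

lemma time_deriv_gradient:
  assumes t: "t > 0"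
  shows "dird tvec (D1 i) (t, x) = m * \<theta> * V (t, x) powr (\<theta> - 1) * D1 i (t, x) * (\<Sum>j\<in>UNIV. D2 j j (t, x))
    + m * V (t, x) powr \<theta> * (\<Sum>j\<in>UNIV. dird (xvec j) (D2 i j) (t, x))"
proof -
  let ?l = "\<lambda>r. (t, x + r *\<^sub>R axis i 1)"
  have V: "((\<lambda>r. V (?l r)) has_real_derivative D1 i (t, x)) (at 0)"
    using DERIV_x_line[of V t x 0 i] diff0[OF t] by simp
  have L: "((\<lambda>r. \<Sum>j\<in>UNIV. D2 j j (?l r)) has_real_derivative (\<Sum>j\<in>UNIV. dird (xvec i) (D2 j j) (t, x))) (at 0)"
    using DERIV_x_line[OF diff2[OF t], where x = x and s = 0 and j = i] by (intro DERIV_sum) simp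
  have 1: "((\<lambda>r. m * V (?l r) powr \<theta> * (\<Sum>j\<in>UNIV. D2 j j (?l r))) has_real_derivative
      (m * (\<theta> * V (?l 0) powr (\<theta> - 1) * D1 i (t, x))) * (\<Sum>j\<in>UNIV. D2 j j (?l 0))
      + (\<Sum>j\<in>UNIV. dird (xvec i) (D2 j j) (t, x)) * (m * V (?l 0) powr \<theta>)) (at 0)"
    by (rule DERIV_mult[OF DERIV_cmult[OF DERIV_powr_chain[OF V]] L]) (simp add: pos t)
  have 2: "((\<lambda>r. dird tvec V (?l r)) has_real_derivative dird (xvec i) (dird tvec V) (t, x)) (at 0)"
    using DERIV_x_line[OF diff1[OF t], where x = x and s = 0 and j = i] by simp
  have "(\<lambda>r. m * V (?l r) powr \<theta> * (\<Sum>j\<in>UNIV. D2 j j (?l r))) = (\<lambda>r. dird tvec V (?l r))"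
    using eq[OF t] by simp
  from DERIV_unique[OF 1[unfolded this] 2]
  have "dird (xvec i) (dird tvec V) (t, x) = (m * (\<theta> * V (t, x) powr (\<theta> - 1) * D1 i (t, x))) * (\<Sum>j\<in>UNIV. D2 j j (t, x))
      + (\<Sum>j\<in>UNIV. dird (xvec i) (D2 j j) (t, x)) * (m * V (t, x) powr \<theta>)"
    by simp
  moreover have "(\<Sum>j\<in>UNIV. dird (xvec i) (D2 j j) (t, x)) = (\<Sum>j\<in>UNIV. dird (xvec j) (D2 i j) (t, x))"
    by (intro sum.cong refl comm3[OF t])
  moreover have "dird tvec (D1 i) (t, x) = dird (xvec i) (dird tvec V) (t, x)"
    by (rule comm[OF t])
  ultimately show ?thesis by simp
qed

text \<open>After division by V the derivatives become \<open>g\<close>, \<open>H\<close>,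
  \<open>K\<close> and the powers of V collect into one positive factor, so a maximum yields the
  hypotheses of \<open>bernstein_contradiction\<close>. The factor \<open>\<sigma>\<close> plays the
  part of \<open>sgn k\<close>; it makes the coefficient of the differentiated power term
  \<open>\<bar>k\<bar>\<close>, positive for either sign of \<open>k\<close>.\<close>

lemma no_interior_max:
  fixes \<phi> :: "real ^ 'n \<Rightarrow> real" and F :: "real \<Rightarrow> real ^ 'n \<Rightarrow> real"
  assumes \<phi>': "\<And>x j s. ((\<lambda>r. \<phi> (x + r *\<^sub>R axis j 1)) has_real_derivative \<phi>' j (x + s *\<^sub>R axis j 1)) (at s)"
    and \<phi>'': "\<And>x j s. ((\<lambda>r. \<phi>' j (x + r *\<^sub>R axis j 1)) has_real_derivative \<phi>'' j (x + s *\<^sub>R axis j 1)) (at s)"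
    and t: "0 < t0" "t0 < t"
    and k: "\<sigma> * k = \<bar>k\<bar>" "k \<noteq> 0"
    and \<alpha>: "\<alpha> = k + \<theta> - 2"
    and F: "\<And>t x. F t x = (\<phi> x)\<^sup>2 * (m * \<bar>k\<bar> * (t - t0)) * (V (t, x) powr \<alpha> * (\<Sum>i\<in>UNIV. (D1 i (t, x))\<^sup>2))
      + \<sigma> * V (t, x) powr k"
    and max_t: "\<And>t'. \<lbrakk>t0 < t'; t' < t\<rbrakk> \<Longrightarrow> F t' x \<le> F t x"
    and max_x: "d > 0" "\<And>j s. \<bar>s\<bar> < d \<Longrightarrow> F t (x + s *\<^sub>R axis j 1) \<le> F t x"
    and \<phi>: "0 < \<phi> x" "\<phi> x \<le> 1"
    and P: "P = (\<Sum>i\<in>UNIV. (D1 i (t, x) / V (t, x))\<^sup>2)" "P > 0"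
    and s: "s = m * (t - t0) * V (t, x) powr \<theta>"
    and \<kappa>: "(k - 1)\<^sup>2 + (real CARD('n) - 1) * \<theta>\<^sup>2 - (1 - \<theta>)\<^sup>2 \<le> - \<kappa>"
    and \<epsilon>: "0 < \<epsilon>" "\<epsilon> \<le> 1" "\<epsilon> * (2 * \<bar>2 - k\<bar> + 12 + 4 / c) < \<kappa> / 2"
    and c: "0 < c" "c \<le> (\<phi> x)\<^sup>2 * s * P"
    and \<phi>d: "(\<Sum>j\<in>UNIV. (\<phi>' j x)\<^sup>2) \<le> \<epsilon>\<^sup>2 * ((\<phi> x)\<^sup>2 * P)" "\<bar>\<Sum>j\<in>UNIV. \<phi>'' j x\<bar> \<le> \<epsilon> * ((\<phi> x)\<^sup>2 * P)"
  shows False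
proof -
  have t_pos: "t > 0" using t by simp
  define w where "w = V (t, x)"
  have w: "w > 0" using pos t_pos by (simp add: w_def)
  define g where "g i = D1 i (t, x) / w" for i
  define H where "H i j = D2 i j (t, x) / w" for i j
  define K where "K i j = dird (xvec j) (D2 i j) (t, x) / w" for i j
  define G where "G = (\<Sum>i\<in>UNIV. g i * (\<Sum>j\<in>UNIV. K i j))"
  define \<tau> where "\<tau> = (\<Sum>i\<in>UNIV. H i i)"
  define W where "W = w powr k"
  define B where "B = m * \<bar>k\<bar> * (t - t0)"
  have W: "W > 0" using w by (simp add: W_def)
  have s_pos: "s > 0" using s t m_pos w by (simp add: w_def)
  have D: "V (t, x) = w" "D1 i (t, x) = w * g i" "D2 i j (t, x) = w * H i j"
    "dird (xvec j) (D2 i j) (t, x) = w * K i j" for i j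
    using w by (simp_all add: g_def H_def K_def w_def)
  have Pg: "P = (\<Sum>i\<in>UNIV. (g i)\<^sup>2)" by (simp add: P(1) g_def w_def)
  have p: "(\<Sum>i\<in>UNIV. (w * g i)\<^sup>2) = w\<^sup>2 * P" by (simp add: Pg power_mult_distrib sum_distrib_left)
  have s': "s = m * (t - t0) * w powr \<theta>" by (simp add: s w_def)
  \<comment> \<open>Because \<open>\<alpha> + 2 = \<theta> + k\<close>, the gradient term and the
    power term of F share the factor \<open>W\<close>.\<close>
  have BW: "B * w powr \<alpha> * w\<^sup>2 = \<bar>k\<bar> * W * s"
  proof -
    have "w powr \<alpha> * w\<^sup>2 = w powr (\<alpha> + 2)" using w by (simp add: powr_add)
    also have "\<alpha> + 2 = \<theta> + k" by (simp add: \<alpha>)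
    finally have "w powr \<alpha> * w\<^sup>2 = w powr \<theta> * W" by (simp add: W_def powr_add)
    then show ?thesis by (simp add: B_def s' mult_ac) 
  qed
  have pm: "w powr (a - 1) = w powr a / w" "w powr (a - 2) = w powr a / w\<^sup>2" for a
    using w by (simp_all add: powr_diff)

  have 1: "(\<phi> x)\<^sup>2 * (P + s * ((\<alpha> + 2 * \<theta>) * \<tau> * P + 2 * G)) + \<tau> \<ge> 0"
  proof -
    define w' where "w' = m * w powr \<theta> * (w * \<tau>)"
    define g' where "g' i = m * \<theta> * w powr \<theta> * g i * (w * \<tau>) + m * w powr \<theta> * (w * (\<Sum>j\<in>UNIV. K i j))" for i
    have V': "((\<lambda>r. V (r, x)) has_real_derivative w') (at t)"
      using DERIV_t_line[OF diff0[OF t_pos, of x]] unfolding eq[OF t_pos] w'_def D \<tau>_def sum_distrib_left .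
    have G': "((\<lambda>r. D1 i (r, x)) has_real_derivative g' i) (at t)" for i
    proof -
      have "dird tvec (D1 i) (t, x) = g' i"
        unfolding time_deriv_gradient[OF t_pos] D g'_def \<tau>_def pm sum_distrib_left[symmetric]
        using w by simp
      then show ?thesis using DERIV_t_line[OF diff1[OF t_pos, where v = "xvec i" and x = x]] by simp
    qed
    have "((\<lambda>r. F r x) has_real_derivative
        (2 * \<phi> x * 0 * (m * \<bar>k\<bar> * (t - t0)) + (\<phi> x)\<^sup>2 * (m * \<bar>k\<bar>)) * (V (t, x) powr \<alpha> * (\<Sum>i\<in>UNIV. (D1 i (t, x))\<^sup>2))
        + (\<phi> x)\<^sup>2 * (m * \<bar>k\<bar> * (t - t0)) * (\<alpha> * V (t, x) powr (\<alpha> - 1) * w' * (\<Sum>i\<in>UNIV. (D1 i (t, x))\<^sup>2)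
          + 2 * V (t, x) powr \<alpha> * (\<Sum>i\<in>UNIV. D1 i (t, x) * g' i))
        + \<sigma> * k * V (t, x) powr (k - 1) * w') (at t)" (is "(_ has_real_derivative ?D) _")
      unfolding F
      by (rule DERIV_bernstein[where w = "\<lambda>r. V (r, x)" and g = "\<lambda>i r. D1 i (r, x)" and \<phi> = "\<lambda>r. \<phi> x"
            and A = "\<lambda>r. m * \<bar>k\<bar> * (r - t0)", OF _ V' _ _ G'])
        (use pos t_pos in \<open>auto intro!: derivative_eq_intros\<close>)
    from left_max_DERIV[OF t(2) max_t this] have "?D \<ge> 0" .
    also have "?D = (\<phi> x)\<^sup>2 * (m * \<bar>k\<bar>) * (w powr \<alpha> * (w\<^sup>2 * P))
        + (\<phi> x)\<^sup>2 * B * (\<alpha> * (w powr \<alpha> / w) * w' * (w\<^sup>2 * P) + 2 * w powr \<alpha> * (\<Sum>i\<in>UNIV. w * g i * g' i))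
        + \<bar>k\<bar> * (W / w) * w'"
      unfolding D p pm B_def W_def k by simp
    also have "(\<Sum>i\<in>UNIV. w * g i * g' i) = w\<^sup>2 * (m * w powr \<theta>) * (\<theta> * \<tau> * P + G)"
      unfolding g'_def Pg G_def
      by (simp add: algebra_simps sum.distrib sum_distrib_left power2_eq_square)
    also have "(\<phi> x)\<^sup>2 * (m * \<bar>k\<bar>) * (w powr \<alpha> * (w\<^sup>2 * P))
        + (\<phi> x)\<^sup>2 * B * (\<alpha> * (w powr \<alpha> / w) * w' * (w\<^sup>2 * P) + 2 * w powr \<alpha> * (w\<^sup>2 * (m * w powr \<theta>) * (\<theta> * \<tau> * P + G)))
        + \<bar>k\<bar> * (W / w) * w'
      = (\<phi> x)\<^sup>2 * (m * \<bar>k\<bar>) * P * (w powr \<alpha> * w\<^sup>2)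
        + (\<phi> x)\<^sup>2 * (m * w powr \<theta>) * (B * w powr \<alpha> * w\<^sup>2) * (\<alpha> * \<tau> * P + 2 * (\<theta> * \<tau> * P + G))
        + \<bar>k\<bar> * W * (m * w powr \<theta>) * \<tau>"
      using w by (simp add: w'_def algebra_simps)
    also have "w powr \<alpha> * w\<^sup>2 = w powr \<theta> * W"
    proof -
      have "w powr \<alpha> * w\<^sup>2 = w powr (\<alpha> + 2)" using w by (simp add: powr_add)
      also have "\<alpha> + 2 = \<theta> + k" by (simp add: \<alpha>)
      finally show ?thesis by (simp add: W_def powr_add)
    qed
    also have "(\<phi> x)\<^sup>2 * (m * \<bar>k\<bar>) * P * (w powr \<theta> * W)
        + (\<phi> x)\<^sup>2 * (m * w powr \<theta>) * (B * w powr \<alpha> * w\<^sup>2) * (\<alpha> * \<tau> * P + 2 * (\<theta> * \<tau> * P + G))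
        + \<bar>k\<bar> * W * (m * w powr \<theta>) * \<tau>
      = (m * \<bar>k\<bar> * (w powr \<theta> * W)) * ((\<phi> x)\<^sup>2 * (P + s * ((\<alpha> + 2 * \<theta>) * \<tau> * P + 2 * G)) + \<tau>)"
      unfolding BW by (simp add: algebra_simps)
    finally have *: "0 \<le> (m * \<bar>k\<bar> * (w powr \<theta> * W)) * ((\<phi> x)\<^sup>2 * (P + s * ((\<alpha> + 2 * \<theta>) * \<tau> * P + 2 * G)) + \<tau>)" .
    show ?thesis
    proof -
      have "m * \<bar>k\<bar> * (w powr \<theta> * W) > 0"
        using m_pos k W w by (intro mult_pos_pos) auto
      then show ?thesis
        using * unfolding zero_le_mult_iff by linarith
    qed
  qed

  \<comment> \<open>Conditions along single axes; only later are the second-order ones summed over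
    \<open>j\<close> to form the Laplacian.\<close>
  have space: "2 * \<phi> x * \<phi>' j x * P * s + (\<phi> x)\<^sup>2 * s * (\<alpha> * g j * P + 2 * (\<Sum>i\<in>UNIV. g i * H i j)) + g j = 0 \<and>
     s * ((2 * (\<phi>' j x)\<^sup>2 + 2 * \<phi> x * \<phi>'' j x) * P + 4 * \<phi> x * \<phi>' j x * (\<alpha> * g j * P + 2 * (\<Sum>i\<in>UNIV. g i * H i j))
      + (\<phi> x)\<^sup>2 * (\<alpha> * (\<alpha> - 1) * (g j)\<^sup>2 * P + \<alpha> * H j j * P + 4 * \<alpha> * g j * (\<Sum>i\<in>UNIV. g i * H i j)
        + 2 * (\<Sum>i\<in>UNIV. (H i j)\<^sup>2 + g i * K i j))) + (k - 1) * (g j)\<^sup>2 + H j j \<le> 0" for j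
  proof -
    let ?l = "\<lambda>r. x + r *\<^sub>R axis j 1"
    define F' where "F' r = 2 * \<phi> (?l r) * \<phi>' j (?l r) * B * (V (t, ?l r) powr \<alpha> * (\<Sum>i\<in>UNIV. (D1 i (t, ?l r))\<^sup>2))
      + (\<phi> (?l r))\<^sup>2 * B * (\<alpha> * V (t, ?l r) powr (\<alpha> - 1) * D1 j (t, ?l r) * (\<Sum>i\<in>UNIV. (D1 i (t, ?l r))\<^sup>2)
        + 2 * V (t, ?l r) powr \<alpha> * (\<Sum>i\<in>UNIV. D1 i (t, ?l r) * D2 i j (t, ?l r)))
      + \<sigma> * k * V (t, ?l r) powr (k - 1) * D1 j (t, ?l r)" for r
    have V': "((\<lambda>r. V (t, ?l r)) has_real_derivative D1 j (t, ?l r)) (at r)" for r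
      by (rule DERIV_x_line[OF diff0[OF t_pos]])
    have V'': "((\<lambda>r. D1 i (t, ?l r)) has_real_derivative D2 i j (t, ?l r)) (at r)" for r i
      by (rule DERIV_x_line[OF diff1[OF t_pos]])
    have V''': "((\<lambda>r. D2 i j (t, ?l r)) has_real_derivative dird (xvec j) (D2 i j) (t, ?l r)) (at r)" for r i
      by (rule DERIV_x_line[OF diff2[OF t_pos]])
    have F1: "((\<lambda>r. F t (?l r)) has_real_derivative F' r) (at r)" for r
    proof -
      have "((\<lambda>r. F t (?l r)) has_real_derivative
        (2 * \<phi> (?l r) * \<phi>' j (?l r) * B + (\<phi> (?l r))\<^sup>2 * 0) * (V (t, ?l r) powr \<alpha> * (\<Sum>i\<in>UNIV. (D1 i (t, ?l r))\<^sup>2))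
        + (\<phi> (?l r))\<^sup>2 * B * (\<alpha> * V (t, ?l r) powr (\<alpha> - 1) * D1 j (t, ?l r) * (\<Sum>i\<in>UNIV. (D1 i (t, ?l r))\<^sup>2)
          + 2 * V (t, ?l r) powr \<alpha> * (\<Sum>i\<in>UNIV. D1 i (t, ?l r) * D2 i j (t, ?l r)))
        + \<sigma> * k * V (t, ?l r) powr (k - 1) * D1 j (t, ?l r)) (at r)"
        unfolding F B_def[symmetric]
        by (rule DERIV_bernstein[where w = "\<lambda>r. V (t, ?l r)" and g = "\<lambda>i r. D1 i (t, ?l r)" and \<phi> = "\<lambda>r. \<phi> (?l r)"
            and A = "\<lambda>r. B", OF _ V' \<phi>' _ V'']) (use pos t_pos in auto)
      then show ?thesis unfolding F'_def by simp
    qed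
    have F2: "(F' has_real_derivative
        B * ((2 * (\<phi>' j (?l 0))\<^sup>2 + 2 * \<phi> (?l 0) * \<phi>'' j (?l 0)) * (V (t, ?l 0) powr \<alpha> * (\<Sum>i\<in>UNIV. (D1 i (t, ?l 0))\<^sup>2))
      + 4 * \<phi> (?l 0) * \<phi>' j (?l 0) * (\<alpha> * V (t, ?l 0) powr (\<alpha> - 1) * D1 j (t, ?l 0) * (\<Sum>i\<in>UNIV. (D1 i (t, ?l 0))\<^sup>2)
         + 2 * V (t, ?l 0) powr \<alpha> * (\<Sum>i\<in>UNIV. D1 i (t, ?l 0) * D2 i j (t, ?l 0)))
      + (\<phi> (?l 0))\<^sup>2 * (\<alpha> * (\<alpha> - 1) * V (t, ?l 0) powr (\<alpha> - 2) * (D1 j (t, ?l 0))\<^sup>2 * (\<Sum>i\<in>UNIV. (D1 i (t, ?l 0))\<^sup>2)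
          + \<alpha> * V (t, ?l 0) powr (\<alpha> - 1) * D2 j j (t, ?l 0) * (\<Sum>i\<in>UNIV. (D1 i (t, ?l 0))\<^sup>2)
          + 4 * \<alpha> * V (t, ?l 0) powr (\<alpha> - 1) * D1 j (t, ?l 0) * (\<Sum>i\<in>UNIV. D1 i (t, ?l 0) * D2 i j (t, ?l 0))
          + 2 * V (t, ?l 0) powr \<alpha> * (\<Sum>i\<in>UNIV. (D2 i j (t, ?l 0))\<^sup>2 + D1 i (t, ?l 0) * dird (xvec j) (D2 i j) (t, ?l 0))))
    + \<sigma> * k * ((k - 1) * V (t, ?l 0) powr (k - 2) * (D1 j (t, ?l 0))\<^sup>2 + V (t, ?l 0) powr (k - 1) * D2 j j (t, ?l 0))) (at 0)"
      (is "(_ has_real_derivative ?D) _")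
      unfolding F'_def[abs_def]
      by (rule DERIV2_bernstein[where w = "\<lambda>r. V (t, ?l r)" and w' = "\<lambda>r. D1 j (t, ?l r)"
            and g = "\<lambda>i r. D1 i (t, ?l r)" and \<phi> = "\<lambda>r. \<phi> (?l r)" and g' = "\<lambda>i r. D2 i j (t, ?l r)"
            and \<phi>' = "\<lambda>r. \<phi>' j (?l r)", OF _ V' \<phi>' V'' V'' \<phi>'' V''']) (simp add: pos t_pos)
    have *: "F' 0 = 0" "?D \<le> 0"
      using local_max_DERIV2[OF max_x(1), of "\<lambda>r. F t (?l r)", OF _ F1 F2] max_x(2) by simp_all
    have q: "(\<Sum>i\<in>UNIV. w * g i * (w * H i j)) = w\<^sup>2 * (\<Sum>i\<in>UNIV. g i * H i j)"
      by (simp add: sum_distrib_left power2_eq_square mult_ac)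
    have r: "(\<Sum>i\<in>UNIV. (w * H i j)\<^sup>2 + w * g i * (w * K i j)) = w\<^sup>2 * (\<Sum>i\<in>UNIV. (H i j)\<^sup>2 + g i * K i j)"
      by (simp add: sum_distrib_left power2_eq_square algebra_simps)
    have "F' 0 = (B * w powr \<alpha> * w\<^sup>2) * (2 * \<phi> x * \<phi>' j x * P + (\<phi> x)\<^sup>2 * (\<alpha> * g j * P + 2 * (\<Sum>i\<in>UNIV. g i * H i j)))
        + \<bar>k\<bar> * W * g j"
      unfolding F'_def scaleR_zero_left add_0_right D p q pm W_def k(1) using w by (simp add: algebra_simps)
    also have "\<dots> = \<bar>k\<bar> * W * (2 * \<phi> x * \<phi>' j x * P * s + (\<phi> x)\<^sup>2 * s * (\<alpha> * g j * P + 2 * (\<Sum>i\<in>UNIV. g i * H i j)) + g j)"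
      unfolding BW by (simp add: algebra_simps)
    finally have 1: "2 * \<phi> x * \<phi>' j x * P * s + (\<phi> x)\<^sup>2 * s * (\<alpha> * g j * P + 2 * (\<Sum>i\<in>UNIV. g i * H i j)) + g j = 0"
      using *(1) k W by simp
    have "?D = (B * w powr \<alpha> * w\<^sup>2) * ((2 * (\<phi>' j x)\<^sup>2 + 2 * \<phi> x * \<phi>'' j x) * P + 4 * \<phi> x * \<phi>' j x * (\<alpha> * g j * P + 2 * (\<Sum>i\<in>UNIV. g i * H i j))
      + (\<phi> x)\<^sup>2 * (\<alpha> * (\<alpha> - 1) * (g j)\<^sup>2 * P + \<alpha> * H j j * P + 4 * \<alpha> * g j * (\<Sum>i\<in>UNIV. g i * H i j)
        + 2 * (\<Sum>i\<in>UNIV. (H i j)\<^sup>2 + g i * K i j))) + \<bar>k\<bar> * W * ((k - 1) * (g j)\<^sup>2 + H j j)"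
      unfolding scaleR_zero_left add_0_right D p q r pm W_def k(1) using w
      by (simp add: distrib_left distrib_right power_mult_distrib mult_ac)
    also have "\<dots> = \<bar>k\<bar> * W * (s * ((2 * (\<phi>' j x)\<^sup>2 + 2 * \<phi> x * \<phi>'' j x) * P + 4 * \<phi> x * \<phi>' j x * (\<alpha> * g j * P + 2 * (\<Sum>i\<in>UNIV. g i * H i j))
      + (\<phi> x)\<^sup>2 * (\<alpha> * (\<alpha> - 1) * (g j)\<^sup>2 * P + \<alpha> * H j j * P + 4 * \<alpha> * g j * (\<Sum>i\<in>UNIV. g i * H i j)
        + 2 * (\<Sum>i\<in>UNIV. (H i j)\<^sup>2 + g i * K i j))) + ((k - 1) * (g j)\<^sup>2 + H j j))"
      unfolding BW by (simp only: distrib_left mult_ac)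
    finally show ?thesis
      using 1 *(2) k W by (simp add: mult_le_0_iff add.assoc)
  qed
  have 2: "s * (2 * \<phi> x * \<phi>' j x * P + (\<phi> x)\<^sup>2 * (\<alpha> * g j * P + 2 * (\<Sum>i\<in>UNIV. g i * H i j))) + g j = 0" for j
    using space[of j] by (simp add: algebra_simps)
  have "(\<Sum>j\<in>UNIV. s * ((2 * (\<phi>' j x)\<^sup>2 + 2 * \<phi> x * \<phi>'' j x) * P + 4 * \<phi> x * \<phi>' j x * (\<alpha> * g j * P + 2 * (\<Sum>i\<in>UNIV. g i * H i j))
      + (\<phi> x)\<^sup>2 * (\<alpha> * (\<alpha> - 1) * (g j)\<^sup>2 * P + \<alpha> * H j j * P + 4 * \<alpha> * g j * (\<Sum>i\<in>UNIV. g i * H i j)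
        + 2 * (\<Sum>i\<in>UNIV. (H i j)\<^sup>2 + g i * K i j))) + (k - 1) * (g j)\<^sup>2 + H j j) \<le> 0"
    using space by (intro sum_nonpos) blast
  also have "(\<Sum>j\<in>UNIV. s * ((2 * (\<phi>' j x)\<^sup>2 + 2 * \<phi> x * \<phi>'' j x) * P + 4 * \<phi> x * \<phi>' j x * (\<alpha> * g j * P + 2 * (\<Sum>i\<in>UNIV. g i * H i j))
      + (\<phi> x)\<^sup>2 * (\<alpha> * (\<alpha> - 1) * (g j)\<^sup>2 * P + \<alpha> * H j j * P + 4 * \<alpha> * g j * (\<Sum>i\<in>UNIV. g i * H i j)
        + 2 * (\<Sum>i\<in>UNIV. (H i j)\<^sup>2 + g i * K i j))) + (k - 1) * (g j)\<^sup>2 + H j j)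
    = s * ((2 * (\<Sum>j\<in>UNIV. (\<phi>' j x)\<^sup>2) + 2 * \<phi> x * (\<Sum>j\<in>UNIV. \<phi>'' j x)) * P
        + 2 * (\<Sum>j\<in>UNIV. (2 * \<phi> x * \<phi>' j x) * (\<alpha> * g j * P + 2 * (\<Sum>i\<in>UNIV. g i * H i j)))
        + (\<phi> x)\<^sup>2 * (\<alpha> * (\<alpha> - 1) * P\<^sup>2 + \<alpha> * \<tau> * P + 4 * \<alpha> * (\<Sum>i\<in>UNIV. \<Sum>j\<in>UNIV. g i * g j * H i j)
            + 2 * (\<Sum>i\<in>UNIV. \<Sum>j\<in>UNIV. (H i j)\<^sup>2) + 2 * G)) + (k - 1) * P + \<tau>"
  proof -
    have a: "(\<Sum>j\<in>UNIV. g j * (\<Sum>i\<in>UNIV. g i * H i j)) = (\<Sum>i\<in>UNIV. \<Sum>j\<in>UNIV. g i * g j * H i j)"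
      unfolding sum_distrib_left by (subst sum.swap) (simp only: mult_ac)
    have b: "(\<Sum>j\<in>UNIV. \<Sum>i\<in>UNIV. (H i j)\<^sup>2 + g i * K i j) = (\<Sum>i\<in>UNIV. \<Sum>j\<in>UNIV. (H i j)\<^sup>2) + G"
      unfolding G_def sum_distrib_left sum.distrib[symmetric] by (rule sum.swap)
    define q where "q j = (\<Sum>i\<in>UNIV. g i * H i j)" for j
    define h where "h j = \<alpha> * g j * P + 2 * q j" for j
    define e where "e j = (\<Sum>i\<in>UNIV. (H i j)\<^sup>2 + g i * K i j)" for j
    have "(\<Sum>j\<in>UNIV. s * ((2 * (\<phi>' j x)\<^sup>2 + 2 * \<phi> x * \<phi>'' j x) * P + 4 * \<phi> x * \<phi>' j x * h j
      + (\<phi> x)\<^sup>2 * (\<alpha> * (\<alpha> - 1) * (g j)\<^sup>2 * P + \<alpha> * H j j * P + 4 * \<alpha> * g j * q j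
        + 2 * e j)) + (k - 1) * (g j)\<^sup>2 + H j j)
      = (\<Sum>j\<in>UNIV. (s * 2 * P) * (\<phi>' j x)\<^sup>2 + (s * 2 * \<phi> x * P) * \<phi>'' j x + (s * 2) * (2 * \<phi> x * \<phi>' j x * h j)
        + (s * (\<phi> x)\<^sup>2 * \<alpha> * (\<alpha> - 1) * P) * (g j)\<^sup>2 + (s * (\<phi> x)\<^sup>2 * \<alpha> * P) * H j j
        + (s * (\<phi> x)\<^sup>2 * 4 * \<alpha>) * (g j * q j) + (s * (\<phi> x)\<^sup>2 * 2) * e j + (k - 1) * (g j)\<^sup>2 + H j j)"
      by (intro sum.cong refl) (simp add: algebra_simps)
    also have "\<dots> = (s * 2 * P) * (\<Sum>j\<in>UNIV. (\<phi>' j x)\<^sup>2) + (s * 2 * \<phi> x * P) * (\<Sum>j\<in>UNIV. \<phi>'' j x)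
        + (s * 2) * (\<Sum>j\<in>UNIV. 2 * \<phi> x * \<phi>' j x * h j)
        + (s * (\<phi> x)\<^sup>2 * \<alpha> * (\<alpha> - 1) * P) * P + (s * (\<phi> x)\<^sup>2 * \<alpha> * P) * \<tau>
        + (s * (\<phi> x)\<^sup>2 * 4 * \<alpha>) * (\<Sum>j\<in>UNIV. g j * q j) + (s * (\<phi> x)\<^sup>2 * 2) * (\<Sum>j\<in>UNIV. e j) + (k - 1) * P + \<tau>"
      unfolding sum.distrib sum_distrib_left[symmetric] Pg \<tau>_def ..
    also have "\<dots> = s * ((2 * (\<Sum>j\<in>UNIV. (\<phi>' j x)\<^sup>2) + 2 * \<phi> x * (\<Sum>j\<in>UNIV. \<phi>'' j x)) * P
        + 2 * (\<Sum>j\<in>UNIV. (2 * \<phi> x * \<phi>' j x) * h j)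
        + (\<phi> x)\<^sup>2 * (\<alpha> * (\<alpha> - 1) * P\<^sup>2 + \<alpha> * \<tau> * P + 4 * \<alpha> * (\<Sum>j\<in>UNIV. g j * q j)
            + 2 * (\<Sum>j\<in>UNIV. e j))) + (k - 1) * P + \<tau>"
      by (simp add: algebra_simps power2_eq_square)
    finally show ?thesis
      unfolding h_def q_def e_def a b by (simp only: distrib_left add.assoc)
  qed
  finally have 3: "s * ((2 * (\<Sum>j\<in>UNIV. (\<phi>' j x)\<^sup>2) + 2 * \<phi> x * (\<Sum>j\<in>UNIV. \<phi>'' j x)) * P
        + 2 * (\<Sum>j\<in>UNIV. (2 * \<phi> x * \<phi>' j x) * (\<alpha> * g j * P + 2 * (\<Sum>i\<in>UNIV. g i * H i j)))
        + (\<phi> x)\<^sup>2 * (\<alpha> * (\<alpha> - 1) * P\<^sup>2 + \<alpha> * \<tau> * P + 4 * \<alpha> * (\<Sum>i\<in>UNIV. \<Sum>j\<in>UNIV. g i * g j * H i j)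
            + 2 * (\<Sum>i\<in>UNIV. \<Sum>j\<in>UNIV. (H i j)\<^sup>2) + 2 * G)) + (k - 1) * P + \<tau> \<le> 0" .
  show False
    by (rule bernstein_contradiction[where g = g and H = H and \<phi>' = "\<lambda>j. \<phi>' j x" and \<phi> = "\<phi> x"
          and \<phi>'' = "\<Sum>j\<in>UNIV. \<phi>'' j x" and G = G, folded Pg \<tau>_def, OF P(2) s_pos \<phi> \<alpha> 1 2 3 \<kappa> \<epsilon> c \<phi>d])
qed

end

section \<open>Cutoff functions and the weak maximum principle\<close>

text \<open>For \<open>b\<close> near 0 this is the cutoff profile; with \<open>b\<close> as decay
  exponent it is the spatial profile of the subsolution. \<open>bump1\<close> and
  \<open>bump2\<close> are the first and second derivatives along axis \<open>j\<close>.\<close>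

definition bump :: "real \<Rightarrow> real ^ 'n \<Rightarrow> real"
  where "bump b x = (1 + x \<bullet> x) powr (- b)"
definition bump1 :: "real \<Rightarrow> 'n \<Rightarrow> real ^ 'n \<Rightarrow> real"
  where "bump1 b j x = - 2 * b * x $ j * (1 + x \<bullet> x) powr (- b - 1)"
definition bump2 :: "real \<Rightarrow> 'n \<Rightarrow> real ^ 'n \<Rightarrow> real"
  where "bump2 b j x = - 2 * b * (1 + x \<bullet> x) powr (- b - 1)
    + 4 * b * (b + 1) * (x $ j)\<^sup>2 * (1 + x \<bullet> x) powr (- b - 2)"

lemma one_plus_inner_pos: "1 + x \<bullet> x > (0::real)" for x :: "real ^ 'n"
  using inner_ge_zero[of x] by linarith

lemma DERIV_inner_line:
  fixes x :: "real ^ 'n"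
  shows "((\<lambda>r. (x + r *\<^sub>R axis j 1) \<bullet> (x + r *\<^sub>R axis j 1)) has_real_derivative 2 * (x + s *\<^sub>R axis j 1) $ j) (at s)"
proof -
  have "(x + r *\<^sub>R axis j 1) \<bullet> (x + r *\<^sub>R axis j 1) = x \<bullet> x + 2 * r * x $ j + r\<^sup>2" for r
    by (simp add: inner_add_left inner_add_right inner_axis inner_axis' power2_eq_square algebra_simps)
  then show ?thesis by (auto intro!: derivative_eq_intros)
qed

lemma DERIV_nth_line:
  fixes x :: "real ^ 'n"
  shows "((\<lambda>r. (x + r *\<^sub>R axis j 1) $ j) has_real_derivative 1) (at s)"
  by (auto intro!: derivative_eq_intros)

lemma DERIV_bump:
  fixes x :: "real ^ 'n"
  shows "((\<lambda>r. bump b (x + r *\<^sub>R axis j 1)) has_real_derivative bump1 b j (x + s *\<^sub>R axis j 1)) (at s)"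
proof -
  have "((\<lambda>r. 1 + (x + r *\<^sub>R axis j 1) \<bullet> (x + r *\<^sub>R axis j 1)) has_real_derivative 0 + 2 * (x + s *\<^sub>R axis j 1) $ j) (at s)"
    by (intro DERIV_add DERIV_const DERIV_inner_line)
  from DERIV_powr_chain[OF this one_plus_inner_pos, of "- b"] show ?thesis
    unfolding bump_def bump1_def by (simp add: mult_ac)
qed

lemma DERIV_bump1:
  fixes x :: "real ^ 'n"
  shows "((\<lambda>r. bump1 b j (x + r *\<^sub>R axis j 1)) has_real_derivative bump2 b j (x + s *\<^sub>R axis j 1)) (at s)"
proof -
  define y where "y = x + s *\<^sub>R axis j 1"
  have "((\<lambda>r. 1 + (x + r *\<^sub>R axis j 1) \<bullet> (x + r *\<^sub>R axis j 1)) has_real_derivative 0 + 2 * y $ j) (at s)"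
    unfolding y_def by (intro DERIV_add DERIV_const DERIV_inner_line)
  from DERIV_powr_chain[OF this one_plus_inner_pos]
  have 1: "((\<lambda>r. (1 + (x + r *\<^sub>R axis j 1) \<bullet> (x + r *\<^sub>R axis j 1)) powr (- b - 1)) has_real_derivative
      (- b - 1) * (1 + y \<bullet> y) powr (- b - 1 - 1) * (0 + 2 * y $ j)) (at s)"
    unfolding y_def .
  have "((\<lambda>r. bump1 b j (x + r *\<^sub>R axis j 1)) has_real_derivative
    (- 2 * b * 1) * (1 + y \<bullet> y) powr (- b - 1)
      + (- b - 1) * (1 + y \<bullet> y) powr (- b - 1 - 1) * (0 + 2 * y $ j) * (- 2 * b * y $ j)) (at s)"
    using DERIV_mult[OF DERIV_cmult[OF DERIV_nth_line[of x j s], where c = "- 2 * b"] 1]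
    unfolding bump1_def y_def .
  moreover have "(- 2 * b * 1) * (1 + y \<bullet> y) powr (- b - 1)
      + (- b - 1) * (1 + y \<bullet> y) powr (- b - 1 - 1) * (0 + 2 * y $ j) * (- 2 * b * y $ j) = bump2 b j y"
    by (simp add: bump2_def power2_eq_square algebra_simps)
  ultimately show ?thesis unfolding y_def by simp
qed

lemma inner_eq_sum_sq: "x \<bullet> x = (\<Sum>j\<in>UNIV. (x $ j)\<^sup>2)" for x :: "real ^ 'n"
  by (simp add: inner_vec_def power2_eq_square)

lemma sum_bump1_sq:
  fixes x :: "real ^ 'n"
  shows "(\<Sum>j\<in>UNIV. (bump1 b j x)\<^sup>2) * (1 + x \<bullet> x) \<le> 4 * b\<^sup>2 * (bump b x)\<^sup>2"
proof -
  define y where "y = 1 + x \<bullet> x"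
  have y: "y > 0" unfolding y_def by (rule one_plus_inner_pos)
  have "(\<Sum>j\<in>UNIV. (bump1 b j x)\<^sup>2) = (4 * b\<^sup>2 * (y powr (- b - 1))\<^sup>2) * (\<Sum>j\<in>UNIV. (x $ j)\<^sup>2)"
    unfolding bump1_def y_def[symmetric] sum_distrib_left
    by (intro sum.cong refl) (simp add: power_mult_distrib mult_ac)
  also have "\<dots> = 4 * b\<^sup>2 * (bump b x)\<^sup>2 * (x \<bullet> x) / y\<^sup>2"
    using y unfolding bump_def y_def[symmetric] inner_eq_sum_sq[symmetric]
    by (simp add: powr_diff power_divide)
  also have "\<dots> * y = 4 * b\<^sup>2 * (bump b x)\<^sup>2 * ((x \<bullet> x) / y)"
    using y by (simp add: power2_eq_square)
  also have "\<dots> \<le> 4 * b\<^sup>2 * (bump b x)\<^sup>2 * 1"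
    using y by (intro mult_left_mono) (auto simp: y_def)
  finally show ?thesis by (simp add: y_def)
qed

text \<open>The last factor tends to 2 (b + 1) - n at infinity. Its sign decides whether the profile
  is subharmonic far out; its boundedness controls the cutoff error.\<close>

lemma sum_bump2:
  fixes x :: "real ^ 'n"
  shows "(\<Sum>j\<in>UNIV. bump2 b j x) = 2 * b * bump b x / (1 + x \<bullet> x)
    * (2 * (b + 1) * (x \<bullet> x / (1 + x \<bullet> x)) - real CARD('n))"
proof -
  define y where "y = 1 + x \<bullet> x"
  have y: "y > 0" unfolding y_def by (rule one_plus_inner_pos)
  have p: "y powr (- b - 1) = y powr (- b) / y" "y powr (- b - 2) = y powr (- b) / y\<^sup>2"
    using y by (simp_all add: powr_diff)
  have *: "(\<Sum>j\<in>UNIV. bump2 b j x) = real CARD('n) * (- 2 * b * y powr (- b - 1))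
      + 4 * b * (b + 1) * y powr (- b - 2) * (x \<bullet> x)"
  proof -
    have "(\<Sum>j\<in>UNIV. 4 * b * (b + 1) * (x $ j)\<^sup>2 * y powr (- b - 2)) = 4 * b * (b + 1) * y powr (- b - 2) * (x \<bullet> x)"
      unfolding inner_eq_sum_sq sum_distrib_left by (intro sum.cong refl) simp
    then show ?thesis
      unfolding bump2_def y_def[symmetric] sum.distrib by simp
  qed
  show ?thesis
    unfolding * p bump_def y_def[symmetric] using y by (simp add: power2_eq_square field_simps)
qed

lemma bump_pos: "bump b x > 0"
  using one_plus_inner_pos[of x] by (simp add: bump_def)

lemma continuous_on_bump:
  assumes "continuous_on S f"
  shows "continuous_on S (\<lambda>z. bump b (f z))"
proof -
  have "1 + f z \<bullet> f z \<noteq> 0" for z using one_plus_inner_pos[of "f z"] by simp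
  then show ?thesis unfolding bump_def by (intro continuous_intros assms) auto
qed

lemma bump_le_1: "b \<ge> 0 \<Longrightarrow> bump b x \<le> 1"
  using powr_mono2'[of "- b" 1 "1 + x \<bullet> x"] by (simp add: bump_def)

lemma abs_sum_bump2:
  fixes x :: "real ^ 'n"
  assumes "0 \<le> b" "b \<le> 1"
  shows "\<bar>\<Sum>j\<in>UNIV. bump2 b j x\<bar> * (1 + x \<bullet> x) \<le> 2 * b * (real CARD('n) + 4)"
proof -
  define y where "y = 1 + x \<bullet> x"
  have y: "y > 0" unfolding y_def by (rule one_plus_inner_pos)
  have q: "0 \<le> x \<bullet> x / y" "x \<bullet> x / y \<le> 1" using y by (auto simp: y_def)
  have "0 \<le> 2 * (b + 1) * (x \<bullet> x / y)"
    using assms q(1) by (intro mult_nonneg_nonneg) auto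
  moreover have "2 * (b + 1) * (x \<bullet> x / y) \<le> 4 * 1"
    using assms q by (intro mult_mono) auto
  ultimately have "\<bar>2 * (b + 1) * (x \<bullet> x / y) - real CARD('n)\<bar> \<le> real CARD('n) + 4"
    by linarith
  then have "2 * b * bump b x * \<bar>2 * (b + 1) * (x \<bullet> x / y) - real CARD('n)\<bar> \<le> 2 * b * 1 * (real CARD('n) + 4)"
    using assms bump_le_1[of b x] bump_pos[of b x] by (intro mult_mono) auto
  moreover have "\<bar>\<Sum>j\<in>UNIV. bump2 b j x\<bar> * y = 2 * b * bump b x * \<bar>2 * (b + 1) * (x \<bullet> x / y) - real CARD('n)\<bar>"
    unfolding sum_bump2 y_def[symmetric] using y assms bump_pos[of b x] by (simp add: abs_mult)
  ultimately show ?thesis by (simp add: y_def)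
qed

text \<open>The common core of the three comparison arguments. For \<open>r = - 1\<close> the inner
  sphere is empty and the shell is a full ball; a positive \<open>r\<close> gives the exterior
  domain.\<close>

lemma interior_max_exists:
  fixes W :: "real \<times> (real ^ 'n) \<Rightarrow> real"
  assumes cont: "continuous_on ({a..b} \<times> {x. r \<le> norm x \<and> norm x \<le> R}) W"
    and pt: "a \<le> t0" "t0 \<le> b" "r \<le> norm x0" "norm x0 \<le> R"
    and bdry: "\<And>t x. \<lbrakk>a \<le> t; t \<le> b; r \<le> norm x; norm x \<le> R; t = a \<or> norm x = r \<or> norm x = R\<rbrakk>
      \<Longrightarrow> W (t, x) < W (t0, x0)"
  obtains t x d where "a < t" "t \<le> b" "r < norm x" "norm x < R" "W (t0, x0) \<le> W (t, x)" "d > 0"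
    "\<And>t'. \<lbrakk>a < t'; t' < t\<rbrakk> \<Longrightarrow> W (t', x) \<le> W (t, x)"
    "\<And>j s. \<bar>s\<bar> < d \<Longrightarrow> W (t, x + s *\<^sub>R axis j 1) \<le> W (t, x)"
proof -
  let ?S = "{a..b} \<times> {x :: real ^ 'n. r \<le> norm x \<and> norm x \<le> R}"
  have "{x :: real ^ 'n. r \<le> norm x \<and> norm x \<le> R} = cball 0 R - ball 0 r"
    by auto
  then have "compact ?S"
    by (auto intro!: compact_Times compact_diff)
  then obtain z where z: "z \<in> ?S" "\<And>y. y \<in> ?S \<Longrightarrow> W y \<le> W z"
    using continuous_attains_sup[OF _ _ cont] pt by force
  obtain t x where tx: "z = (t, x)" by fastforce
  have ge: "W (t0, x0) \<le> W (t, x)" using z(2)[of "(t0, x0)"] pt by (simp add: tx)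
  have mem: "a \<le> t" "t \<le> b" "r \<le> norm x" "norm x \<le> R" using z(1) by (auto simp: tx)
  have "t \<noteq> a" "norm x \<noteq> r" "norm x \<noteq> R" using bdry[OF mem] ge by force+
  then have strict: "a < t" "r < norm x" "norm x < R" using mem by auto
  define d where "d = min (norm x - r) (R - norm x)"
  have "W (t, x + s *\<^sub>R axis j 1) \<le> W (t, x)" if "\<bar>s\<bar> < d" for j s
  proof -
    have n: "norm (s *\<^sub>R axis j 1 :: real ^ 'n) < d" using that by simp
    have "norm x - norm (s *\<^sub>R axis j 1 :: real ^ 'n) \<le> norm (x + s *\<^sub>R axis j 1)"
      by (rule norm_diff_ineq)
    moreover have "norm (x + s *\<^sub>R axis j 1) \<le> norm x + norm (s *\<^sub>R axis j 1 :: real ^ 'n)"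
      by (rule norm_triangle_ineq)
    ultimately have "r \<le> norm (x + s *\<^sub>R axis j 1) \<and> norm (x + s *\<^sub>R axis j 1) \<le> R"
      using n unfolding d_def by linarith
    then show ?thesis using z(2)[of "(t, x + s *\<^sub>R axis j 1)"] mem by (simp add: tx)
  qed
  moreover have "W (t', x) \<le> W (t, x)" if "a < t'" "t' < t" for t'
    using z(2)[of "(t', x)"] mem that by (simp add: tx)
  moreover have "d > 0" using strict by (simp add: d_def)
  ultimately show ?thesis using that strict mem ge by blast
qed

context pressure_eq
begin

lemma continuous: "continuous_on ({0<..} \<times> UNIV) V"
proof -
  have "V differentiable at z" if "z \<in> {0<..} \<times> UNIV" for z
    using diff0 that by auto
  then show ?thesis
    by (meson continuous_at_imp_continuous_on differentiable_imp_continuous_within)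
qed

text \<open>The coefficient V^\<theta> may be unbounded where V is small, but a violation has N < V
  <= M, and this bounds V^\<theta> for either sign of \<theta>. The perturbation \<epsilon> (K t +
  |x|^2) replaces a condition at infinity.\<close>

lemma weak_maximum_principle:
  assumes cont: "continuous_on ({0..} \<times> UNIV) V"
    and le_M: "\<And>t x. t \<ge> 0 \<Longrightarrow> V (t, x) \<le> M"
    and init: "\<And>x. V (0, x) \<le> N" and N: "N > 0" and t0: "t0 \<ge> 0"
  shows "V (t0, x0) \<le> N"
proof (rule ccontr)
  assume "\<not> V (t0, x0) \<le> N"
  then have gt: "V (t0, x0) - N > 0" by simp
  define C where "C = N powr \<theta> + M powr \<theta>"
  \<comment> \<open>At the maximum each second derivative of V is at most 2 \<epsilon>, so V_t is at
    most 2 n m C \<epsilon>; the added 1 makes \<epsilon> K strictly larger.\<close>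
  define K where "K = 2 * real CARD('n) * m * C + 1"
  define \<epsilon> where "\<epsilon> = (V (t0, x0) - N) / (2 * (K * t0 + x0 \<bullet> x0 + 1))"
  have C: "C \<ge> 0" by (simp add: C_def)
  have K: "K > 0" using C m_pos by (simp add: K_def add_nonneg_pos)
  have den: "K * t0 + x0 \<bullet> x0 + 1 > 0" using K t0 by (simp add: add_nonneg_pos)
  have \<epsilon>: "\<epsilon> > 0" using gt den by (simp add: \<epsilon>_def)
  have \<epsilon>': "\<epsilon> * (K * t0 + x0 \<bullet> x0) < V (t0, x0) - N"
  proof -
    have "\<epsilon> * (K * t0 + x0 \<bullet> x0) \<le> \<epsilon> * (K * t0 + x0 \<bullet> x0 + 1)" using \<epsilon> by (intro mult_left_mono) auto
    also have "\<dots> = (V (t0, x0) - N) / 2" using den by (simp add: \<epsilon>_def field_simps)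
    finally show ?thesis using gt by simp
  qed
  have M: "M > N" using gt le_M[OF t0, of x0] by simp
  define R where "R = M / \<epsilon> + norm x0 + 1"
  have R: "R \<ge> 1" "norm x0 \<le> R" using \<epsilon> M N by (auto simp: R_def)
  have R2: "\<epsilon> * R\<^sup>2 \<ge> M"
  proof -
    have "M / \<epsilon> \<le> R" by (simp add: R_def)
    also have "R \<le> R\<^sup>2" using R by (simp add: power2_eq_square mult_left_le)
    finally show ?thesis using \<epsilon> by (simp add: field_simps)
  qed
  define W where "W z = V z - N - \<epsilon> * (K * fst z + snd z \<bullet> snd z)" for z
  have W0: "W (t0, x0) > 0" using \<epsilon>' by (simp add: W_def)
  have contW: "continuous_on ({0..t0} \<times> {x. - 1 \<le> norm x \<and> norm x \<le> R}) W"
    unfolding W_def by (intro continuous_intros continuous_on_subset[OF cont]) auto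
  have bdry: "W (t, x) < W (t0, x0)"
    if h: "0 \<le> t" "t \<le> t0" "- 1 \<le> norm x" "norm x \<le> R" "t = 0 \<or> norm x = - 1 \<or> norm x = R" for t x
  proof -
    consider "t = 0" | "norm x = R" using h(5) norm_ge_zero[of x] by force
    then have "W (t, x) \<le> 0"
    proof cases
      case 1
      moreover have "0 \<le> \<epsilon> * (x \<bullet> x)" using \<epsilon> by simp
      ultimately show ?thesis using init[of x] by (simp add: W_def)
    next
      case 2
      then have "x \<bullet> x = R\<^sup>2" by (simp add: power2_norm_eq_inner[symmetric])
      moreover have "\<epsilon> * (K * t) \<ge> 0" using \<epsilon> K that by simp
      ultimately show ?thesis
        using le_M[OF that(1), of x] R2 N unfolding W_def by (simp add: distrib_left)
    qed
    then show ?thesis using W0 by simp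
  qed
  obtain t x d where mx: "0 < t" "t \<le> t0" "W (t0, x0) \<le> W (t, x)" "d > 0"
    "\<And>t'. \<lbrakk>0 < t'; t' < t\<rbrakk> \<Longrightarrow> W (t', x) \<le> W (t, x)"
    "\<And>j s. \<bar>s\<bar> < d \<Longrightarrow> W (t, x + s *\<^sub>R axis j 1) \<le> W (t, x)"
    by (rule interior_max_exists[OF contW t0 order_refl _ R(2) bdry, simplified])
      (use norm_ge_zero[of x0] in \<open>auto intro: order_trans[OF _ norm_ge_zero]\<close>)
  have "((\<lambda>r. W (r, x)) has_real_derivative dird tvec V (t, x) - \<epsilon> * K) (at t)"
    unfolding W_def using DERIV_t_line[OF diff0[OF mx(1), of x]] by (auto intro!: derivative_eq_intros)
  from left_max_DERIV[OF mx(1,5) this] have t: "dird tvec V (t, x) \<ge> \<epsilon> * K" by simp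
  have j: "D2 j j (t, x) \<le> 2 * \<epsilon>" for j
  proof -
    let ?l = "\<lambda>r. x + r *\<^sub>R axis j 1"
    have 1: "((\<lambda>r. W (t, ?l r)) has_real_derivative D1 j (t, ?l s) - 0 - \<epsilon> * (0 + 2 * ?l s $ j)) (at s)" for s
      unfolding W_def fst_conv snd_conv
      by (intro DERIV_diff DERIV_const DERIV_cmult DERIV_add DERIV_inner_line DERIV_x_line diff0 mx(1))
    have 2: "((\<lambda>r. D1 j (t, ?l r) - 0 - \<epsilon> * (0 + 2 * ?l r $ j)) has_real_derivative
        D2 j j (t, ?l 0) - 0 - \<epsilon> * (0 + 2 * 1)) (at 0)"
      by (intro DERIV_diff DERIV_const DERIV_cmult DERIV_add DERIV_nth_line DERIV_x_line diff1 mx(1))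
    show ?thesis
      using local_max_DERIV2(2)[OF mx(4), of "\<lambda>r. W (t, ?l r)", OF _ 1 2] mx(6) by simp
  qed
  have V: "N < V (t, x)" "V (t, x) \<le> M"
  proof -
    have "\<epsilon> * (K * t + x \<bullet> x) \<ge> 0" using \<epsilon> K mx(1) by simp
    then show "N < V (t, x)" using mx(3) W0 by (simp add: W_def)
  qed (use le_M mx(1) in simp)
  have Vth: "V (t, x) powr \<theta> \<le> C"
  proof (cases "\<theta> \<ge> 0")
    case True
    then show ?thesis using powr_mono2[of \<theta> "V (t, x)" M] V N by (simp add: C_def add_increasing)
  next
    case False
    then show ?thesis using powr_mono2'[of \<theta> N "V (t, x)"] V N by (simp add: C_def add_increasing2)
  qed
  have "(\<Sum>j\<in>UNIV. D2 j j (t, x)) \<le> real CARD('n) * (2 * \<epsilon>)"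
    using sum_bounded_above[of UNIV "\<lambda>j. D2 j j (t, x)" "2 * \<epsilon>"] j by simp
  then have "dird tvec V (t, x) \<le> m * V (t, x) powr \<theta> * (real CARD('n) * (2 * \<epsilon>))"
    unfolding eq[OF mx(1)] using m_pos by (intro mult_left_mono) auto
  also have "\<dots> \<le> m * C * (real CARD('n) * (2 * \<epsilon>))"
    using Vth m_pos \<epsilon> by (intro mult_right_mono mult_left_mono) auto
  also have "\<dots> < \<epsilon> * K" using \<epsilon> by (simp add: K_def algebra_simps)
  finally show False using t by simp
qed

end

section \<open>Lower bounds in the fast diffusion case\<close>

context pressure_eq
begin

text \<open>The bound is a subsolution with positive Laplacian on an exterior domain; it vanishes at
  \<open>t = t0\<close> and at infinity, so that no information on \<open>V\<close> is needed there.\<close>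

lemma algebraic_lower_bound:
  assumes \<theta>: "\<theta> < 0" and t0: "0 < t0" "t0 < T"
    and b: "b > 0" "2 * b > real CARD('n) - 2" "1 \<le> - b * \<theta>"
  obtains \<epsilon> where "\<epsilon> > 0"
    "\<And>t x. \<lbrakk>t0 \<le> t; t \<le> T\<rbrakk> \<Longrightarrow> \<epsilon> * (t - t0) powr (- 1 / \<theta>) * bump b x \<le> V (t, x)"
proof -
  \<comment> \<open>The power for which Y^\<theta> is proportional to 1 / (t - t0), as is Y_t / Y =
    \<nu> / (t - t0).\<close>
  define \<nu> where "\<nu> = - 1 / \<theta>"
  have \<nu>: "\<nu> > 0" using \<theta> by (simp add: \<nu>_def)
  define \<delta> where "\<delta> = 2 * b + 2 - real CARD('n)"
  have \<delta>: "\<delta> > 0" using b by (simp add: \<delta>_def)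
  \<comment> \<open>Beyond this radius the bracket in the Laplacian of the profile falls short of
    its limit \<delta> by at most \<delta> / 2, which leaves \<open>l\<close>.\<close>
  define r0 where "r0 = 4 * (b + 1) / \<delta> + 1"
  have r0: "r0 \<ge> 1" using b \<delta> by (simp add: r0_def)
  define l where "l = \<delta> / 2"
  have l: "l > 0" using \<delta> by (simp add: l_def)
  have far: "l \<le> 2 * (b + 1) * (x \<bullet> x / (1 + x \<bullet> x)) - real CARD('n)" if "norm x > r0" for x :: "real ^ 'n"
  proof -
    define y where "y = 1 + x \<bullet> x"
    have y: "y > 0" unfolding y_def by (rule one_plus_inner_pos)
    have "r0 \<le> r0 * r0" using r0 mult_right_mono[of 1 r0 r0] by simp
    also have "\<dots> \<le> norm x * norm x" using that r0 by (intro mult_mono) auto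
    also have "\<dots> \<le> y" by (simp add: y_def power2_norm_eq_inner[symmetric] power2_eq_square)
    finally have "4 * (b + 1) / \<delta> \<le> y" by (simp add: r0_def)
    define A where "A = 2 * (b + 1) / y"
    have "A \<le> \<delta> / 2" using \<open>4 * (b + 1) / \<delta> \<le> y\<close> \<delta> y by (simp add: A_def field_simps)
    have "x \<bullet> x / y = 1 - 1 / y" using y by (simp add: y_def field_simps)
    then have *: "2 * (b + 1) * (x \<bullet> x / y) = 2 * (b + 1) - A"
      by (simp only: A_def right_diff_distrib times_divide_eq_right mult_1_right)
    show ?thesis
      using \<open>A \<le> \<delta> / 2\<close> l_def \<delta>_def unfolding y_def[symmetric] * by argo
  qed
  have "continuous_on ({t0..T} \<times> cball 0 r0) V"
    by (rule continuous_on_subset[OF continuous]) (use t0 in auto)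
  moreover have "compact ({t0..T} \<times> cball (0 :: real ^ 'n) r0)"
    by (intro compact_Times) auto
  moreover have "{t0..T} \<times> cball (0 :: real ^ 'n) r0 \<noteq> {}" using t0 r0 by auto
  ultimately obtain z0 where z0: "z0 \<in> {t0..T} \<times> cball 0 r0" "\<And>z. z \<in> {t0..T} \<times> cball 0 r0 \<Longrightarrow> V z0 \<le> V z"
    by (meson continuous_attains_inf)
  define c where "c = V z0"
  have c: "c > 0" using z0(1) pos t0 by (cases z0) (auto simp: c_def)
  have near: "c \<le> V (t, x)" if "t0 \<le> t" "t \<le> T" "norm x \<le> r0" for t x
    unfolding c_def using z0(2)[of "(t, x)"] that by simp
  define Z where "Z = \<nu> / (2 * b * l * m)"
  have Z: "Z > 0" using \<nu> b l m_pos by (simp add: Z_def)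
  \<comment> \<open>The first entry keeps Y below V on the inner ball. The second gives
    \<open>Z \<le> \<epsilon> powr \<theta>\<close>, since \<theta> < 0 reverses the order;
    \<open>Z\<close> is the value at which diffusion of Y matches its growth in time.\<close>
  define \<epsilon> where "\<epsilon> = min (c / (2 * (T - t0) powr \<nu>)) (Z powr (1 / \<theta>))"
  have \<epsilon>: "\<epsilon> > 0" using c t0 Z by (simp add: \<epsilon>_def)
  have \<epsilon>c: "\<epsilon> * (T - t0) powr \<nu> < c"
  proof -
    have "\<epsilon> * (T - t0) powr \<nu> \<le> c / (2 * (T - t0) powr \<nu>) * (T - t0) powr \<nu>"
      by (intro mult_right_mono) (auto simp: \<epsilon>_def)
    also have "\<dots> < c" using c t0 by simp
    finally show ?thesis .
  qed
  have \<epsilon>Z: "Z \<le> \<epsilon> powr \<theta>"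
  proof -
    have "(Z powr (1 / \<theta>)) powr \<theta> \<le> \<epsilon> powr \<theta>"
      using \<epsilon> \<theta> by (intro powr_mono2') (auto simp: \<epsilon>_def)
    then show ?thesis using Z \<theta> by (simp add: powr_powr)
  qed
  define Y where "Y t x = \<epsilon> * (t - t0) powr \<nu> * bump b x" for t and x :: "real ^ 'n"
  have Y_le: "Y t x \<le> \<epsilon> * (T - t0) powr \<nu> * bump b x" if "t0 \<le> t" "t \<le> T" for t x
    unfolding Y_def using \<epsilon> \<nu> that bump_pos[of b x]
    by (intro mult_right_mono mult_left_mono powr_mono2) auto
  have Y_near: "Y t x < V (t, x)" if "t0 \<le> t" "t \<le> T" "norm x \<le> r0" for t x
  proof -
    have "Y t x \<le> \<epsilon> * (T - t0) powr \<nu> * 1"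
      using Y_le[OF that(1,2), of x] bump_le_1[of b x] b \<epsilon>
      by (meson less_eq_real_def mult_left_mono mult_nonneg_nonneg order_trans powr_ge_zero)
    then show ?thesis using \<epsilon>c near[OF that] by simp
  qed
  have main: "Y t x \<le> V (t, x)" if h: "t0 \<le> t" "t \<le> T" for t x
  proof (rule ccontr)
    assume "\<not> Y t x \<le> V (t, x)"
    define W where "W z = Y (fst z) (snd z) - V z" for z
    define d where "d = W (t, x)"
    have d: "d > 0" using \<open>\<not> Y t x \<le> V (t, x)\<close> by (simp add: d_def W_def)
    have x: "norm x > r0" using Y_near[OF h, of x] d by (force simp: d_def W_def)
    define C where "C = \<epsilon> * (T - t0) powr \<nu>"
    have C: "C > 0" using \<epsilon> t0 by (simp add: C_def)
    define R where "R = (d / (2 * C)) powr (- 1 / b) + norm x"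
    have R: "norm x \<le> R" "1 \<le> R" using x r0 by (auto simp: R_def add_increasing)
    have bump_R: "C * bump b y < d" if "norm y = R" for y :: "real ^ 'n"
    proof -
      have "(d / (2 * C)) powr (- 1 / b) \<le> R" by (simp add: R_def)
      also have "R \<le> R * R" using R(2) mult_right_mono[of 1 R R] by simp
      also have "\<dots> \<le> 1 + y \<bullet> y" using that by (simp add: power2_norm_eq_inner[symmetric] power2_eq_square)
      finally have "(1 + y \<bullet> y) powr (- b) \<le> ((d / (2 * C)) powr (- 1 / b)) powr (- b)"
        using b d C by (intro powr_mono2') auto
      also have "\<dots> = d / (2 * C)" using b d C by (simp add: powr_powr)
      finally have "C * bump b y \<le> d / 2" using C by (simp add: bump_def field_simps)
      then show ?thesis using d by simp
    qed
    have "continuous_on ({t0..T} \<times> {y. r0 \<le> norm y \<and> norm y \<le> R}) (\<lambda>z. Y (fst z) (snd z))"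
    proof -
      have "continuous_on ({t0..T} \<times> {y. r0 \<le> norm y \<and> norm y \<le> R}) (\<lambda>z. (fst z - t0) powr \<nu>)"
        using \<nu> by (intro continuous_on_powr' continuous_intros) auto
      then show ?thesis
        unfolding Y_def
        by (intro continuous_on_mult continuous_on_bump continuous_on_const continuous_on_snd continuous_on_id)
    qed
    moreover have "continuous_on ({t0..T} \<times> {y. r0 \<le> norm y \<and> norm y \<le> R}) V"
      by (rule continuous_on_subset[OF continuous]) (use t0 in auto)
    ultimately have contW: "continuous_on ({t0..T} \<times> {y. r0 \<le> norm y \<and> norm y \<le> R}) W"
      unfolding W_def by (rule continuous_on_diff)
    have bdry: "W (s, y) < W (t, x)"
      if "t0 \<le> s" "s \<le> T" "r0 \<le> norm y" "norm y \<le> R" "s = t0 \<or> norm y = r0 \<or> norm y = R" for s y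
    proof -
      have Vp: "V (s, y) > 0" using pos that(1) t0 by simp
      have "W (s, y) < d"
        using that(5)
      proof (elim disjE)
        assume "s = t0"
        then show ?thesis using Vp d by (simp add: W_def Y_def)
      next
        assume "norm y = r0"
        then show ?thesis using Y_near[OF that(1,2), of y] d by (simp add: W_def)
      next
        assume "norm y = R"
        from bump_R[OF this] Y_le[OF that(1,2), of y] Vp show ?thesis by (simp add: W_def C_def)
      qed
      then show ?thesis by (simp add: d_def)
    qed
    obtain s y e where mx: "t0 < s" "s \<le> T" "r0 < norm y" "norm y < R" "W (t, x) \<le> W (s, y)" "e > 0"
      "\<And>s'. \<lbrakk>t0 < s'; s' < s\<rbrakk> \<Longrightarrow> W (s', y) \<le> W (s, y)"
      "\<And>j r. \<bar>r\<bar> < e \<Longrightarrow> W (s, y + r *\<^sub>R axis j 1) \<le> W (s, y)"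
      using interior_max_exists[OF contW h less_imp_le[OF x] R(1) bdry] by blast
    have s: "s > 0" using mx(1) t0 by simp
    define q where "q = \<epsilon> * (s - t0) powr \<nu>"
    have q: "q > 0" using \<epsilon> mx(1) by (simp add: q_def)
    have VY: "V (s, y) < Y s y" using mx(5) d by (simp add: W_def d_def)
    have Yq: "Y s y = q * bump b y" by (simp add: Y_def q_def)
    have Y_pos: "Y s y > 0" using q bump_pos[of b y] by (simp add: Yq)
    have D: "q * bump2 b j y \<le> D2 j j (s, y)" for j
    proof -
      let ?l = "\<lambda>r. y + r *\<^sub>R axis j 1"
      have 1: "((\<lambda>r. W (s, ?l r)) has_real_derivative q * bump1 b j (?l r) - D1 j (s, ?l r)) (at r)" for r
        unfolding W_def fst_conv snd_conv Y_def q_def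
        by (intro DERIV_diff DERIV_cmult DERIV_bump DERIV_x_line diff0 s)
      have 2: "((\<lambda>r. q * bump1 b j (?l r) - D1 j (s, ?l r)) has_real_derivative
          q * bump2 b j (?l 0) - D2 j j (s, ?l 0)) (at 0)"
        by (intro DERIV_diff DERIV_cmult DERIV_bump1 DERIV_x_line diff1 s)
      show ?thesis
        using local_max_DERIV2(2)[OF mx(6), of "\<lambda>r. W (s, ?l r)", OF _ 1 2] mx(8) by simp
    qed
    have "(\<Sum>j\<in>UNIV. q * bump2 b j y) \<le> (\<Sum>j\<in>UNIV. D2 j j (s, y))"
      by (intro sum_mono D)
    moreover have "Y s y * (2 * b * l / (1 + y \<bullet> y)) \<le> (\<Sum>j\<in>UNIV. q * bump2 b j y)"
    proof -
      have "2 * b * bump b y / (1 + y \<bullet> y) * l \<le> (\<Sum>j\<in>UNIV. bump2 b j y)"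
        unfolding sum_bump2 using far[OF mx(3)] b bump_pos[of b y] one_plus_inner_pos[of y]
        by (intro mult_left_mono) auto
      then have "q * (2 * b * bump b y / (1 + y \<bullet> y) * l) \<le> q * (\<Sum>j\<in>UNIV. bump2 b j y)"
        using q by (intro mult_left_mono) auto
      then show ?thesis by (simp add: Yq sum_distrib_left mult_ac)
    qed
    ultimately have lap: "Y s y * (2 * b * l / (1 + y \<bullet> y)) \<le> (\<Sum>j\<in>UNIV. D2 j j (s, y))" by simp
    have lap_pos: "Y s y * (2 * b * l / (1 + y \<bullet> y)) > 0"
      using Y_pos b l one_plus_inner_pos[of y] by simp
    have "((\<lambda>r. W (r, y)) has_real_derivative
        \<epsilon> * (\<nu> * (s - t0) powr (\<nu> - 1) * (1 - 0)) * bump b y - dird tvec V (s, y)) (at s)"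
      unfolding W_def fst_conv snd_conv Y_def
      by (intro DERIV_diff DERIV_cmult_right DERIV_cmult DERIV_powr_chain DERIV_t_line diff0 s DERIV_ident DERIV_const)
        (use mx(1) in auto)
    from left_max_DERIV[OF mx(1,7) this]
    have "dird tvec V (s, y) \<le> \<epsilon> * (\<nu> * (s - t0) powr (\<nu> - 1)) * bump b y" by simp
    also have "\<dots> = Y s y * (\<nu> / (s - t0))"
      using mx(1) by (simp add: Y_def powr_diff)
    finally have upper: "dird tvec V (s, y) \<le> Y s y * (\<nu> / (s - t0))" .
    have "Y s y powr \<theta> = \<epsilon> powr \<theta> * (s - t0) powr (\<nu> * \<theta>) * (1 + y \<bullet> y) powr (- b * \<theta>)"
      unfolding Y_def bump_def using \<epsilon> mx(1) one_plus_inner_pos[of y] by (simp add: powr_mult powr_powr)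
    also have "(s - t0) powr (\<nu> * \<theta>) = 1 / (s - t0)"
      using mx(1) \<theta> by (simp add: \<nu>_def powr_minus_divide)
    \<comment> \<open>By \<open>1 \<le> - b * \<theta>\<close> the growth of Y^\<theta> in space
      compensates the factor 1 / (1 + |y|^2) of the Laplacian.\<close>
    also have "\<epsilon> powr \<theta> * (1 / (s - t0)) * (1 + y \<bullet> y) powr (- b * \<theta>) \<ge> Z * (1 / (s - t0)) * (1 + y \<bullet> y) powr 1"
      using \<epsilon>Z Z mx(1) b(3) by (intro mult_mono powr_mono) auto
    finally have "Z * (1 / (s - t0)) * (1 + y \<bullet> y) \<le> Y s y powr \<theta>"
      using one_plus_inner_pos[of y] by simp
    \<comment> \<open>Where V lies below Y its diffusion coefficient is larger, as \<theta> < 0.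
      Since the Laplacian is positive, V_t exceeds the growth rate of Y, against the time condition
      at the maximum.\<close>
    moreover have "Y s y powr \<theta> < V (s, y) powr \<theta>"
      using powr_less_mono2_neg[OF \<theta> _ VY] pos s by simp
    ultimately have "Z * (1 / (s - t0)) * (1 + y \<bullet> y) < V (s, y) powr \<theta>" by simp
    then have "m * (Z * (1 / (s - t0)) * (1 + y \<bullet> y)) * (Y s y * (2 * b * l / (1 + y \<bullet> y)))
        < m * V (s, y) powr \<theta> * (Y s y * (2 * b * l / (1 + y \<bullet> y)))"
      using m_pos lap_pos by (intro mult_strict_right_mono mult_strict_left_mono) auto
    also have "\<dots> \<le> dird tvec V (s, y)"
      unfolding eq[OF s] using lap m_pos by (intro mult_left_mono) auto
    also have "m * (Z * (1 / (s - t0)) * (1 + y \<bullet> y)) * (Y s y * (2 * b * l / (1 + y \<bullet> y))) = Y s y * (\<nu> / (s - t0))"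
    proof -
      have "m * (Z * (1 / r) * w) * (Y s y * (2 * b * l / w)) = Y s y * (\<nu> / r)" if "r > 0" "w > 0" for r w
        using that b l m_pos by (simp add: Z_def)
      then show ?thesis using one_plus_inner_pos[of y] mx(1) by simp
    qed
    finally show False using upper by simp
  qed
  show ?thesis
    using that[OF \<epsilon>] main unfolding Y_def \<nu>_def by blast
qed

end

text \<open>The exponent \<theta> + k = - a of V has to be controlled. If (n - 2) a >= 2, then (n -
  1) a >= a + 2, and inserting this in \<open>cond\<close> leaves (a + 2) (\<theta> + a)^2 < 0,
  where \<theta> + a = - k.\<close>

lemma tail_exponent_pos:
  fixes k \<theta> n :: real
  assumes cond: "(k - 1)\<^sup>2 + (n - 1) * \<theta>\<^sup>2 < (1 - \<theta>)\<^sup>2" and k: "k > 0" and a: "a = - \<theta> - k" "a > 0"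
  shows "(n - 2) * a < 2"
proof (rule ccontr)
  assume "\<not> (n - 2) * a < 2"
  then have "a + 2 \<le> (n - 1) * a" by (simp add: algebra_simps)
  then have "(a + 2) * \<theta>\<^sup>2 \<le> a * ((n - 1) * \<theta>\<^sup>2)"
    using mult_right_mono[of "a + 2" "(n - 1) * a" "\<theta>\<^sup>2"] by (simp add: mult_ac)
  also have "\<dots> < a * ((1 - \<theta>)\<^sup>2 - (k - 1)\<^sup>2)"
    using cond a by (intro mult_strict_left_mono) auto
  also have "(1 - \<theta>)\<^sup>2 - (k - 1)\<^sup>2 = (- 2 * \<theta> - a) * (2 + a)"
  proof -
    have k: "k = - \<theta> - a" using a(1) by simp
    show ?thesis unfolding k by (simp add: power2_eq_square algebra_simps)
  qed
  finally have "(a + 2) * (\<theta>\<^sup>2 + 2 * \<theta> * a + a\<^sup>2) < 0"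
    by (simp add: algebra_simps power2_eq_square)
  moreover have "(a + 2) * (\<theta> + a)\<^sup>2 \<ge> 0" using a by simp
  ultimately show False by (simp add: power2_sum algebra_simps)
qed

text \<open>A negative \<open>k\<close> has (k - 1)^2 > 1, so \<open>cond\<close> leaves (n - 2)
  \<theta>^2 < - 2 \<theta>.\<close>

lemma tail_exponent_neg:
  fixes k \<theta> n :: real
  assumes cond: "(k - 1)\<^sup>2 + (n - 1) * \<theta>\<^sup>2 < (1 - \<theta>)\<^sup>2" and k: "k < 0" and \<theta>: "\<theta> < 0"
  shows "(n - 2) * (- \<theta>) < 2"
proof -
  have "(1::real) < (k - 1)\<^sup>2" using k mult_strict_mono[of 1 "1 - k" 1 "1 - k"] by (simp add: power2_eq_square algebra_simps)
  then have "(n - 2) * \<theta>\<^sup>2 < - 2 * \<theta>" using cond by (simp add: power2_eq_square algebra_simps)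
  then have "(- \<theta>) * ((n - 2) * (- \<theta>)) < (- \<theta>) * 2" by (simp add: power2_eq_square algebra_simps)
  then show ?thesis using \<theta> by (simp only: mult_less_cancel_left_pos neg_0_less_iff_less)
qed

context pressure_eq
begin

text \<open>For \<open>e \<ge> 0\<close> the upper bound on V is enough. For \<open>e < 0\<close>
  the algebraic lower bound is used with decay exponent b = - 1 / e, for which the power
  \<open>e\<close> of the profile is exactly 1 + |x|^2; the hypotheses on \<open>e\<close> are its
  conditions on b.\<close>

lemma power_growth:
  assumes t0: "0 < t0" "t0 < T" and le: "\<And>t x. t > 0 \<Longrightarrow> V (t, x) \<le> N"
    and e: "e < 0 \<Longrightarrow> \<theta> \<le> e \<and> (real CARD('n) - 2) * (- e) < 2"
  obtains D where "D > 0"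
    "\<And>t x. \<lbrakk>t0 < t; t \<le> T\<rbrakk> \<Longrightarrow> (t - t0) * V (t, x) powr e \<le> D * (1 + x \<bullet> x)"
proof (cases "e \<ge> 0")
  case True
  have N: "N > 0" using le[OF t0(1), of 0] pos[OF t0(1), of 0] by linarith
  show ?thesis
  proof (rule that[of "(T - t0) * N powr e"])
    show "(T - t0) * N powr e > 0" using t0 N by simp
    fix t and x :: "real ^ 'n"
    assume t: "t0 < t" "t \<le> T"
    have "V (t, x) powr e \<le> N powr e"
      using True le pos t t0 by (intro powr_mono2) (auto intro: less_imp_le)
    then have "(t - t0) * V (t, x) powr e \<le> (T - t0) * N powr e"
      using t by (intro mult_mono) auto
    also have "\<dots> * 1 \<le> (T - t0) * N powr e * (1 + x \<bullet> x)"
      using t0 by (intro mult_left_mono) auto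
    finally show "(t - t0) * V (t, x) powr e \<le> (T - t0) * N powr e * (1 + x \<bullet> x)" by simp
  qed
next
  case False
  define a where "a = - e"
  have a: "a > 0" "a \<le> - \<theta>" "(real CARD('n) - 2) * a < 2" using False e by (auto simp: a_def)
  have \<theta>: "\<theta> < 0" using a by linarith
  have "1 / a > 0" "2 * (1 / a) > real CARD('n) - 2" "1 \<le> - (1 / a) * \<theta>"
    using a by (simp_all add: field_simps)
  from algebraic_lower_bound[OF \<theta> t0 this] obtain \<epsilon> where \<epsilon>: "\<epsilon> > 0"
    "\<And>t x. \<lbrakk>t0 \<le> t; t \<le> T\<rbrakk> \<Longrightarrow> \<epsilon> * (t - t0) powr (- 1 / \<theta>) * bump (1 / a) x \<le> V (t, x)"
    by blast
  \<comment> \<open>A nonnegative leftover power of t - t0 can be bounded by its value at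
    \<open>T\<close>.\<close>
  have ex: "1 + a / \<theta> \<ge> 0" using a \<theta> by (simp add: field_simps)
  show ?thesis
  proof (rule that[of "\<epsilon> powr (- a) * (T - t0) powr (1 + a / \<theta>)"])
    show "\<epsilon> powr (- a) * (T - t0) powr (1 + a / \<theta>) > 0" using t0 \<epsilon> by simp
    fix t and x :: "real ^ 'n"
    assume t: "t0 < t" "t \<le> T"
    have y: "1 + x \<bullet> x > 0" by (rule one_plus_inner_pos)
    have "V (t, x) powr (- a) \<le> (\<epsilon> * (t - t0) powr (- 1 / \<theta>) * bump (1 / a) x) powr (- a)"
      using \<epsilon> t a bump_pos[of "1 / a" x] by (intro powr_mono2') auto
    also have "\<dots> = \<epsilon> powr (- a) * (t - t0) powr (a / \<theta>) * (1 + x \<bullet> x)"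
      using \<epsilon>(1) t a y by (simp add: bump_def powr_mult powr_powr)
    finally have "(t - t0) * V (t, x) powr (- a) \<le> (t - t0) * (\<epsilon> powr (- a) * (t - t0) powr (a / \<theta>) * (1 + x \<bullet> x))"
      using t by (intro mult_left_mono) auto
    also have "\<dots> = \<epsilon> powr (- a) * (t - t0) powr (1 + a / \<theta>) * (1 + x \<bullet> x)"
      using t by (simp add: powr_add mult_ac)
    also have "\<dots> \<le> \<epsilon> powr (- a) * (T - t0) powr (1 + a / \<theta>) * (1 + x \<bullet> x)"
      using t ex y by (intro mult_right_mono mult_left_mono powr_mono2) auto
    finally show "(t - t0) * V (t, x) powr e \<le> \<epsilon> powr (- a) * (T - t0) powr (1 + a / \<theta>) * (1 + x \<bullet> x)"
      by (simp add: a_def)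
  qed
qed

text \<open>Here \<open>S v\<close> is the value that the normalised gradient term of \<open>F\<close> exceeds wherever \<open>F\<close> violates
  the claimed bound by \<open>\<eta>\<close>, so the lemma controls the cutoff errors by that term.\<close>

lemma threshold_bound:
  fixes N k \<eta> :: real
  defines "S \<equiv> \<lambda>v. v powr (- k) * (sgn k * (N powr k - v powr k) + \<eta>)"
  assumes t0: "0 < t0" "t0 < T" and le: "\<And>t x. t > 0 \<Longrightarrow> V (t, x) \<le> N"
    and k: "k \<noteq> 0" and \<eta>: "\<eta> > 0"
    and cond: "(k - 1)\<^sup>2 + (real CARD('n) - 1) * \<theta>\<^sup>2 < (1 - \<theta>)\<^sup>2"
  obtains C where "C > 0"
    "\<And>t x. \<lbrakk>t0 < t; t \<le> T\<rbrakk> \<Longrightarrow> 1 \<le> C * S (V (t, x))"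
    "\<And>t x. \<lbrakk>t0 < t; t \<le> T\<rbrakk> \<Longrightarrow> (t - t0) * V (t, x) powr \<theta> \<le> C * S (V (t, x)) * (1 + x \<bullet> x)"
proof (cases "k > 0")
  case True
  \<comment> \<open>For positive \<open>k\<close> the threshold grows like
    \<open>v powr (- k)\<close> as v tends to 0, so it is V^(\<theta> + k) rather than V^\<theta>
    that must be bounded.\<close>
  have "\<theta> + k < 0 \<Longrightarrow> (real CARD('n) - 2) * (- (\<theta> + k)) < 2"
    using tail_exponent_pos[OF cond True, of "- \<theta> - k"] by simp
  then obtain D where D: "D > 0"
    "\<And>t x. \<lbrakk>t0 < t; t \<le> T\<rbrakk> \<Longrightarrow> (t - t0) * V (t, x) powr (\<theta> + k) \<le> D * (1 + x \<bullet> x)"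
    using power_growth[OF t0 le, of "\<theta> + k"] True by (metis less_eq_real_def less_add_same_cancel1)
  define C where "C = D / \<eta> + N powr k / \<eta>"
  have C: "C > 0" using D(1) \<eta> by (simp add: C_def add_pos_nonneg)
  show ?thesis
  proof (rule that[OF C])
    fix t and x :: "real ^ 'n"
    assume t: "t0 < t" "t \<le> T"
    define v where "v = V (t, x)"
    have v: "v > 0" "v \<le> N" using t t0 pos le by (auto simp: v_def)
    have "v powr k \<le> N powr k" using v True by (intro powr_mono2) auto
    then have S: "S v \<ge> v powr (- k) * \<eta>"
      unfolding S_def using True by (intro mult_left_mono) auto
    have "v powr k * v powr (- k) = 1" using v by (simp flip: powr_add)
    then have "1 \<le> N powr k * v powr (- k)"
      using mult_right_mono[OF \<open>v powr k \<le> N powr k\<close>, of "v powr (- k)"] by simp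
    also have "\<dots> = (N powr k / \<eta>) * (v powr (- k) * \<eta>)" using \<eta> by simp
    also have "\<dots> \<le> C * S v" using S C D(1) \<eta> by (intro mult_mono) (auto simp: C_def)
    finally show "1 \<le> C * S (V (t, x))" by (simp add: v_def)
    have "(t - t0) * v powr \<theta> = ((t - t0) * v powr (\<theta> + k)) * v powr (- k)"
      using v by (simp flip: powr_add)
    also have "\<dots> \<le> (D * (1 + x \<bullet> x)) * v powr (- k)"
      using D(2)[OF t, of x] by (intro mult_right_mono) (auto simp: v_def)
    also have "\<dots> = (D / \<eta>) * (v powr (- k) * \<eta>) * (1 + x \<bullet> x)" using \<eta> by simp
    also have "\<dots> \<le> C * S v * (1 + x \<bullet> x)"
      using S C D(1) \<eta> one_plus_inner_pos[of x] by (intro mult_right_mono mult_mono) (auto simp: C_def)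
    finally show "(t - t0) * V (t, x) powr \<theta> \<le> C * S (V (t, x)) * (1 + x \<bullet> x)" by (simp add: v_def)
  qed
next
  case False
  then have k: "k < 0" using k by simp
  have "\<theta> < 0 \<Longrightarrow> (real CARD('n) - 2) * (- \<theta>) < 2"
    using tail_exponent_neg[OF cond k] by simp
  then obtain D where D: "D > 0"
    "\<And>t x. \<lbrakk>t0 < t; t \<le> T\<rbrakk> \<Longrightarrow> (t - t0) * V (t, x) powr \<theta> \<le> D * (1 + x \<bullet> x)"
    using power_growth[OF t0 le, of \<theta>] by blast
  have N: "N > 0" using le[OF t0(1), of 0] pos[OF t0(1), of 0] by linarith
  define c where "c = min 1 (\<eta> * N powr (- k))"
  have c: "c > 0" using \<eta> N by (simp add: c_def)
  define C where "C = (D + 1) / c"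
  have C: "C > 0" using D(1) c by (simp add: C_def)
  have S: "c \<le> S v" if v: "v > 0" "v \<le> N" for v
  proof -
    \<comment> \<open>For negative \<open>k\<close>, \<open>S v\<close> is a convex combination of 1
      and \<open>\<eta> * N powr (- k)\<close> with weight z = (v / N)^(- k). It is bounded below
      but need not grow for small v, so V^\<theta> itself must be controlled.\<close>
    define z where "z = N powr k * v powr (- k)"
    have "v powr (- k) \<le> N powr (- k)" using v k by (intro powr_mono2) auto
    then have "z \<le> N powr k * N powr (- k)" unfolding z_def by (intro mult_left_mono) auto
    also have "\<dots> = 1" using N by (simp flip: powr_add)
    finally have z: "0 \<le> z" "z \<le> 1" by (auto simp: z_def)
    have "v powr (- k) = N powr (- k) * z" using N by (simp add: z_def flip: powr_add mult.assoc)
    moreover have "v powr (- k) * v powr k = 1" using v by (simp flip: powr_add)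
    ultimately have "S v = (1 - z) * 1 + z * (\<eta> * N powr (- k))"
      unfolding S_def using k by (simp add: z_def algebra_simps)
    moreover have "(1 - z) * c + z * c \<le> (1 - z) * 1 + z * (\<eta> * N powr (- k))"
      using z by (intro add_mono mult_left_mono) (auto simp: c_def)
    ultimately show ?thesis by (simp add: algebra_simps)
  qed
  show ?thesis
  proof (rule that[OF C])
    fix t and x :: "real ^ 'n"
    assume t: "t0 < t" "t \<le> T"
    have *: "c \<le> S (V (t, x))" using S t t0 pos le by simp
    then have **: "D + 1 \<le> C * S (V (t, x))"
      using mult_left_mono[OF *, of "(D + 1) / c"] c D(1) by (simp add: C_def)
    then show "1 \<le> C * S (V (t, x))" using D(1) by simp
    have "(t - t0) * V (t, x) powr \<theta> \<le> D * (1 + x \<bullet> x)" by (rule D(2)[OF t])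
    also have "\<dots> \<le> C * S (V (t, x)) * (1 + x \<bullet> x)"
      using ** one_plus_inner_pos[of x] by (intro mult_right_mono) auto
    finally show "(t - t0) * V (t, x) powr \<theta> \<le> C * S (V (t, x)) * (1 + x \<bullet> x)" .
  qed
qed

end

section \<open>The gradient estimate\<close>

context pressure_eq
begin

text \<open>The order of the choices matters: \<eta> determines \<open>C\<close>, hence
  \<open>c\<close> and \<open>E\<close>; \<kappa> and \<open>c\<close> determine \<epsilon>;
  \<epsilon> and \<open>E\<close> determine the range of \<beta>. Nothing depends on
  \<open>R\<close>, so \<open>R\<close> can tend to infinity before \<beta> tends to 0.\<close>

lemma gradient_bound_interior:
  assumes t0: "0 < t0" "t0 < T" and le: "\<And>t x. t > 0 \<Longrightarrow> V (t, x) \<le> N"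
    and k: "k \<noteq> 0"
    and cond: "(k - 1)\<^sup>2 + (real CARD('n) - 1) * \<theta>\<^sup>2 < (1 - \<theta>)\<^sup>2"
  shows "m * \<bar>k\<bar> * (T - t0) * (V (T, x0) powr (k + \<theta> - 2) * (\<Sum>i\<in>UNIV. (D1 i (T, x0))\<^sup>2))
    + sgn k * V (T, x0) powr k \<le> sgn k * N powr k"
proof (rule field_le_epsilon)
  fix \<eta> :: real assume \<eta>: "\<eta> > 0"
  define \<alpha> where "\<alpha> = k + \<theta> - 2"
  define A where "A t x = m * \<bar>k\<bar> * (t - t0) * (V (t, x) powr \<alpha> * (\<Sum>i\<in>UNIV. (D1 i (t, x))\<^sup>2))" for t x
  define L where "L = sgn k * N powr k + \<eta>"
  have sgn_mono: "sgn k * V (t, x) powr k \<le> sgn k * N powr k" if "t > 0" for t x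
  proof (cases "k > 0")
    case True
    then show ?thesis using pos[OF that, of x] le[OF that, of x] by (simp add: powr_mono2)
  next
    case False
    then show ?thesis using k pos[OF that, of x] le[OF that, of x] by (simp add: powr_mono2')
  qed
  obtain C where C: "C > 0"
    "\<And>t x. \<lbrakk>t0 < t; t \<le> T\<rbrakk> \<Longrightarrow> 1 \<le> C * (V (t, x) powr (- k) * (sgn k * (N powr k - V (t, x) powr k) + \<eta>))"
    "\<And>t x. \<lbrakk>t0 < t; t \<le> T\<rbrakk> \<Longrightarrow> (t - t0) * V (t, x) powr \<theta>
      \<le> C * (V (t, x) powr (- k) * (sgn k * (N powr k - V (t, x) powr k) + \<eta>)) * (1 + x \<bullet> x)"
    using threshold_bound[OF t0 le k \<eta> cond] by blast
  define \<kappa> where "\<kappa> = (1 - \<theta>)\<^sup>2 - (k - 1)\<^sup>2 - (real CARD('n) - 1) * \<theta>\<^sup>2"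
  have \<kappa>: "\<kappa> > 0" using cond by (simp add: \<kappa>_def)
  define c where "c = 1 / (C * \<bar>k\<bar>)"
  have c: "c > 0" using C k by (simp add: c_def)
  define Q where "Q = 2 * \<bar>2 - k\<bar> + 12 + 4 / c"
  have Q: "Q > 0" using c by (simp add: Q_def add_pos_pos add_nonneg_pos)
  define \<epsilon> where "\<epsilon> = min 1 (\<kappa> / (4 * Q))"
  have \<epsilon>: "0 < \<epsilon>" "\<epsilon> \<le> 1" using \<kappa> Q by (auto simp: \<epsilon>_def)
  have \<epsilon>Q: "\<epsilon> * Q < \<kappa> / 2"
  proof -
    have "\<epsilon> * Q \<le> \<kappa> / (4 * Q) * Q" using Q by (intro mult_right_mono) (auto simp: \<epsilon>_def)
    then show ?thesis using \<kappa> Q by simp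
  qed
  define E where "E = C * \<bar>k\<bar> * m"
  have E: "E > 0" using C k m_pos by (simp add: E_def)
  \<comment> \<open>The bound 1 gives \<beta>^2 <= \<beta>; the other entries fit the squared
    gradient and the Laplacian of \<phi> to the two smallness conditions, once 1 / (1 + |x|^2) is
    replaced by E \<phi>^2 P.\<close>
  define \<beta>0 where "\<beta>0 = min 1 (min (\<epsilon>\<^sup>2 / (4 * E)) (\<epsilon> / (2 * (real CARD('n) + 4) * E)))"
  have \<beta>0: "\<beta>0 > 0" using \<epsilon> E by (simp add: \<beta>0_def)
  have cutoff: "(bump \<beta> x0 - (1 + R\<^sup>2) powr (- \<beta>))\<^sup>2 * A T x0 + sgn k * V (T, x0) powr k \<le> L"
    if \<beta>: "0 < \<beta>" "\<beta> \<le> \<beta>0" and R: "norm x0 < R" for \<beta> R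
  proof (rule ccontr)
    define \<phi> where "\<phi> x = bump \<beta> x - (1 + R\<^sup>2) powr (- \<beta>)" for x :: "real ^ 'n"
    define F where "F t x = (\<phi> x)\<^sup>2 * A t x + sgn k * V (t, x) powr k" for t x
    define W where "W z = F (fst z) (snd z)" for z
    assume "\<not> ?thesis"
    then have gt: "F T x0 > L" by (simp add: F_def \<phi>_def)
    have R0: "R > 0" using R norm_ge_zero[of x0] by linarith
    have \<phi>_R: "\<phi> x = 0" if "norm x = R" for x
      using that by (simp add: \<phi>_def bump_def power2_norm_eq_inner[symmetric])
    have contD1: "continuous_on ({t0..T} \<times> {x. - 1 \<le> norm x \<and> norm x \<le> R}) (D1 i)" for i
      by (intro continuous_at_imp_continuous_on ballI differentiable_imp_continuous_within)
        (use diff1 t0 in auto)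
    have contV: "continuous_on ({t0..T} \<times> {x. - 1 \<le> norm x \<and> norm x \<le> R}) V"
      by (rule continuous_on_subset[OF continuous]) (use t0 in auto)
    have V0: "V z \<noteq> 0" if "z \<in> {t0..T} \<times> {x. - 1 \<le> norm x \<and> norm x \<le> R}" for z
      using pos[of "fst z" "snd z"] that t0 by (cases z) auto
    have cont: "continuous_on ({t0..T} \<times> {x. - 1 \<le> norm x \<and> norm x \<le> R}) W"
      unfolding W_def F_def A_def \<phi>_def prod.collapse
      by (intro continuous_on_add continuous_on_mult continuous_on_power continuous_on_diff continuous_on_sum
          continuous_on_bump continuous_on_powr continuous_on_const continuous_on_fst continuous_on_snd
          continuous_on_id contV contD1 ballI V0)
    have bdry: "W (t, x) < W (T, x0)"
      if h: "t0 \<le> t" "t \<le> T" "- 1 \<le> norm x" "norm x \<le> R" "t = t0 \<or> norm x = - 1 \<or> norm x = R" for t x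
    proof -
      have "t = t0 \<or> norm x = R" using h(5) norm_ge_zero[of x] by force
      \<comment> \<open>\<open>A\<close> vanishes at \<open>t0\<close> and \<phi> at radius
        \<open>R\<close>, so the boundary requires no gradient bound.\<close>
      then have "(\<phi> x)\<^sup>2 * A t x = 0" using \<phi>_R[of x] by (auto simp: A_def)
      then have "F t x = sgn k * V (t, x) powr k" by (simp only: F_def add_0_left)
      moreover have "sgn k * V (t, x) powr k \<le> sgn k * N powr k" using sgn_mono h(1) t0 by simp
      ultimately have "F t x < F T x0" using gt \<eta> unfolding L_def by linarith
      then show ?thesis by (simp only: W_def fst_conv snd_conv)
    qed
    have pt: "t0 \<le> T" "- 1 \<le> norm x0" using t0 norm_ge_zero[of x0] by linarith+
    obtain t x d where mx: "t0 < t" "t \<le> T" "norm x < R" "W (T, x0) \<le> W (t, x)" "d > 0"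
      "\<And>t'. \<lbrakk>t0 < t'; t' < t\<rbrakk> \<Longrightarrow> W (t', x) \<le> W (t, x)"
      "\<And>j s. \<bar>s\<bar> < d \<Longrightarrow> W (t, x + s *\<^sub>R axis j 1) \<le> W (t, x)"
      by (rule interior_max_exists[OF cont pt(1) order_refl pt(2) less_imp_le[OF R]], erule (4) bdry) blast
    note mx = mx[unfolded W_def fst_conv snd_conv]
    have t: "t > 0" using mx(1) t0 by simp
    define v where "v = V (t, x)"
    have v: "v > 0" using pos[OF t] by (simp add: v_def)
    have y: "1 + x \<bullet> x > 0" by (rule one_plus_inner_pos)
    have \<phi>_pos: "\<phi> x > 0"
    proof -
      have "x \<bullet> x < R\<^sup>2"
        using mx(3) norm_ge_zero[of x] by (simp add: power2_norm_eq_inner[symmetric] power_strict_mono)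
      then have "(1 + R\<^sup>2) powr (- \<beta>) < bump \<beta> x"
        unfolding bump_def using y \<beta> by (intro powr_less_mono2_neg) auto
      then show ?thesis by (simp add: \<phi>_def)
    qed
    have \<phi>_le: "\<phi> x \<le> 1" using bump_le_1[of \<beta> x] \<beta> by (simp add: \<phi>_def add_increasing2 diff_le_eq)
    define P where "P = (\<Sum>i\<in>UNIV. (D1 i (t, x) / V (t, x))\<^sup>2)"
    define s where "s = m * (t - t0) * V (t, x) powr \<theta>"
    have s: "s > 0" using m_pos mx(1) v by (simp add: s_def v_def)
    define S where "S = v powr (- k) * (sgn k * (N powr k - v powr k) + \<eta>)"
    have S: "1 \<le> C * S" "(t - t0) * v powr \<theta> \<le> C * S * (1 + x \<bullet> x)"
      using C(2)[OF mx(1,2), of x] C(3)[OF mx(1,2), of x] by (simp_all add: S_def v_def)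
    \<comment> \<open>F exceeds \<open>L\<close> at the maximum. Moving the power term to the other
      side and multiplying by \<open>v powr (- k)\<close> makes the threshold a lower bound for the
      gradient term.\<close>
    have SP: "S \<le> (\<phi> x)\<^sup>2 * \<bar>k\<bar> * s * P"
    proof -
      have p: "(\<Sum>i\<in>UNIV. (D1 i (t, x))\<^sup>2) = v\<^sup>2 * P"
        unfolding P_def sum_distrib_left using v by (intro sum.cong refl) (simp add: v_def power_divide)
      have vp: "v powr (- k) * (v powr \<alpha> * v\<^sup>2) = v powr \<theta>"
      proof -
        have "v powr (- k) * (v powr \<alpha> * v\<^sup>2) = v powr (- k + (\<alpha> + 2))"
          unfolding powr_add using v by simp
        then show ?thesis by (simp add: \<alpha>_def)
      qed
      have "sgn k * (N powr k - v powr k) + \<eta> \<le> (\<phi> x)\<^sup>2 * A t x"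
        using gt mx(4) by (simp add: F_def L_def v_def right_diff_distrib)
      then have "S \<le> v powr (- k) * ((\<phi> x)\<^sup>2 * A t x)"
        unfolding S_def by (intro mult_left_mono) auto
      also have "\<dots> = (\<phi> x)\<^sup>2 * \<bar>k\<bar> * (m * (t - t0) * (v powr (- k) * (v powr \<alpha> * v\<^sup>2))) * P"
        unfolding A_def p v_def[symmetric] by simp
      finally show ?thesis unfolding vp by (simp add: s_def v_def)
    qed
    have "C * S \<le> C * ((\<phi> x)\<^sup>2 * \<bar>k\<bar> * s * P)" using SP C(1) by (intro mult_left_mono) auto
    then have "1 \<le> C * ((\<phi> x)\<^sup>2 * \<bar>k\<bar> * s * P)" using S(1) by linarith
    then have c_le: "c \<le> (\<phi> x)\<^sup>2 * s * P" using C(1) k by (simp add: c_def field_simps)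
    have P: "P > 0"
    proof (rule ccontr)
      assume "\<not> P > 0"
      then have "(\<phi> x)\<^sup>2 * s * P \<le> 0" using s by (intro mult_nonneg_nonpos) auto
      then show False using c c_le by linarith
    qed
    \<comment> \<open>Both sides of the growth bound contain (t - t0) v^\<theta>, as it is part of
      \<open>s\<close>; cancelling it leaves a lower bound on \<phi>^2 P by |x| alone.\<close>
    have EP: "1 / (1 + x \<bullet> x) \<le> E * ((\<phi> x)\<^sup>2 * P)"
    proof -
      have "(t - t0) * v powr \<theta> \<le> C * ((\<phi> x)\<^sup>2 * \<bar>k\<bar> * s * P) * (1 + x \<bullet> x)"
        using S(2) mult_right_mono[OF \<open>C * S \<le> _\<close>, of "1 + x \<bullet> x"] y by linarith
      also have "\<dots> = ((t - t0) * v powr \<theta>) * (E * ((\<phi> x)\<^sup>2 * P) * (1 + x \<bullet> x))"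
        by (simp add: s_def E_def v_def)
      finally have "1 \<le> E * ((\<phi> x)\<^sup>2 * P) * (1 + x \<bullet> x)"
        using mx(1) v by (simp add: mult_le_cancel_left1)
      then show ?thesis using y by (simp add: field_simps)
    qed
    have d1: "(\<Sum>j\<in>UNIV. (bump1 \<beta> j x)\<^sup>2) \<le> \<epsilon>\<^sup>2 * ((\<phi> x)\<^sup>2 * P)"
    proof -
      have "(bump \<beta> x)\<^sup>2 \<le> 1" using bump_le_1[of \<beta> x] bump_pos[of \<beta> x] \<beta> by (simp add: power_le_one)
      then have "4 * \<beta>\<^sup>2 * (bump \<beta> x)\<^sup>2 \<le> 4 * \<beta>\<^sup>2 * 1" by (intro mult_left_mono) auto
      then have "(\<Sum>j\<in>UNIV. (bump1 \<beta> j x)\<^sup>2) * (1 + x \<bullet> x) \<le> 4 * \<beta>\<^sup>2"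
        using sum_bump1_sq[of \<beta> x] by linarith
      then have "(\<Sum>j\<in>UNIV. (bump1 \<beta> j x)\<^sup>2) \<le> 4 * \<beta>\<^sup>2 * (1 / (1 + x \<bullet> x))"
        using y by (simp add: field_simps)
      also have "\<dots> \<le> 4 * \<beta>\<^sup>2 * (E * ((\<phi> x)\<^sup>2 * P))" using EP by (intro mult_left_mono) auto
      also have "\<dots> = (4 * \<beta>\<^sup>2 * E) * ((\<phi> x)\<^sup>2 * P)" by simp
      also have "\<dots> \<le> \<epsilon>\<^sup>2 * ((\<phi> x)\<^sup>2 * P)"
      proof (intro mult_right_mono)
        have "\<beta>\<^sup>2 \<le> \<beta>" using \<beta> by (simp add: \<beta>0_def power2_eq_square mult_left_le)
        also have "\<beta> \<le> \<epsilon>\<^sup>2 / (4 * E)" using \<beta> by (simp add: \<beta>0_def)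
        finally show "4 * \<beta>\<^sup>2 * E \<le> \<epsilon>\<^sup>2" using E by (simp add: field_simps)
      qed (use P in auto)
      finally show ?thesis .
    qed
    have d2: "\<bar>\<Sum>j\<in>UNIV. bump2 \<beta> j x\<bar> \<le> \<epsilon> * ((\<phi> x)\<^sup>2 * P)"
    proof -
      have "\<bar>\<Sum>j\<in>UNIV. bump2 \<beta> j x\<bar> * (1 + x \<bullet> x) \<le> 2 * \<beta> * (real CARD('n) + 4)"
        using \<beta> by (intro abs_sum_bump2) (auto simp: \<beta>0_def)
      then have "\<bar>\<Sum>j\<in>UNIV. bump2 \<beta> j x\<bar> \<le> 2 * \<beta> * (real CARD('n) + 4) * (1 / (1 + x \<bullet> x))"
        using y by (simp add: field_simps)
      also have "\<dots> \<le> 2 * \<beta> * (real CARD('n) + 4) * (E * ((\<phi> x)\<^sup>2 * P))"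
        using EP \<beta> by (intro mult_left_mono) auto
      also have "\<dots> = (\<beta> * (2 * (real CARD('n) + 4) * E)) * ((\<phi> x)\<^sup>2 * P)" by simp
      also have "\<dots> \<le> \<epsilon> * ((\<phi> x)\<^sup>2 * P)"
      proof (intro mult_right_mono)
        have "\<beta> \<le> \<epsilon> / (2 * (real CARD('n) + 4) * E)" using \<beta> by (simp add: \<beta>0_def)
        then show "\<beta> * (2 * (real CARD('n) + 4) * E) \<le> \<epsilon>"
          using E by (subst (asm) pos_le_divide_eq) (auto intro!: mult_pos_pos add_nonneg_pos)
      qed (use P in auto)
      finally show ?thesis .
    qed
    have \<phi>1: "((\<lambda>r. \<phi> (x + r *\<^sub>R axis j 1)) has_real_derivative bump1 \<beta> j (x + s *\<^sub>R axis j 1)) (at s)" for x j s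
      unfolding \<phi>_def using DERIV_diff[OF DERIV_bump DERIV_const] by simp
    have F_eq: "F t x = (\<phi> x)\<^sup>2 * (m * \<bar>k\<bar> * (t - t0)) * (V (t, x) powr \<alpha> * (\<Sum>i\<in>UNIV. (D1 i (t, x))\<^sup>2))
      + sgn k * V (t, x) powr k" for t x
      by (simp add: F_def A_def)
    show False
      by (rule no_interior_max[OF \<phi>1 DERIV_bump1 t0(1) mx(1) _ k \<alpha>_def F_eq mx(6) mx(5) mx(7) \<phi>_pos \<phi>_le P_def P s_def
            _ \<epsilon> \<epsilon>Q[unfolded Q_def] c c_le d1 d2])
        (auto simp: \<kappa>_def sgn_if)
  qed
  have lim_R: "(bump \<beta> x0)\<^sup>2 * A T x0 + sgn k * V (T, x0) powr k \<le> L" if \<beta>: "0 < \<beta>" "\<beta> \<le> \<beta>0" for \<beta>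
  proof (rule tendsto_upperbound)
    have "filterlim (\<lambda>R::real. 1 + R\<^sup>2) at_top at_top"
      by (intro filterlim_tendsto_add_at_top[OF tendsto_const] filterlim_pow_at_top filterlim_ident) simp
    then have "((\<lambda>R::real. (1 + R\<^sup>2) powr (- \<beta>)) \<longlongrightarrow> 0) at_top"
      using \<beta> by (intro tendsto_neg_powr) auto
    then have "((\<lambda>R. (bump \<beta> x0 - (1 + R\<^sup>2) powr (- \<beta>))\<^sup>2 * A T x0 + sgn k * V (T, x0) powr k)
        \<longlongrightarrow> (bump \<beta> x0 - 0)\<^sup>2 * A T x0 + sgn k * V (T, x0) powr k) at_top"
      by (intro tendsto_intros)
    then show "((\<lambda>R. (bump \<beta> x0 - (1 + R\<^sup>2) powr (- \<beta>))\<^sup>2 * A T x0 + sgn k * V (T, x0) powr k)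
        \<longlongrightarrow> (bump \<beta> x0)\<^sup>2 * A T x0 + sgn k * V (T, x0) powr k) at_top"
      by simp
    show "\<forall>\<^sub>F R in at_top. (bump \<beta> x0 - (1 + R\<^sup>2) powr (- \<beta>))\<^sup>2 * A T x0 + sgn k * V (T, x0) powr k \<le> L"
      using eventually_gt_at_top[of "norm x0"] by eventually_elim (rule cutoff[OF \<beta>])
  qed simp
  have "A T x0 + sgn k * V (T, x0) powr k \<le> L"
  proof (rule tendsto_upperbound)
    have "((\<lambda>\<beta>. (1 + x0 \<bullet> x0) powr (- \<beta>)) \<longlongrightarrow> (1 + x0 \<bullet> x0) powr (- 0)) (at_right 0)"
      using one_plus_inner_pos[of x0] by (intro tendsto_intros) auto
    then have "((\<lambda>\<beta>. bump \<beta> x0) \<longlongrightarrow> 1) (at_right 0)"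
      using one_plus_inner_pos[of x0] by (simp add: bump_def)
    then have "((\<lambda>\<beta>. (bump \<beta> x0)\<^sup>2 * A T x0 + sgn k * V (T, x0) powr k)
        \<longlongrightarrow> 1\<^sup>2 * A T x0 + sgn k * V (T, x0) powr k) (at_right 0)"
      by (intro tendsto_intros)
    then show "((\<lambda>\<beta>. (bump \<beta> x0)\<^sup>2 * A T x0 + sgn k * V (T, x0) powr k)
        \<longlongrightarrow> A T x0 + sgn k * V (T, x0) powr k) (at_right 0)"
      by simp
    show "\<forall>\<^sub>F \<beta> in at_right 0. (bump \<beta> x0)\<^sup>2 * A T x0 + sgn k * V (T, x0) powr k \<le> L"
      using eventually_at_right_real[OF \<beta>0] by eventually_elim (use lim_R in auto)
  qed simp
  then show "m * \<bar>k\<bar> * (T - t0) * (V (T, x0) powr (k + \<theta> - 2) * (\<Sum>i\<in>UNIV. (D1 i (T, x0))\<^sup>2))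
    + sgn k * V (T, x0) powr k \<le> sgn k * N powr k + \<eta>"
    by (simp add: A_def L_def \<alpha>_def)
qed

end

text \<open>The set where |f| exceeds its essential supremum is open and null, hence empty. The
  bound \<open>B\<close> keeps the supremum finite, since \<open>real_of_ereal\<close> sends
  infinity to 0.\<close>

lemma le_Linf_norm:
  fixes f :: "'a::euclidean_space \<Rightarrow> real"
  assumes cont: "continuous_on UNIV f" and bound: "\<And>y. \<bar>f y\<bar> \<le> B"
  shows "\<bar>f y\<bar> \<le> Linf_norm f"
proof -
  let ?E = "esssup lborel (\<lambda>x. ereal \<bar>f x\<bar>)"
  have cont': "continuous_on UNIV (\<lambda>x. ereal \<bar>f x\<bar>)"
    by (intro continuous_on_ereal continuous_intros cont)
  have meas: "(\<lambda>x. ereal \<bar>f x\<bar>) \<in> borel_measurable lborel"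
    using borel_measurable_continuous_onI[OF cont'] by simp
  have upper: "?E \<le> ereal B"
    by (rule esssup_I[OF meas]) (simp add: bound)
  have "ereal \<bar>f y\<bar> \<le> ?E"
  proof (rule ccontr)
    assume *: "\<not> ereal \<bar>f y\<bar> \<le> ?E"
    define A where "A = {x. ?E < ereal \<bar>f x\<bar>}"
    have "open A"
      unfolding A_def by (intro open_Collect_less continuous_on_const cont')
    have "AE x in lborel. x \<notin> A"
      using esssup_AE[of "\<lambda>x. ereal \<bar>f x\<bar>" lborel] by (simp add: A_def not_less)
    then have "A \<in> null_sets lborel"
      using \<open>open A\<close> by (subst AE_iff_null_sets) auto
    then have "negligible A"
      using negligible_iff_null_sets null_sets_completionI by blast
    moreover have "A \<noteq> {}" using * by (auto simp: A_def not_le)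
    ultimately show False using open_not_negligible[OF \<open>open A\<close>] by blast
  qed
  then show ?thesis
    unfolding Linf_norm_def using upper by (cases ?E) auto
qed

lemma norm_gradient_sq:
  fixes U :: "real \<times> (real ^ 'n) \<Rightarrow> real"
  assumes "U differentiable at (t, x)"
  shows "(norm (gradient (\<lambda>y. U (t, y)) x))\<^sup>2 = (\<Sum>i\<in>UNIV. (dird (xvec i) U (t, x))\<^sup>2)"
proof -
  define D where "D = (\<chi> i. dird (xvec i) U (t, x))"
  have lin: "linear (\<lambda>v. dird v U (t, x))" by (rule linear_frechet_derivative[OF assms])
  have U: "(U has_derivative (\<lambda>v. dird v U (t, x))) (at (t, x))"
    using assms by (simp add: frechet_derivative_works)
  have "((\<lambda>y. (t, y)) has_derivative (\<lambda>v. (0, v))) (at x)"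
    by (intro has_derivative_Pair has_derivative_const has_derivative_ident)
  from has_derivative_compose[OF this U]
  have der: "((\<lambda>y. U (t, y)) has_derivative (\<lambda>v. dird (0, v) U (t, x))) (at x)" .
  have "dird (0, v) U (t, x) = v \<bullet> D" for v
  proof -
    have "(0, v) = (\<Sum>i\<in>UNIV. v $ i *\<^sub>R xvec i)"
      using basis_expansion[of v] by (simp add: sum_prod scalar_mult_eq_scaleR)
    moreover have "dird (0, c *\<^sub>R b) U (t, x) = c * dird (0, b) U (t, x)" for c and b :: "real ^ 'n"
      using linear_cmul[OF lin, of c "(0, b)"] by simp
    ultimately have "dird (0, v) U (t, x) = (\<Sum>i\<in>UNIV. v $ i *\<^sub>R dird (xvec i) U (t, x))"
      using linear_sum[OF lin, of "\<lambda>i. v $ i *\<^sub>R xvec i" UNIV] by simp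
    then show ?thesis by (simp add: D_def inner_vec_def)
  qed
  then have G: "GDERIV (\<lambda>y. U (t, y)) x :> D"
    using der by (simp add: gderiv_def)
  have "gradient (\<lambda>y. U (t, y)) x = D"
    unfolding gradient_def
  proof (rule the_equality)
    show "GDERIV (\<lambda>y. U (t, y)) x :> D" by (rule G)
    fix D' assume "GDERIV (\<lambda>y. U (t, y)) x :> D'"
    then have "(\<lambda>v. v \<bullet> D') = (\<lambda>v. v \<bullet> D)"
      using G unfolding gderiv_def by (rule has_derivative_unique)
    then show "D' = D" by (metis vector_eq_ldot)
  qed
  then show ?thesis
    by (simp add: D_def power2_norm_eq_inner inner_eq_sum_sq)
qed

lemma laplacian_eq_dird:
  fixes V :: "real \<times> (real ^ 'n) \<Rightarrow> real"
  assumes "\<And>y. V differentiable at (t, y)" "\<And>i y. dird (xvec i) V differentiable at (t, y)"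
  shows "laplacian (\<lambda>y. V (t, y)) x = (\<Sum>i\<in>UNIV. dird (xvec i) (dird (xvec i) V) (t, x))"
proof -
  have pd: "partial_deriv i (\<lambda>y. f (t, y)) y = dird (xvec i) f (t, y)"
    if "f differentiable at (t, y)" for f :: "real \<times> (real ^ 'n) \<Rightarrow> real" and i y
    unfolding partial_deriv_def
    using DERIV_x_line[of f t y 0 i] that by (intro DERIV_imp_deriv) simp
  have "partial_deriv i (\<lambda>y. V (t, y)) = (\<lambda>y. dird (xvec i) V (t, y))" for i
    using pd[OF assms(1)] by blast
  then show ?thesis
    unfolding laplacian_def by (simp add: pd[OF assms(2)])
qed

lemma discriminant_pos:
  fixes m :: real and n :: nat
  assumes "n \<ge> 1" "n \<ge> 2 \<Longrightarrow> m \<in> {1 - 1 / sqrt (real n - 1) <..< 1 + 1 / sqrt (real n - 1)}"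
  shows "(real n - 1) * (m - 1)\<^sup>2 < 1"
proof (cases "n \<ge> 2")
  case True
  have n: "real n - 1 > 0" using True by simp
  have "\<bar>m - 1\<bar> < 1 / sqrt (real n - 1)" using assms(2)[OF True] by (auto simp: abs_less_iff)
  then have "\<bar>m - 1\<bar>\<^sup>2 < (1 / sqrt (real n - 1))\<^sup>2" by (intro power_strict_mono) auto
  also have "\<dots> = 1 / (real n - 1)" using n by (simp add: power_divide)
  finally show ?thesis using n by (simp add: field_simps)
next
  case False
  then have "n = 1" using assms(1) by simp
  then show ?thesis by simp
qed

text \<open>The case distinction reflects that the estimate rests on an upper bound for u. For
  \<open>h < 0\<close> it gives u^h >= (sup u_0)^h, so the numerator is nonpositive over a negative
  denominator; the supremum of u_0^h would measure the infimum of u_0 instead.\<close>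

theorem corollary3:
  fixes u :: "real \<Rightarrow> real ^ 'n \<Rightarrow> real"
    and m h hminus hplus T :: real
    and x :: "real ^ 'n"
  assumes m_pos: "m > 0"
    and m_range: "CARD('n) \<ge> 2 \<Longrightarrow>
      m \<in> {1 - 1 / sqrt (real CARD('n) - 1) <..< 1 + 1 / sqrt (real CARD('n) - 1)}"
    and u_pos: "\<And>t y. t \<ge> 0 \<Longrightarrow> u t y > 0"
    and u_bounded: "bounded ((\<lambda>(t, y). u t y) ` ({0..} \<times> UNIV))"
    and u_smooth: "smooth_on ({0..} \<times> UNIV) (\<lambda>(t, y). u t y)"
    and u_solution: "\<And>t y. t > 0 \<Longrightarrow>
      ((\<lambda>s. u s y) has_real_derivative laplacian (\<lambda>z. u t z powr m) y) (at t)"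
    and hminus_def: "hminus = m - sqrt (1 - (real CARD('n) - 1) * (m - 1)\<^sup>2)"
    and hplus_def: "hplus = m + sqrt (1 - (real CARD('n) - 1) * (m - 1)\<^sup>2)"
    and h_range: "h \<in> {hminus..hplus}"
    and h_nonzero: "h \<noteq> 0"
    and T_pos: "T > 0"
  shows "u T x powr (m + h - 3) * (norm (gradient (u T) x))\<^sup>2
    \<le> ((if h > 0 then Linf_norm (\<lambda>y. u 0 y powr h) else Linf_norm (u 0) powr h) - u T x powr h)
       / (T * h * m\<^sup>2)"
proof -

  \<comment> \<open>The power u^m as a solution of the pressure equation\<close>
  define U where "U = (\<lambda>(t, y). u t y)"
  define V where "V z = U z powr m" for z
  define \<theta> where "\<theta> = 1 - 1 / m"
  have U[simp]: "U (t, y) = u t y" for t y by (simp add: U_def)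
  have V: "V (t, y) = u t y powr m" for t y by (simp add: V_def)
  have U_smooth: "C_k_on k ({0..} \<times> UNIV) U" for k
    using u_smooth by (simp add: smooth_on_def U_def)
  have C3U: "C_k_on 3 ({0<..} \<times> UNIV) U"
    by (rule C_k_on_open_subset[OF open_dom _ U_smooth]) auto
  have C3V: "C_k_on 3 ({0<..} \<times> UNIV) V"
    unfolding V_def by (rule C_k_on_powr[OF open_dom C3U]) (use u_pos in \<open>force simp: U_def\<close>)
  have diffU: "U differentiable at (t, y)" if "t > 0" for t y
    using C_k_on_SucD_diff[OF _ that, of 2 U] C3U by (simp only: Suc_numeral semiring_norm)
  have diffV: "V differentiable at (t, y)" if "t > 0" for t y
    using C_k_on_SucD_diff[OF _ that, of 2 V] C3V by (simp only: Suc_numeral semiring_norm)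
  have "C_k_on (Suc 2) ({0<..} \<times> UNIV) V" using C3V by (simp only: Suc_numeral semiring_norm)
  then have "C_k_on (Suc 1) ({0<..} \<times> UNIV) (dird v V)" for v
    by (simp only: C_k_on_open_Suc[OF open_dom] Suc_1)
  then have diffV1: "dird v V differentiable at (t, y)" if "t > 0" for t y v
    using C_k_on_SucD_diff that by blast
  have eqV: "dird tvec V (t, y) = m * V (t, y) powr \<theta> * (\<Sum>i\<in>UNIV. dird (xvec i) (dird (xvec i) V) (t, y))"
    if t: "t > 0" for t y
  proof -
    have "((\<lambda>s. u s y powr m) has_real_derivative m * u t y powr (m - 1) * laplacian (\<lambda>z. u t z powr m) y) (at t)"
      using DERIV_powr_chain[OF u_solution[OF t]] u_pos t by simp
    moreover have "((\<lambda>s. u s y powr m) has_real_derivative dird tvec V (t, y)) (at t)"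
      using DERIV_t_line[OF diffV[OF t, of y]] by (simp add: V)
    ultimately have "dird tvec V (t, y) = m * u t y powr (m - 1) * laplacian (\<lambda>z. V (t, z)) y"
      unfolding V by (rule DERIV_unique[symmetric])
    moreover have "u t y powr (m - 1) = V (t, y) powr \<theta>"
      using m_pos by (simp add: V \<theta>_def powr_powr right_diff_distrib)
    ultimately show ?thesis
      using laplacian_eq_dird[of V t y] diffV[OF t] diffV1[OF t] by simp
  qed
  interpret pressure_eq V m \<theta>
    by unfold_locales (use C3V m_pos eqV u_pos in \<open>auto simp: V less_imp_le less_imp_neq[symmetric]\<close>)

  obtain B where B: "\<And>t y. t \<ge> 0 \<Longrightarrow> u t y \<le> B"
    using u_bounded unfolding bounded_iff by (fastforce simp: abs_le_iff)
  have contU: "continuous_on ({0..} \<times> UNIV) U"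
    using U_smooth[of 0] by simp
  have contV: "continuous_on ({0..} \<times> UNIV) V"
    unfolding V_def using contU u_pos
    by (intro continuous_on_powr continuous_on_const) (auto simp: U_def less_imp_neq[symmetric])
  have cont0: "continuous_on UNIV (u 0)"
  proof -
    have "continuous_on UNIV (U \<circ> (\<lambda>y. (0, y)))"
      by (intro continuous_on_compose continuous_intros continuous_on_subset[OF contU]) auto
    then show ?thesis by (simp add: o_def)
  qed
  define L where "L = (if h > 0 then Linf_norm (\<lambda>y. u 0 y powr h) else Linf_norm (u 0) powr h)"
  \<comment> \<open>An upper bound for \<open>u 0\<close> whose power \<open>h\<close> is the
    constant in the claim. Being independent of the exponent, it stays valid when \<open>h\<close>
    is approximated by \<open>a\<close>.\<close>
  obtain M where M: "M > 0" "\<And>y. u 0 y \<le> M" "M powr h = L"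
  proof (cases "h > 0")
    case True
    have c: "continuous_on UNIV (\<lambda>y. u 0 y powr h)"
      by (intro continuous_on_powr continuous_on_const cont0) (use u_pos in \<open>auto simp: less_imp_neq[symmetric]\<close>)
    have "\<bar>u 0 y powr h\<bar> \<le> B powr h" for y
      using u_pos[of 0 y] B[of 0 y] True by (simp add: powr_mono2)
    from le_Linf_norm[OF c this] have le: "u 0 y powr h \<le> L" for y
      using True by (simp add: L_def)
    have L: "L > 0" using le[of 0] u_pos[of 0 0] by (smt (verit) powr_gt_zero)
    show ?thesis
    proof (rule that[of "L powr (1 / h)"])
      show "u 0 y \<le> L powr (1 / h)" for y
        using powr_mono2[OF _ _ le, of "1 / h" y] u_pos[of 0 y] True by (simp add: powr_powr)
    qed (use L True in \<open>auto simp: powr_powr\<close>)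
  next
    case False
    have "\<bar>u 0 y\<bar> \<le> B" for y using u_pos[of 0 y] B[of 0 y] by simp
    from le_Linf_norm[OF cont0 this] have le: "u 0 y \<le> Linf_norm (u 0)" for y
      using u_pos[of 0 y] by (simp add: abs_le_iff)
    have "Linf_norm (u 0) > 0" using u_pos[of 0 0] le[of 0] by linarith
    then show ?thesis
      by (rule that[of "Linf_norm (u 0)"]) (use le False in \<open>auto simp: L_def\<close>)
  qed
  have VN: "V (t, y) \<le> M powr m" if "t \<ge> 0" for t y
  proof (rule weak_maximum_principle[OF contV _ _ _ that])
    show "V (t, y) \<le> B powr m" if "t \<ge> 0" for t y
      unfolding V using B[OF that] u_pos[OF that] m_pos by (intro powr_mono2) (auto intro: less_imp_le)
    show "V (0, y) \<le> M powr m" for y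
      unfolding V using M u_pos[of 0] m_pos by (intro powr_mono2) (auto intro: less_imp_le)
  qed (use M in simp)

  define G where "G = (norm (gradient (u T) x))\<^sup>2"
  define w where "w = u T x"
  have w: "w > 0" using u_pos T_pos by (simp add: w_def)
  have G: "(\<Sum>i\<in>UNIV. (D1 i (T, x))\<^sup>2) = m\<^sup>2 * w powr (2 * m - 2) * G"
  proof -
    have D1: "D1 i (T, x) = m * w powr (m - 1) * dird (xvec i) U (T, x)" for i
    proof -
      have U': "((\<lambda>r. U (T, x + r *\<^sub>R axis i 1)) has_real_derivative dird (xvec i) U (T, x)) (at 0)"
        using DERIV_x_line[of U T x 0 i] diffU[OF T_pos] by simp
      have "((\<lambda>r. V (T, x + r *\<^sub>R axis i 1)) has_real_derivative m * w powr (m - 1) * dird (xvec i) U (T, x)) (at 0)"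
        using DERIV_powr_chain[OF U', of m] w by (simp add: V w_def)
      moreover have "((\<lambda>r. V (T, x + r *\<^sub>R axis i 1)) has_real_derivative D1 i (T, x)) (at 0)"
        using DERIV_x_line[of V T x 0 i] diffV[OF T_pos] by simp
      ultimately show ?thesis by (rule DERIV_unique[symmetric])
    qed
    have "G = (\<Sum>i\<in>UNIV. (dird (xvec i) U (T, x))\<^sup>2)"
      using norm_gradient_sq[OF diffU[OF T_pos, of x]] by (simp add: G_def)
    moreover have "(w powr (m - 1))\<^sup>2 = w powr (2 * m - 2)"
      using w by (simp add: power2_eq_square flip: powr_add)
    ultimately show ?thesis
      unfolding D1 by (simp add: power_mult_distrib sum_distrib_left)
  qed
  define r where "r = sqrt (1 - (real CARD('n) - 1) * (m - 1)\<^sup>2)"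
  have disc: "(real CARD('n) - 1) * (m - 1)\<^sup>2 < 1"
    by (rule discriminant_pos[OF _ m_range]) simp_all
  have r: "r > 0" "r\<^sup>2 = 1 - (real CARD('n) - 1) * (m - 1)\<^sup>2"
    using disc by (simp_all add: r_def)
  \<comment> \<open>Divided by m^2, the condition |a - m| < r says that the quartic coefficient for
    \<open>k = a / m\<close> is negative.\<close>
  have interior: "\<bar>a\<bar> * T * m\<^sup>2 * (w powr (m + a - 3) * G) + sgn a * w powr a \<le> sgn a * M powr a"
    if a: "a \<noteq> 0" "\<bar>a - m\<bar> < r" for a
  proof -
    define k where "k = a / m"
    have k: "k \<noteq> 0" "m * k = a" using a m_pos by (auto simp: k_def)
    have cond: "(k - 1)\<^sup>2 + (real CARD('n) - 1) * \<theta>\<^sup>2 < (1 - \<theta>)\<^sup>2"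
    proof -
      have "\<bar>a - m\<bar>\<^sup>2 < r\<^sup>2" using a(2) by (intro power_strict_mono) auto
      then have "((a - m)\<^sup>2 + (real CARD('n) - 1) * (m - 1)\<^sup>2) / m\<^sup>2 < 1 / m\<^sup>2"
        using r m_pos by (intro divide_strict_right_mono) auto
      moreover have "k - 1 = (a - m) / m" "\<theta> = (m - 1) / m" "1 - \<theta> = 1 / m"
        using m_pos by (auto simp: k_def \<theta>_def field_simps)
      ultimately show ?thesis by (simp add: power_divide add_divide_distrib)
    qed
    have sg: "sgn k = sgn a" using m_pos by (simp add: k_def sgn_divide)
    have mk: "m * \<bar>k\<bar> = \<bar>a\<bar>" using m_pos by (simp add: k_def)
    have ex: "V (T, x) powr (k + \<theta> - 2) * (\<Sum>i\<in>UNIV. (D1 i (T, x))\<^sup>2) = m\<^sup>2 * (w powr (m + a - 3) * G)"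
    proof -
      have *: "m * (k + \<theta> - 2) + (2 * m - 2) = m + a - 3"
        using m_pos by (simp add: k_def \<theta>_def field_simps)
      have "V (T, x) powr (k + \<theta> - 2) * w powr (2 * m - 2) = w powr (m + a - 3)"
        by (simp only: V w_def[symmetric] powr_powr powr_add[symmetric] *)
      then show ?thesis unfolding G by (simp add: mult_ac)
    qed
    have "V (T, x) powr k = w powr a" "(M powr m) powr k = M powr a"
      using k by (simp_all add: V w_def powr_powr)
    then have bound: "\<bar>a\<bar> * (T - t0) * (m\<^sup>2 * (w powr (m + a - 3) * G)) + sgn a * w powr a \<le> sgn a * M powr a"
      if "0 < t0" "t0 < T" for t0
      using gradient_bound_interior[OF that _ k(1) cond, of "M powr m" x] VN
      unfolding ex mk sg by simp
    show ?thesis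
    proof (rule tendsto_upperbound)
      show "((\<lambda>t0. \<bar>a\<bar> * (T - t0) * (m\<^sup>2 * (w powr (m + a - 3) * G)) + sgn a * w powr a)
          \<longlongrightarrow> \<bar>a\<bar> * T * m\<^sup>2 * (w powr (m + a - 3) * G) + sgn a * w powr a) (at_right 0)"
        by (auto intro!: tendsto_eq_intros simp: mult_ac)
      show "\<forall>\<^sub>F t0 in at_right 0. \<bar>a\<bar> * (T - t0) * (m\<^sup>2 * (w powr (m + a - 3) * G)) + sgn a * w powr a \<le> sgn a * M powr a"
        using eventually_at_right_real[OF T_pos] by eventually_elim (use bound in auto)
    qed simp
  qed
  have closed: "\<bar>h\<bar> * T * m\<^sup>2 * (w powr (m + h - 3) * G) + sgn h * w powr h - sgn h * M powr h \<le> 0"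
  proof (rule tendsto_upperbound)
    \<comment> \<open>The segment from the centre \<open>m\<close> of the interval to
      \<open>h\<close> stays in the interior for s < 1, and near s = 1 its points have the sign of
      \<open>h\<close>, which excludes the exponent 0.\<close>
    define a where "a s = m + s * (h - m)" for s
    have a: "(a \<longlongrightarrow> h) (at_left 1)"
      unfolding a_def by (auto intro!: tendsto_eq_intros)
    show "((\<lambda>s. \<bar>a s\<bar> * T * m\<^sup>2 * (w powr (m + a s - 3) * G) + sgn h * w powr a s - sgn h * M powr a s)
      \<longlongrightarrow> \<bar>h\<bar> * T * m\<^sup>2 * (w powr (m + h - 3) * G) + sgn h * w powr h - sgn h * M powr h) (at_left 1)"
      using w M(1) by (intro tendsto_intros a) auto
    have "\<forall>\<^sub>F s in at_left 1. sgn (a s) = sgn h"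
    proof (cases "h > 0")
      case True
      from order_tendstoD(1)[OF a this] show ?thesis by eventually_elim (use True in simp)
    next
      case False
      then have "h < 0" using h_nonzero by simp
      from order_tendstoD(2)[OF a this] show ?thesis by eventually_elim (use \<open>h < 0\<close> in simp)
    qed
    moreover have "\<forall>\<^sub>F s in at_left 1. s \<in> {0<..<1::real}"
      by (rule eventually_at_left_real) simp
    ultimately show "\<forall>\<^sub>F s in at_left 1. \<bar>a s\<bar> * T * m\<^sup>2 * (w powr (m + a s - 3) * G) + sgn h * w powr a s
        - sgn h * M powr a s \<le> 0"
    proof eventually_elim
      case (elim s)
      have "a s \<noteq> 0" using elim(1) h_nonzero by (metis sgn_eq_0_iff)
      moreover have "\<bar>a s - m\<bar> < r"
      proof -
        have "\<bar>h - m\<bar> \<le> r" using h_range by (auto simp: hminus_def hplus_def r_def)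
        then have "s * \<bar>h - m\<bar> \<le> s * r" using elim(2) by (intro mult_left_mono) auto
        also have "\<dots> < r" using elim(2) r(1) by simp
        finally show ?thesis using elim(2) by (simp add: a_def abs_mult)
      qed
      ultimately show ?case using interior[of "a s"] elim(1) by simp
    qed
  qed simp
  show ?thesis
    unfolding G_def[symmetric] w_def[symmetric] L_def[symmetric] M(3)[symmetric]
  proof (cases "h > 0")
    case True
    then have "w powr (m + h - 3) * G * (T * h * m\<^sup>2) \<le> M powr h - w powr h"
      using closed by (simp add: mult_ac)
    then show "w powr (m + h - 3) * G \<le> (M powr h - w powr h) / (T * h * m\<^sup>2)"
      using True T_pos m_pos by (simp add: pos_le_divide_eq)
  next
    case False
    then have h: "h < 0" using h_nonzero by simp
    then have "M powr h - w powr h \<le> w powr (m + h - 3) * G * (T * h * m\<^sup>2)"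
      using closed by (simp add: mult_ac)
    moreover have "T * h * m\<^sup>2 < 0" using h T_pos m_pos by (simp add: mult_pos_neg mult_neg_pos)
    ultimately show "w powr (m + h - 3) * G \<le> (M powr h - w powr h) / (T * h * m\<^sup>2)"
      by (simp add: neg_le_divide_eq)
  qed
qed

end
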